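(* Let $\mathcal{G}$ be an $\mathcal{O}_X^\times$-gerbe over $\mathsf{C}/X$. A connective structure on $\mathcal{G}$ amounts to the datum of a structure, on $\mathcal{G}$, of gerbe bound by the complex $$\Gamma:\quad \mathcal{O}_X^\times \xrightarrow{\ d\log\ } \Omega^1_X .$$
   Context: $X$ is a smooth scheme or a complex analytic manifold, and $\mathsf{C}/X$ is a site of spaces over $X$ with fiber products (e.g. the small Zariski, étale or analytic site) on which the sheaves $\mathcal{O}_X$, $\mathcal{O}_X^\times$ (invertible functions), $\Omega^1_X$ (1-forms) are defined and restrict to their usual counterparts on opens. A gerbe $\mathcal{G}$ over $\mathsf{C}/X$ is a stack in groupoids which is locally non-empty and locally connected. For a sheaf of abelian groups $A$, an $A$-gerbe is a gerbe with isomorphisms $a_x:\underline{\mathrm{Aut}}(x)\to A|_U$, natural in $x\in\mathrm{Ob}\,\mathcal{G}_U$. $\mathrm{Tors}(B)$ denotes the gerbe of $B$-torsors; it is a $B$-gerbe. If $\delta:A\to B$ is a homomorphism of abelian sheaves, a $\delta$-morphism from an $A$-gerbe to a $B$-gerbe is a cartesian functor $\mu$ such that the induced maps $\underline{\mathrm{Aut}}(x)\to\underline{\mathrm{Aut}}(\mu(x))$ correspond to $\delta$. A (structure of) gerbe bound by the complex $A\xrightarrow{\delta}B$ is an $A$-gerbe $\mathcal{G}$ equipped with a $\delta$-morphism $\mu:\mathcal{G}\to\mathrm{Tors}(B)$. A connective structure $\mathcal{C}o$ on an $\mathcal{O}_X^\times$-gerbe $\mathcal{G}$ is the datum of an $\Omega^1_U$-torsor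 $\mathcal{C}o(x)$ for each object $x\in\mathcal{G}_U$, subject to: (1) for every isomorphism $f:x\to y$ in $\mathcal{G}_U$ there is an isomorphism $f_*=\mathcal{C}o(f):\mathcal{C}o(x)\to\mathcal{C}o(y)$ of $\Omega^1_U$-torsors; in particular, if $f\in\mathrm{Aut}(x)\simeq\mathcal{O}_X^\times|_U$, then $f_*(\nabla)=\nabla+d\log f$ for each section $\nabla$ of $\mathcal{C}o(x)$; (2) if $g:y\to z$ is another morphism in $\mathcal{G}_U$, then $(gf)_*\simeq g_*f_*$; (3) compatibility with restriction functors: for $\imath:V\to U$ in $\mathsf{C}/X$, with restriction functor $\imath^*:\mathcal{G}_U\to\mathcal{G}_V$, there is a natural isomorphism $\alpha_\imath:\imath^*\circ\mathcal{C}o\Rightarrow\mathcal{C}o\circ\imath^*$, so that for $f:x\to y$ one has $(\imath^*f)_*\circ\alpha_\imath(x)=\alpha_\imath(y)\circ\imath^*(f_* )$; moreover, given $\jmath:W\to V$ and the natural transformations $\varphi_{\imath,\jmath}:\jmath^*\imath^*\to(\imath\jmath)^*$ coming from the fibered structures, the compatibility $\alpha_{\imath\jmath}(x)\circ\varphi_{\imath,\jmath}(\mathcal{C}o(x))=(\varphi_{\imath,\jmath}(x))_*\circ\alpha_\jmath(\imath^*x)\circ\jmath^*\alpha_\imath(x)$ holds. *)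

theory Defs
  imports "HOL-Algebra.Module" "HOL-Algebra.RingHom"
begin

section \<open>Categories, sites and sheaves\<close>

record ('o, 'a) cat =
  Obj :: "'o set"
  Arr :: "'a set"
  Dom :: "'a \<Rightarrow> 'o"
  Cod :: "'a \<Rightarrow> 'o"
  Ident :: "'o \<Rightarrow> 'a"
  Comp :: "'a \<Rightarrow> 'a \<Rightarrow> 'a" (infixl "\<cdot>\<index>" 70)

text \<open>Composition is written in the usual order: \<open>g \<cdot>\<^bsub>C\<^esub> f\<close> is ``first \<open>f\<close>, then \<open>g\<close>''.\<close>

definition arrows :: "('o, 'a, 'm) cat_scheme \<Rightarrow> 'o \<Rightarrow> 'o \<Rightarrow> 'a set" where
  "arrows C x y = {f \<in> Arr C. Dom C f = x \<and> Cod C f = y}"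

locale category =
  fixes C :: "('o, 'a, 'm) cat_scheme"
  assumes Dom_closed: "f \<in> Arr C \<Longrightarrow> Dom C f \<in> Obj C"
    and Cod_closed: "f \<in> Arr C \<Longrightarrow> Cod C f \<in> Obj C"
    and Ident_closed: "x \<in> Obj C \<Longrightarrow> Ident C x \<in> arrows C x x"
    and Comp_closed: "\<lbrakk>f \<in> Arr C; g \<in> Arr C; Dom C g = Cod C f\<rbrakk>
        \<Longrightarrow> g \<cdot>\<^bsub>C\<^esub> f \<in> arrows C (Dom C f) (Cod C g)"
    and Comp_Ident_left: "f \<in> Arr C \<Longrightarrow> Ident C (Cod C f) \<cdot>\<^bsub>C\<^esub> f = f"
    and Comp_Ident_right: "f \<in> Arr C \<Longrightarrow> f \<cdot>\<^bsub>C\<^esub> Ident C (Dom C f) = f"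
    and Comp_assoc: "\<lbrakk>f \<in> Arr C; g \<in> Arr C; h \<in> Arr C; Dom C g = Cod C f; Dom C h = Cod C g\<rbrakk>
        \<Longrightarrow> (h \<cdot>\<^bsub>C\<^esub> g) \<cdot>\<^bsub>C\<^esub> f = h \<cdot>\<^bsub>C\<^esub> (g \<cdot>\<^bsub>C\<^esub> f)"

definition iso_arr :: "('o, 'a, 'm) cat_scheme \<Rightarrow> 'a \<Rightarrow> bool" where
  "iso_arr C f \<longleftrightarrow> f \<in> Arr C \<and> (\<exists>g \<in> arrows C (Cod C f) (Dom C f).
     g \<cdot>\<^bsub>C\<^esub> f = Ident C (Dom C f) \<and> f \<cdot>\<^bsub>C\<^esub> g = Ident C (Cod C f))"

definition is_pullback :: "('o, 'a, 'm) cat_scheme \<Rightarrow> 'a \<Rightarrow> 'a \<Rightarrow> 'a \<Rightarrow> 'a \<Rightarrow> bool" where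
  "is_pullback C f g p q \<longleftrightarrow>
     f \<in> Arr C \<and> g \<in> Arr C \<and> p \<in> Arr C \<and> q \<in> Arr C \<and>
     Cod C f = Cod C g \<and> Dom C p = Dom C q \<and> Cod C p = Dom C f \<and> Cod C q = Dom C g \<and>
     f \<cdot>\<^bsub>C\<^esub> p = g \<cdot>\<^bsub>C\<^esub> q \<and>
     (\<forall>p'\<in>Arr C. \<forall>q'\<in>Arr C. Dom C p' = Dom C q' \<and> Cod C p' = Dom C f \<and> Cod C q' = Dom C g \<and>
        f \<cdot>\<^bsub>C\<^esub> p' = g \<cdot>\<^bsub>C\<^esub> q' \<longrightarrow>
        (\<exists>!h. h \<in> arrows C (Dom C p') (Dom C p) \<and> p \<cdot>\<^bsub>C\<^esub> h = p' \<and> q \<cdot>\<^bsub>C\<^esub> h = q'))"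

record ('o, 'a) site = "('o, 'a) cat" +
  Cov :: "'o \<Rightarrow> 'a set set"

text \<open>A category with fibre products, equipped with a pretopology. Covering families are sets of
  arrows with a common codomain.\<close>

locale site = category C
  for C :: "('o, 'a, 'm) site_scheme" +
  assumes fibre_products: "\<lbrakk>f \<in> Arr C; g \<in> Arr C; Cod C f = Cod C g\<rbrakk>
        \<Longrightarrow> \<exists>p q. is_pullback C f g p q"
    and Cov_arrows: "\<lbrakk>U \<in> Obj C; R \<in> Cov C U; i \<in> R\<rbrakk> \<Longrightarrow> i \<in> Arr C \<and> Cod C i = U"
    and Cov_iso: "iso_arr C i \<Longrightarrow> {i} \<in> Cov C (Cod C i)"
    and Cov_pullback: "\<lbrakk>k \<in> Arr C; R \<in> Cov C (Cod C k); \<forall>i\<in>R. \<exists>p. is_pullback C i k p (q i)\<rbrakk>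
        \<Longrightarrow> q ` R \<in> Cov C (Dom C k)"
    and Cov_trans: "\<lbrakk>U \<in> Obj C; R \<in> Cov C U; \<forall>i\<in>R. S i \<in> Cov C (Dom C i)\<rbrakk>
        \<Longrightarrow> {i \<cdot>\<^bsub>C\<^esub> k | i k. i \<in> R \<and> k \<in> S i} \<in> Cov C U"

text \<open>The site \<open>C/U\<close>. Its objects are the arrows \<open>i : V \<rightarrow> U\<close>; the pair \<open>(i, k)\<close> with
  \<open>k : W \<rightarrow> V\<close> is the arrow \<open>i \<cdot> k \<rightarrow> i\<close> over \<open>U\<close> given by \<open>k\<close>.\<close>

definition slice :: "('o, 'a, 'm) site_scheme \<Rightarrow> 'o \<Rightarrow> ('a, 'a \<times> 'a) site" where
  "slice C U = \<lparr>
     Obj = {i \<in> Arr C. Cod C i = U},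
     Arr = {(i, k). i \<in> Arr C \<and> Cod C i = U \<and> k \<in> Arr C \<and> Cod C k = Dom C i},
     Dom = (\<lambda>(i, k). i \<cdot>\<^bsub>C\<^esub> k),
     Cod = (\<lambda>(i, k). i),
     Ident = (\<lambda>i. (i, Ident C (Dom C i))),
     Comp = (\<lambda>(i, k) (j, l). (i, k \<cdot>\<^bsub>C\<^esub> l)),
     Cov = (\<lambda>i. (\<lambda>R. Pair i ` R) ` Cov C (Dom C i)) \<rparr>"

definition is_presheaf ::
  "('o, 'a, 'm) cat_scheme \<Rightarrow> ('o \<Rightarrow> 's set) \<Rightarrow> ('a \<Rightarrow> 's \<Rightarrow> 's) \<Rightarrow> bool" where
  "is_presheaf C S r \<longleftrightarrow>
     (\<forall>f\<in>Arr C. r f \<in> S (Cod C f) \<rightarrow> S (Dom C f)) \<and>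
     (\<forall>U\<in>Obj C. \<forall>s\<in>S U. r (Ident C U) s = s) \<and>
     (\<forall>f\<in>Arr C. \<forall>g\<in>Arr C. Cod C g = Dom C f \<longrightarrow>
        (\<forall>s\<in>S (Cod C f). r (f \<cdot>\<^bsub>C\<^esub> g) s = r g (r f s)))"

definition is_sheaf ::
  "('o, 'a, 'm) site_scheme \<Rightarrow> ('o \<Rightarrow> 's set) \<Rightarrow> ('a \<Rightarrow> 's \<Rightarrow> 's) \<Rightarrow> bool" where
  "is_sheaf C S r \<longleftrightarrow> is_presheaf C S r \<and>
     (\<forall>U\<in>Obj C. \<forall>R\<in>Cov C U. \<forall>s.
        (\<forall>i\<in>R. s i \<in> S (Dom C i)) \<and>
        (\<forall>i\<in>R. \<forall>j\<in>R. \<forall>p\<in>Arr C. \<forall>q\<in>Arr C.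
           Cod C p = Dom C i \<and> Cod C q = Dom C j \<and> i \<cdot>\<^bsub>C\<^esub> p = j \<cdot>\<^bsub>C\<^esub> q \<longrightarrow> r p (s i) = r q (s j)) \<longrightarrow>
        (\<exists>!t. t \<in> S U \<and> (\<forall>i\<in>R. r i t = s i)))"

definition ab_sheaf ::
  "('o, 'a, 'm) site_scheme \<Rightarrow> ('o \<Rightarrow> ('b, 'z) monoid_scheme) \<Rightarrow> ('a \<Rightarrow> 'b \<Rightarrow> 'b) \<Rightarrow> bool" where
  "ab_sheaf C B r \<longleftrightarrow>
     (\<forall>U\<in>Obj C. comm_group (B U)) \<and>
     (\<forall>f\<in>Arr C. r f \<in> hom (B (Cod C f)) (B (Dom C f))) \<and>
     is_sheaf C (\<lambda>U. carrier (B U)) r"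

definition ab_sheaf_hom ::
  "('o, 'a, 'm) site_scheme \<Rightarrow> ('o \<Rightarrow> ('g, 'y) monoid_scheme) \<Rightarrow> ('a \<Rightarrow> 'g \<Rightarrow> 'g) \<Rightarrow>
   ('o \<Rightarrow> ('b, 'z) monoid_scheme) \<Rightarrow> ('a \<Rightarrow> 'b \<Rightarrow> 'b) \<Rightarrow> ('o \<Rightarrow> 'g \<Rightarrow> 'b) \<Rightarrow> bool" where
  "ab_sheaf_hom C A rA B rB \<delta> \<longleftrightarrow>
     (\<forall>U\<in>Obj C. \<delta> U \<in> hom (A U) (B U)) \<and>
     (\<forall>f\<in>Arr C. \<forall>s\<in>carrier (A (Cod C f)). \<delta> (Dom C f) (rA f s) = rB f (\<delta> (Cod C f) s))"


section \<open>Fibred categories, stacks and gerbes\<close>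

text \<open>A category over \<open>C\<close> with a choice \<open>clv i x\<close> of an arrow over \<open>i : V \<rightarrow> U\<close> with
  target \<open>x\<close>, for every \<open>x\<close> over \<open>U\<close>.\<close>

record ('x, 'f, 'o, 'a) fibcat = "('x, 'f) cat" +
  pObj :: "'x \<Rightarrow> 'o"
  pArr :: "'f \<Rightarrow> 'a"
  clv :: "'a \<Rightarrow> 'x \<Rightarrow> 'f"

definition cartesian ::
  "('o, 'a, 'm) site_scheme \<Rightarrow> ('x, 'f, 'o, 'a, 'n) fibcat_scheme \<Rightarrow> 'f \<Rightarrow> bool" where
  "cartesian C G f \<longleftrightarrow> f \<in> Arr G \<and>
     (\<forall>g\<in>Arr G. \<forall>k\<in>Arr C. Cod G g = Cod G f \<and> Cod C k = Dom C (pArr G f) \<and>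
        pArr G g = pArr G f \<cdot>\<^bsub>C\<^esub> k \<longrightarrow>
        (\<exists>!h. h \<in> arrows G (Dom G g) (Dom G f) \<and> pArr G h = k \<and> f \<cdot>\<^bsub>G\<^esub> h = g))"

locale fibration = base: category C + total: category G
  for C :: "('o, 'a, 'm) site_scheme" and G :: "('x, 'f, 'o, 'a, 'n) fibcat_scheme" +
  assumes pObj_closed: "x \<in> Obj G \<Longrightarrow> pObj G x \<in> Obj C"
    and pArr_closed: "f \<in> Arr G \<Longrightarrow> pArr G f \<in> arrows C (pObj G (Dom G f)) (pObj G (Cod G f))"
    and pArr_Ident: "x \<in> Obj G \<Longrightarrow> pArr G (Ident G x) = Ident C (pObj G x)"
    and pArr_Comp: "\<lbrakk>f \<in> Arr G; g \<in> Arr G; Dom G g = Cod G f\<rbrakk>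
        \<Longrightarrow> pArr G (g \<cdot>\<^bsub>G\<^esub> f) = pArr G g \<cdot>\<^bsub>C\<^esub> pArr G f"
    and clv_over: "\<lbrakk>x \<in> Obj G; i \<in> Arr C; Cod C i = pObj G x\<rbrakk>
        \<Longrightarrow> Cod G (clv G i x) = x \<and> pArr G (clv G i x) = i"
    and clv_cartesian: "\<lbrakk>x \<in> Obj G; i \<in> Arr C; Cod C i = pObj G x\<rbrakk>
        \<Longrightarrow> cartesian C G (clv G i x)"

text \<open>The fibre category \<open>G\<^sub>U\<close>: objects over \<open>U\<close>, and arrows over \<open>id\<^sub>U\<close>.\<close>

definition fib :: "('x, 'f, 'o, 'a, 'n) fibcat_scheme \<Rightarrow> 'o \<Rightarrow> 'x set" where
  "fib G U = {x \<in> Obj G. pObj G x = U}"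

definition vert ::
  "('o, 'a, 'm) site_scheme \<Rightarrow> ('x, 'f, 'o, 'a, 'n) fibcat_scheme \<Rightarrow> 'x \<Rightarrow> 'x \<Rightarrow> 'f set" where
  "vert C G x y = {f \<in> arrows G x y. pArr G f = Ident C (pObj G x)}"

definition vert_arrows ::
  "('o, 'a, 'm) site_scheme \<Rightarrow> ('x, 'f, 'o, 'a, 'n) fibcat_scheme \<Rightarrow> 'f set" where
  "vert_arrows C G = {f \<in> Arr G. pArr G f = Ident C (pObj G (Dom G f))}"

text \<open>The restriction functor \<open>i\<^sup>* : G\<^sub>U \<rightarrow> G\<^sub>V\<close> on objects and on arrows, and the natural
  isomorphism \<open>\<phi>\<^sub>i\<^sub>,\<^sub>j(x) : j\<^sup>* i\<^sup>* x \<rightarrow> (i j)\<^sup>* x\<close>.\<close>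

definition restr_obj :: "('x, 'f, 'o, 'a, 'n) fibcat_scheme \<Rightarrow> 'a \<Rightarrow> 'x \<Rightarrow> 'x" where
  "restr_obj G i x = Dom G (clv G i x)"

definition restr_arr ::
  "('o, 'a, 'm) site_scheme \<Rightarrow> ('x, 'f, 'o, 'a, 'n) fibcat_scheme \<Rightarrow> 'a \<Rightarrow> 'f \<Rightarrow> 'f" where
  "restr_arr C G i f =
     (THE h. h \<in> vert C G (restr_obj G i (Dom G f)) (restr_obj G i (Cod G f)) \<and>
        clv G i (Cod G f) \<cdot>\<^bsub>G\<^esub> h = f \<cdot>\<^bsub>G\<^esub> clv G i (Dom G f))"

definition coh ::
  "('o, 'a, 'm) site_scheme \<Rightarrow> ('x, 'f, 'o, 'a, 'n) fibcat_scheme \<Rightarrow> 'a \<Rightarrow> 'a \<Rightarrow> 'x \<Rightarrow> 'f" where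
  "coh C G i j x =
     (THE h. h \<in> vert C G (restr_obj G j (restr_obj G i x)) (restr_obj G (i \<cdot>\<^bsub>C\<^esub> j) x) \<and>
        clv G (i \<cdot>\<^bsub>C\<^esub> j) x \<cdot>\<^bsub>G\<^esub> h = clv G i x \<cdot>\<^bsub>G\<^esub> clv G j (restr_obj G i x))"

text \<open>The presheaf \<open>Isom(x, y)\<close> on \<open>C/U\<close> for \<open>x, y\<close> over \<open>U\<close>. Its restriction along
  \<open>(i, k) : i \<cdot> k \<rightarrow> i\<close> is \<open>h \<mapsto> \<phi>(y) \<cdot> k\<^sup>* h \<cdot> \<phi>(x)\<^sup>-\<^sup>1\<close>.\<close>

definition Isom :: "('o, 'a, 'm) site_scheme \<Rightarrow> ('x, 'f, 'o, 'a, 'n) fibcat_scheme \<Rightarrow>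
    'x \<Rightarrow> 'x \<Rightarrow> 'a \<Rightarrow> 'f set" where
  "Isom C G x y i = {h \<in> vert C G (restr_obj G i x) (restr_obj G i y). iso_arr G h}"

definition Isom_res :: "('o, 'a, 'm) site_scheme \<Rightarrow> ('x, 'f, 'o, 'a, 'n) fibcat_scheme \<Rightarrow>
    'x \<Rightarrow> 'x \<Rightarrow> 'a \<times> 'a \<Rightarrow> 'f \<Rightarrow> 'f" where
  "Isom_res C G x y = (\<lambda>(i, k) h.
     THE h'. h' \<in> vert C G (restr_obj G (i \<cdot>\<^bsub>C\<^esub> k) x) (restr_obj G (i \<cdot>\<^bsub>C\<^esub> k) y) \<and>
       h' \<cdot>\<^bsub>G\<^esub> coh C G i k x = coh C G i k y \<cdot>\<^bsub>G\<^esub> restr_arr C G k h)"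

text \<open>A descent datum relative to the sieve generated by a covering family \<open>R\<close>: objects \<open>\<xi> i\<close>
  over the source of every \<open>i\<close> in the sieve with a functorial system of arrows
  \<open>g i k : \<xi> (i \<cdot> k) \<rightarrow> \<xi> i\<close> over \<open>k\<close>. In a category fibred in groupoids every arrow is cartesian,
  so that this is a cartesian functor from the sieve to \<open>G\<close>, and a descent datum is effective
  if this functor extends along the inclusion of the sieve in \<open>C/U\<close>.\<close>

definition sieve :: "('o, 'a, 'm) site_scheme \<Rightarrow> 'a set \<Rightarrow> 'a set" where
  "sieve C R = {i \<cdot>\<^bsub>C\<^esub> k | i k. i \<in> R \<and> k \<in> Arr C \<and> Cod C k = Dom C i}"

definition descent_datum :: "('o, 'a, 'm) site_scheme \<Rightarrow> ('x, 'f, 'o, 'a, 'n) fibcat_scheme \<Rightarrow>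
    'a set \<Rightarrow> ('a \<Rightarrow> 'x) \<Rightarrow> ('a \<Rightarrow> 'a \<Rightarrow> 'f) \<Rightarrow> bool" where
  "descent_datum C G R \<xi> g \<longleftrightarrow>
     (\<forall>i\<in>sieve C R. \<xi> i \<in> fib G (Dom C i) \<and> g i (Ident C (Dom C i)) = Ident G (\<xi> i) \<and>
        (\<forall>k\<in>Arr C. Cod C k = Dom C i \<longrightarrow>
           g i k \<in> arrows G (\<xi> (i \<cdot>\<^bsub>C\<^esub> k)) (\<xi> i) \<and> pArr G (g i k) = k \<and>
           (\<forall>l\<in>Arr C. Cod C l = Dom C k \<longrightarrow> g i (k \<cdot>\<^bsub>C\<^esub> l) = g i k \<cdot>\<^bsub>G\<^esub> g (i \<cdot>\<^bsub>C\<^esub> k) l)))"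

definition effective :: "('o, 'a, 'm) site_scheme \<Rightarrow> ('x, 'f, 'o, 'a, 'n) fibcat_scheme \<Rightarrow>
    'o \<Rightarrow> 'a set \<Rightarrow> ('a \<Rightarrow> 'x) \<Rightarrow> ('a \<Rightarrow> 'a \<Rightarrow> 'f) \<Rightarrow> bool" where
  "effective C G U R \<xi> g \<longleftrightarrow> (\<exists>x\<in>fib G U. \<exists>t. \<forall>i\<in>sieve C R.
     t i \<in> arrows G (\<xi> i) x \<and> pArr G (t i) = i \<and>
     (\<forall>k\<in>Arr C. Cod C k = Dom C i \<longrightarrow> t i \<cdot>\<^bsub>G\<^esub> g i k = t (i \<cdot>\<^bsub>C\<^esub> k)))"

locale stack_in_groupoids = site C + fibration C G
  for C :: "('o, 'a, 'm) site_scheme" and G :: "('x, 'f, 'o, 'a, 'n) fibcat_scheme" +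
  assumes vert_iso: "f \<in> vert_arrows C G \<Longrightarrow> iso_arr G f"
    and Isom_sheaf: "\<lbrakk>U \<in> Obj C; x \<in> fib G U; y \<in> fib G U\<rbrakk>
        \<Longrightarrow> is_sheaf (slice C U) (Isom C G x y) (Isom_res C G x y)"
    and descent_effective: "\<lbrakk>U \<in> Obj C; R \<in> Cov C U; descent_datum C G R \<xi> g\<rbrakk>
        \<Longrightarrow> effective C G U R \<xi> g"

locale gerbe = stack_in_groupoids C G
  for C :: "('o, 'a, 'm) site_scheme" and G :: "('x, 'f, 'o, 'a, 'n) fibcat_scheme" +
  assumes locally_nonempty: "U \<in> Obj C \<Longrightarrow> \<exists>R\<in>Cov C U. \<forall>i\<in>R. fib G (Dom C i) \<noteq> {}"
    and locally_connected: "\<lbrakk>U \<in> Obj C; x \<in> fib G U; y \<in> fib G U\<rbrakk>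
        \<Longrightarrow> \<exists>R\<in>Cov C U. \<forall>i\<in>R. Isom C G x y i \<noteq> {}"

definition aut_group :: "('o, 'a, 'm) site_scheme \<Rightarrow> ('x, 'f, 'o, 'a, 'n) fibcat_scheme \<Rightarrow>
    'x \<Rightarrow> 'f monoid" where
  "aut_group C G x = \<lparr>carrier = {f \<in> vert C G x x. iso_arr G f}, mult = Comp G, one = Ident G x\<rparr>"

text \<open>The sheaf isomorphism \<open>Aut(x) \<cong> A|\<^sub>U\<close> is given by the group isomorphisms
  \<open>a (i\<^sup>* x) : Aut(i\<^sup>* x) \<cong> A(V)\<close> for \<open>i : V \<rightarrow> U\<close>. The condition \<open>band_natural\<close> for \<open>f\<close> in a
  fibre is naturality in \<open>x\<close> (invariance under conjugation by \<open>f\<close>), and for \<open>f = clv i x\<close> it is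
  compatibility with restriction.\<close>

locale banded_gerbe = gerbe C G
  for C :: "('o, 'a, 'm) site_scheme" and A :: "'o \<Rightarrow> ('g, 'z) monoid_scheme"
    and rA :: "'a \<Rightarrow> 'g \<Rightarrow> 'g" and G :: "('x, 'f, 'o, 'a, 'n) fibcat_scheme"
    and a :: "'x \<Rightarrow> 'f \<Rightarrow> 'g" +
  assumes band_sheaf: "ab_sheaf C A rA"
    and band_iso: "x \<in> Obj G \<Longrightarrow> a x \<in> iso (aut_group C G x) (A (pObj G x))"
    and band_natural: "\<lbrakk>f \<in> Arr G; u \<in> carrier (aut_group C G (Dom G f));
          v \<in> carrier (aut_group C G (Cod G f)); f \<cdot>\<^bsub>G\<^esub> u = v \<cdot>\<^bsub>G\<^esub> f\<rbrakk>
        \<Longrightarrow> a (Dom G f) u = rA (pArr G f) (a (Cod G f) v)"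

record ('x, 'f, 'y, 'h) fun_data =
  FObj :: "'x \<Rightarrow> 'y"
  FArr :: "'f \<Rightarrow> 'h"

text \<open>The two conditions with \<^const>\<open>extensional\<close> fix the junk values outside of the domains, so
  that equality of HOL functions is equality of the functors.\<close>

definition cartesian_functor :: "('o, 'a, 'm) site_scheme \<Rightarrow>
    ('x, 'f, 'o, 'a, 'n) fibcat_scheme \<Rightarrow> ('y, 'h, 'o, 'a, 'k) fibcat_scheme \<Rightarrow>
    ('x, 'f, 'y, 'h) fun_data \<Rightarrow> bool" where
  "cartesian_functor C G H \<mu> \<longleftrightarrow>
     FObj \<mu> \<in> extensional (Obj G) \<and> FArr \<mu> \<in> extensional (Arr G) \<and>
     (\<forall>x\<in>Obj G. FObj \<mu> x \<in> fib H (pObj G x) \<and> FArr \<mu> (Ident G x) = Ident H (FObj \<mu> x)) \<and>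
     (\<forall>f\<in>Arr G. FArr \<mu> f \<in> arrows H (FObj \<mu> (Dom G f)) (FObj \<mu> (Cod G f)) \<and>
        pArr H (FArr \<mu> f) = pArr G f) \<and>
     (\<forall>f\<in>Arr G. \<forall>g\<in>Arr G. Dom G g = Cod G f \<longrightarrow> FArr \<mu> (g \<cdot>\<^bsub>G\<^esub> f) = FArr \<mu> g \<cdot>\<^bsub>H\<^esub> FArr \<mu> f) \<and>
     (\<forall>f. cartesian C G f \<longrightarrow> cartesian C H (FArr \<mu> f))"

definition delta_morphism :: "('o, 'a, 'm) site_scheme \<Rightarrow>
    ('x, 'f, 'o, 'a, 'n) fibcat_scheme \<Rightarrow> ('x \<Rightarrow> 'f \<Rightarrow> 'g) \<Rightarrow>
    ('y, 'h, 'o, 'a, 'k) fibcat_scheme \<Rightarrow> ('y \<Rightarrow> 'h \<Rightarrow> 'b) \<Rightarrow> ('o \<Rightarrow> 'g \<Rightarrow> 'b) \<Rightarrow>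
    ('x, 'f, 'y, 'h) fun_data \<Rightarrow> bool" where
  "delta_morphism C G aG H aH \<delta> \<mu> \<longleftrightarrow> cartesian_functor C G H \<mu> \<and>
     (\<forall>x\<in>Obj G. \<forall>f\<in>carrier (aut_group C G x).
        aH (FObj \<mu> x) (FArr \<mu> f) = \<delta> (pObj G x) (aG x f))"


section \<open>Torsors\<close>

text \<open>The sections of a torsor take values in a fixed type \<open>'t\<close>, which plays the role of the
  universe of sets in which torsors are formed.\<close>

record ('o, 'a, 'b, 't) torsor =
  Sec :: "'o \<Rightarrow> 't set"
  Res :: "'a \<Rightarrow> 't \<Rightarrow> 't"
  Act :: "'o \<Rightarrow> 't \<Rightarrow> 'b \<Rightarrow> 't"

definition is_torsor :: "('o, 'a, 'm) site_scheme \<Rightarrow> ('o \<Rightarrow> ('b, 'z) monoid_scheme) \<Rightarrow>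
    ('a \<Rightarrow> 'b \<Rightarrow> 'b) \<Rightarrow> ('o, 'a, 'b, 't) torsor \<Rightarrow> bool" where
  "is_torsor D B rB T \<longleftrightarrow>
     is_sheaf D (Sec T) (Res T) \<and>
     (\<forall>U\<in>Obj D. \<forall>s\<in>Sec T U.
        Act T U s \<one>\<^bsub>B U\<^esub> = s \<and>
        (\<forall>b\<in>carrier (B U). Act T U s b \<in> Sec T U \<and>
           (\<forall>c\<in>carrier (B U). Act T U s (b \<otimes>\<^bsub>B U\<^esub> c) = Act T U (Act T U s b) c))) \<and>
     (\<forall>f\<in>Arr D. \<forall>s\<in>Sec T (Cod D f). \<forall>b\<in>carrier (B (Cod D f)).
        Res T f (Act T (Cod D f) s b) = Act T (Dom D f) (Res T f s) (rB f b)) \<and>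
     (\<forall>U\<in>Obj D. \<forall>s\<in>Sec T U. \<forall>t\<in>Sec T U. \<exists>!b. b \<in> carrier (B U) \<and> Act T U s b = t) \<and>
     (\<forall>U\<in>Obj D. \<exists>R\<in>Cov D U. \<forall>i\<in>R. Sec T (Dom D i) \<noteq> {})"

text \<open>Torsors over \<open>U\<close> are torsors on the site \<open>C/U\<close> under \<open>B|\<^sub>U\<close>; they are pulled back along
  \<open>i : V \<rightarrow> U\<close> by composition with \<open>C/V \<rightarrow> C/U\<close>.\<close>

definition torsor_over :: "('o, 'a, 'm) site_scheme \<Rightarrow> ('o \<Rightarrow> ('b, 'z) monoid_scheme) \<Rightarrow>
    ('a \<Rightarrow> 'b \<Rightarrow> 'b) \<Rightarrow> 'o \<Rightarrow> ('a, 'a \<times> 'a, 'b, 't) torsor \<Rightarrow> bool" where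
  "torsor_over C B rB U T \<longleftrightarrow> is_torsor (slice C U) (\<lambda>i. B (Dom C i)) (\<lambda>(i, k). rB k) T"

definition torsor_pullback :: "('o, 'a, 'm) site_scheme \<Rightarrow> 'a \<Rightarrow>
    ('a, 'a \<times> 'a, 'b, 't) torsor \<Rightarrow> ('a, 'a \<times> 'a, 'b, 't) torsor" where
  "torsor_pullback C i T = \<lparr>
     Sec = (\<lambda>j. Sec T (i \<cdot>\<^bsub>C\<^esub> j)),
     Res = (\<lambda>(j, k). Res T (i \<cdot>\<^bsub>C\<^esub> j, k)),
     Act = (\<lambda>j. Act T (i \<cdot>\<^bsub>C\<^esub> j)) \<rparr>"

definition torsor_map :: "('o, 'a, 'm) site_scheme \<Rightarrow> ('o \<Rightarrow> ('b, 'z) monoid_scheme) \<Rightarrow>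
    ('o, 'a, 'b, 't) torsor \<Rightarrow> ('o, 'a, 'b, 't) torsor \<Rightarrow> ('o \<Rightarrow> 't \<Rightarrow> 't) \<Rightarrow> bool" where
  "torsor_map D B S T h \<longleftrightarrow>
     h \<in> (\<Pi>\<^sub>E U\<in>Obj D. Sec S U \<rightarrow>\<^sub>E Sec T U) \<and>
     (\<forall>f\<in>Arr D. \<forall>s\<in>Sec S (Cod D f). h (Dom D f) (Res S f s) = Res T f (h (Cod D f) s)) \<and>
     (\<forall>U\<in>Obj D. \<forall>s\<in>Sec S U. \<forall>b\<in>carrier (B U). h U (Act S U s b) = Act T U (h U s) b)"

text \<open>The fibred category \<open>Tors(B)\<close>. An arrow \<open>(V, S) \<rightarrow> (U, T)\<close> over \<open>i : V \<rightarrow> U\<close> is a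
  morphism of torsors \<open>S \<rightarrow> i\<^sup>* T\<close>.\<close>

record ('o, 'a, 'b, 't) tors_arr =
  t_src :: "'o \<times> ('a, 'a \<times> 'a, 'b, 't) torsor"
  t_tgt :: "'o \<times> ('a, 'a \<times> 'a, 'b, 't) torsor"
  t_base :: 'a
  t_map :: "'a \<Rightarrow> 't \<Rightarrow> 't"

definition Tors :: "('o, 'a, 'm) site_scheme \<Rightarrow> ('o \<Rightarrow> ('b, 'z) monoid_scheme) \<Rightarrow>
    ('a \<Rightarrow> 'b \<Rightarrow> 'b) \<Rightarrow>
    ('o \<times> ('a, 'a \<times> 'a, 'b, 't) torsor, ('o, 'a, 'b, 't) tors_arr, 'o, 'a) fibcat" where
  "Tors C B rB = \<lparr>
     Obj = {(U, T). U \<in> Obj C \<and> torsor_over C B rB U T},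
     Arr = {f. fst (t_src f) \<in> Obj C \<and> torsor_over C B rB (fst (t_src f)) (snd (t_src f)) \<and>
               fst (t_tgt f) \<in> Obj C \<and> torsor_over C B rB (fst (t_tgt f)) (snd (t_tgt f)) \<and>
               t_base f \<in> arrows C (fst (t_src f)) (fst (t_tgt f)) \<and>
               torsor_map (slice C (fst (t_src f))) (\<lambda>i. B (Dom C i)) (snd (t_src f))
                 (torsor_pullback C (t_base f) (snd (t_tgt f))) (t_map f)},
     Dom = t_src,
     Cod = t_tgt,
     Ident = (\<lambda>(U, T). \<lparr>t_src = (U, T), t_tgt = (U, T), t_base = Ident C U,
        t_map = (\<lambda>j\<in>Obj (slice C U). \<lambda>s\<in>Sec T j. s)\<rparr>),
     Comp = (\<lambda>g f. \<lparr>t_src = t_src f, t_tgt = t_tgt g, t_base = t_base g \<cdot>\<^bsub>C\<^esub> t_base f,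
        t_map = (\<lambda>j\<in>Obj (slice C (fst (t_src f))). \<lambda>s\<in>Sec (snd (t_src f)) j.
                   t_map g (t_base f \<cdot>\<^bsub>C\<^esub> j) (t_map f j s))\<rparr>),
     pObj = fst,
     pArr = t_base,
     clv = (\<lambda>i (U, T). \<lparr>t_src = (Dom C i, torsor_pullback C i T), t_tgt = (U, T), t_base = i,
        t_map = (\<lambda>j\<in>Obj (slice C (Dom C i)). \<lambda>s\<in>Sec T (i \<cdot>\<^bsub>C\<^esub> j). s)\<rparr>) \<rparr>"

text \<open>The structure of \<open>B\<close>-gerbe of \<open>Tors(B)\<close>: an automorphism of a torsor over \<open>U\<close> is the
  translation by a unique section of \<open>B\<close> over \<open>U\<close>.\<close>

definition Tors_band :: "('o, 'a, 'm) site_scheme \<Rightarrow> ('o \<Rightarrow> ('b, 'z) monoid_scheme) \<Rightarrow>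
    ('a \<Rightarrow> 'b \<Rightarrow> 'b) \<Rightarrow> 'o \<times> ('a, 'a \<times> 'a, 'b, 't) torsor \<Rightarrow>
    ('o, 'a, 'b, 't) tors_arr \<Rightarrow> 'b" where
  "Tors_band C B rB T f = (THE b. b \<in> carrier (B (fst T)) \<and>
     (\<forall>j\<in>Obj (slice C (fst T)). \<forall>s\<in>Sec (snd T) j.
        t_map f j s = Act (snd T) j s (rB j b)))"

text \<open>The structures of gerbe bound by the complex \<open>\<delta> : A \<rightarrow> B\<close> on a given \<open>A\<close>-gerbe \<open>(G, a)\<close>.\<close>

definition bound_structures :: "('o, 'a, 'm) site_scheme \<Rightarrow>
    ('x, 'f, 'o, 'a, 'n) fibcat_scheme \<Rightarrow> ('x \<Rightarrow> 'f \<Rightarrow> 'g) \<Rightarrow>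
    ('o \<Rightarrow> ('b, 'z) monoid_scheme) \<Rightarrow> ('a \<Rightarrow> 'b \<Rightarrow> 'b) \<Rightarrow> ('o \<Rightarrow> 'g \<Rightarrow> 'b) \<Rightarrow>
    ('x, 'f, 'o \<times> ('a, 'a \<times> 'a, 'b, 't) torsor, ('o, 'a, 'b, 't) tors_arr) fun_data set" where
  "bound_structures C G a B rB \<delta> =
     {\<mu>. delta_morphism C G a (Tors C B rB) (Tors_band C B rB) \<delta> \<mu>}"


section \<open>Functions, forms and the logarithmic derivative\<close>

text \<open>The site \<open>C/X\<close> with the sheaf of rings \<open>O\<close>, the sheaf of \<open>O\<close>-modules \<open>\<Omega>\<^sup>1\<close> and the
  differential \<open>d : O \<rightarrow> \<Omega>\<^sup>1\<close>. The object \<open>X\<close> is terminal, as every object lies over \<open>X\<close> by a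
  unique map. A smooth scheme or a complex manifold \<open>X\<close> is an instance, with its structure
  sheaf, its 1-forms and the exterior derivative.\<close>

locale site_with_forms = site C
  for C :: "('o, 'a, 'm) site_scheme" and X :: 'o
    and \<O> :: "'o \<Rightarrow> ('r, 'y) ring_scheme" and r\<O> :: "'a \<Rightarrow> 'r \<Rightarrow> 'r"
    and \<Omega> :: "'o \<Rightarrow> ('r, 'w, 'z) module_scheme" and r\<Omega> :: "'a \<Rightarrow> 'w \<Rightarrow> 'w"
    and d :: "'o \<Rightarrow> 'r \<Rightarrow> 'w" +
  assumes X_terminal: "X \<in> Obj C" "U \<in> Obj C \<Longrightarrow> \<exists>!f. f \<in> arrows C U X"
    and functions_cring: "U \<in> Obj C \<Longrightarrow> cring (\<O> U)"
    and functions_res: "i \<in> Arr C \<Longrightarrow> r\<O> i \<in> ring_hom (\<O> (Cod C i)) (\<O> (Dom C i))"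
    and functions_sheaf: "is_sheaf C (\<lambda>U. carrier (\<O> U)) r\<O>"
    and forms_module: "U \<in> Obj C \<Longrightarrow> module (\<O> U) (\<Omega> U)"
    and forms_sheaf: "ab_sheaf C (\<lambda>U. add_monoid (\<Omega> U)) r\<Omega>"
    and forms_res_smult: "\<lbrakk>i \<in> Arr C; f \<in> carrier (\<O> (Cod C i)); \<omega> \<in> carrier (\<Omega> (Cod C i))\<rbrakk>
        \<Longrightarrow> r\<Omega> i (f \<odot>\<^bsub>\<Omega> (Cod C i)\<^esub> \<omega>) = r\<O> i f \<odot>\<^bsub>\<Omega> (Dom C i)\<^esub> r\<Omega> i \<omega>"
    and d_hom: "U \<in> Obj C \<Longrightarrow> d U \<in> hom (add_monoid (\<O> U)) (add_monoid (\<Omega> U))"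
    and d_Leibniz: "\<lbrakk>U \<in> Obj C; f \<in> carrier (\<O> U); g \<in> carrier (\<O> U)\<rbrakk>
        \<Longrightarrow> d U (f \<otimes>\<^bsub>\<O> U\<^esub> g) = f \<odot>\<^bsub>\<Omega> U\<^esub> d U g \<oplus>\<^bsub>\<Omega> U\<^esub> g \<odot>\<^bsub>\<Omega> U\<^esub> d U f"
    and d_res: "\<lbrakk>i \<in> Arr C; f \<in> carrier (\<O> (Cod C i))\<rbrakk>
        \<Longrightarrow> d (Dom C i) (r\<O> i f) = r\<Omega> i (d (Cod C i) f)"

abbreviation invertibles :: "('o \<Rightarrow> ('r, 'y) ring_scheme) \<Rightarrow> 'o \<Rightarrow> 'r monoid" where
  "invertibles \<O> \<equiv> \<lambda>U. units_of (\<O> U)"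

abbreviation forms :: "('o \<Rightarrow> ('r, 'w, 'z) module_scheme) \<Rightarrow> 'o \<Rightarrow> ('w, _) monoid_scheme" where
  "forms \<Omega> \<equiv> \<lambda>U. add_monoid (\<Omega> U)"

definition dlog :: "('o \<Rightarrow> ('r, 'y) ring_scheme) \<Rightarrow> ('o \<Rightarrow> ('r, 'w, 'z) module_scheme) \<Rightarrow>
    ('o \<Rightarrow> 'r \<Rightarrow> 'w) \<Rightarrow> 'o \<Rightarrow> 'r \<Rightarrow> 'w" where
  "dlog \<O> \<Omega> d U f = inv\<^bsub>\<O> U\<^esub> f \<odot>\<^bsub>\<Omega> U\<^esub> d U f"

text \<open>\<open>d log : O\<^sup>\<times> \<rightarrow> \<Omega>\<^sup>1\<close> is a complex of sheaves of abelian groups.\<close>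

lemma (in category) CompD: "\<lbrakk>f \<in> Arr C; g \<in> Arr C; Dom C g = Cod C f\<rbrakk>
  \<Longrightarrow> g \<cdot>\<^bsub>C\<^esub> f \<in> Arr C \<and> Dom C (g \<cdot>\<^bsub>C\<^esub> f) = Dom C f \<and> Cod C (g \<cdot>\<^bsub>C\<^esub> f) = Cod C g"
  using Comp_closed by (auto simp: arrows_def)

lemma (in site_with_forms) res_Units:
  assumes "i \<in> Arr C" "f \<in> Units (\<O> (Cod C i))"
  shows "r\<O> i f \<in> Units (\<O> (Dom C i))"
    and "r\<O> i (inv\<^bsub>\<O> (Cod C i)\<^esub> f) = inv\<^bsub>\<O> (Dom C i)\<^esub> (r\<O> i f)"
proof -
  interpret c: cring "\<O> (Cod C i)" by (rule functions_cring[OF Cod_closed[OF assms(1)]])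
  interpret c': cring "\<O> (Dom C i)" by (rule functions_cring[OF Dom_closed[OF assms(1)]])
  interpret h: ring_hom_ring "\<O> (Cod C i)" "\<O> (Dom C i)" "r\<O> i"
    by (rule ring_hom_ringI2[OF c.ring_axioms c'.ring_axioms functions_res[OF assms(1)]])
  let ?g = "inv\<^bsub>\<O> (Cod C i)\<^esub> f"
  have c: "f \<in> carrier (\<O> (Cod C i))" "?g \<in> carrier (\<O> (Cod C i))" using assms(2) by auto
  have 1: "r\<O> i f \<otimes>\<^bsub>\<O> (Dom C i)\<^esub> r\<O> i ?g = \<one>\<^bsub>\<O> (Dom C i)\<^esub>"
    using assms(2) c by (metis c.Units_r_inv h.hom_mult h.hom_one)
  then show "r\<O> i ?g = inv\<^bsub>\<O> (Dom C i)\<^esub> (r\<O> i f)"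
    using c by (metis c'.comm_inv_char h.hom_closed)
  show "r\<O> i f \<in> Units (\<O> (Dom C i))"
    using 1 c h.hom_closed by (auto simp: Units_def c'.m_comm intro!: bexI[of _ "r\<O> i ?g"])
qed

lemma (in site_with_forms) invertibles_sheaf: "ab_sheaf C (invertibles \<O>) r\<O>"
  unfolding ab_sheaf_def
proof (intro conjI ballI)
  fix U assume "U \<in> Obj C"
  then interpret cring "\<O> U" by (rule functions_cring)
  show "comm_group (invertibles \<O> U)" by (rule units_comm_group)
next
  fix i assume i: "i \<in> Arr C"
  interpret c: cring "\<O> (Cod C i)" by (rule functions_cring[OF Cod_closed[OF i]])
  show "r\<O> i \<in> hom (invertibles \<O> (Cod C i)) (invertibles \<O> (Dom C i))"
    using res_Units(1)[OF i] functions_res[OF i]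
    by (intro homI) (auto simp: units_of_carrier units_of_mult ring_hom_mult c.Units_closed)
next
  have units: "Units (\<O> U) \<subseteq> carrier (\<O> U)" for U by (auto simp: Units_def)
  have sh: "is_presheaf C (\<lambda>U. carrier (\<O> U)) r\<O>"
    using functions_sheaf by (simp add: is_sheaf_def)
  show "is_sheaf C (\<lambda>U. carrier (invertibles \<O> U)) r\<O>"
    unfolding is_sheaf_def units_of_carrier
  proof (intro conjI ballI allI impI, goal_cases)
    case 1
    show ?case using sh units res_Units(1) unfolding is_presheaf_def by (auto simp: subset_iff)
  next
    case (2 U R s)
    interpret cring "\<O> U" by (rule functions_cring[OF 2(1)])
    have R: "i \<in> Arr C" "Cod C i = U" if "i \<in> R" for i using Cov_arrows[OF 2(1,2) that] by auto
    have su: "s i \<in> Units (\<O> (Dom C i))" if "i \<in> R" for i using 2(3) that by blast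
    have glue: "\<exists>!t. t \<in> carrier (\<O> U) \<and> (\<forall>i\<in>R. r\<O> i t = s' i)"
      if "\<And>i. i \<in> R \<Longrightarrow> s' i \<in> carrier (\<O> (Dom C i))"
        and "\<And>i j p q. \<lbrakk>i \<in> R; j \<in> R; p \<in> Arr C; q \<in> Arr C; Cod C p = Dom C i;
            Cod C q = Dom C j; i \<cdot>\<^bsub>C\<^esub> p = j \<cdot>\<^bsub>C\<^esub> q\<rbrakk> \<Longrightarrow> r\<O> p (s' i) = r\<O> q (s' j)" for s'
      using functions_sheaf[unfolded is_sheaf_def, THEN conjunct2, THEN bspec, OF 2(1),
          THEN bspec, OF 2(2), THEN spec, of s'] that by blast
    have m: "r\<O> p (s i) = r\<O> q (s j)" if "i \<in> R" "j \<in> R" "p \<in> Arr C" "q \<in> Arr C"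
      "Cod C p = Dom C i" "Cod C q = Dom C j" "i \<cdot>\<^bsub>C\<^esub> p = j \<cdot>\<^bsub>C\<^esub> q" for i j p q
      using 2(3) that by blast
    have ex: "\<exists>!t. t \<in> carrier (\<O> U) \<and> (\<forall>i\<in>R. r\<O> i t = s i)"
      using su units by (intro glue) (auto intro: m)
    then obtain t where t: "t \<in> carrier (\<O> U)" "\<And>i. i \<in> R \<Longrightarrow> r\<O> i t = s i" by blast
    have "\<exists>!t. t \<in> carrier (\<O> U) \<and> (\<forall>i\<in>R. r\<O> i t = inv\<^bsub>\<O> (Dom C i)\<^esub> s i)"
    proof (rule glue)
      fix i assume "i \<in> R"
      then interpret i: cring "\<O> (Dom C i)" using R by (intro functions_cring Dom_closed)
      show "inv\<^bsub>\<O> (Dom C i)\<^esub> s i \<in> carrier (\<O> (Dom C i))" using su[OF \<open>i \<in> R\<close>] by simp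
    next
      fix i j p q assume a: "i \<in> R" "j \<in> R" "p \<in> Arr C" "q \<in> Arr C"
        "Cod C p = Dom C i" "Cod C q = Dom C j" "i \<cdot>\<^bsub>C\<^esub> p = j \<cdot>\<^bsub>C\<^esub> q"
      have "Dom C p = Dom C q"
        using a R CompD[of p i] CompD[of q j] by simp
      then show "r\<O> p (inv\<^bsub>\<O> (Dom C i)\<^esub> s i) = r\<O> q (inv\<^bsub>\<O> (Dom C j)\<^esub> s j)"
        using res_Units(2)[OF a(3), of "s i"] res_Units(2)[OF a(4), of "s j"] a su m[OF a] by simp
    qed
    then obtain t' where t': "t' \<in> carrier (\<O> U)"
      "\<And>i. i \<in> R \<Longrightarrow> r\<O> i t' = inv\<^bsub>\<O> (Dom C i)\<^esub> s i" by blast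
    have "\<exists>!t. t \<in> carrier (\<O> U) \<and> (\<forall>i\<in>R. r\<O> i t = \<one>\<^bsub>\<O> (Dom C i)\<^esub>)"
    proof (rule glue)
      fix i assume "i \<in> R"
      then interpret i: cring "\<O> (Dom C i)" using R by (intro functions_cring Dom_closed)
      show "\<one>\<^bsub>\<O> (Dom C i)\<^esub> \<in> carrier (\<O> (Dom C i))" by simp
    next
      fix i j p q assume a: "i \<in> R" "j \<in> R" "p \<in> Arr C" "q \<in> Arr C"
        "Cod C p = Dom C i" "Cod C q = Dom C j" "i \<cdot>\<^bsub>C\<^esub> p = j \<cdot>\<^bsub>C\<^esub> q"
      have "Dom C p = Dom C q"
        using a R CompD[of p i] CompD[of q j] by simp
      then show "r\<O> p \<one>\<^bsub>\<O> (Dom C i)\<^esub> = r\<O> q \<one>\<^bsub>\<O> (Dom C j)\<^esub>"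
        using ring_hom_one[OF functions_res[OF a(3)]] ring_hom_one[OF functions_res[OF a(4)]] a by simp
    qed
    moreover have "r\<O> i (t \<otimes>\<^bsub>\<O> U\<^esub> t') = \<one>\<^bsub>\<O> (Dom C i)\<^esub> \<and> r\<O> i \<one>\<^bsub>\<O> U\<^esub> = \<one>\<^bsub>\<O> (Dom C i)\<^esub>" if "i \<in> R" for i
    proof -
      interpret i: cring "\<O> (Dom C i)" using R that by (intro functions_cring Dom_closed)
      have "r\<O> i \<in> ring_hom (\<O> U) (\<O> (Dom C i))" using functions_res R that by metis
      then show ?thesis using t t' that su by (auto simp: ring_hom_mult ring_hom_one)
    qed
    ultimately have "t \<otimes>\<^bsub>\<O> U\<^esub> t' = \<one>\<^bsub>\<O> U\<^esub>" using t(1) t'(1) by (metis m_closed one_closed)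
    then have "t \<in> Units (\<O> U)" using t(1) t'(1) by (auto simp: Units_def m_comm intro!: bexI[of _ t'])
    then show ?case using t ex units by blast
  qed
qed

lemma (in site_with_forms) dlog_sheaf_hom:
  "ab_sheaf_hom C (invertibles \<O>) r\<O> (forms \<Omega>) r\<Omega> (dlog \<O> \<Omega> d)"
  unfolding ab_sheaf_hom_def
proof (intro conjI ballI)
  fix U assume U: "U \<in> Obj C"
  interpret module "\<O> U" "\<Omega> U" by (rule forms_module[OF U])
  have d: "d U f \<in> carrier (\<Omega> U)" if "f \<in> carrier (\<O> U)" for f
    using d_hom[OF U] that by (auto simp: hom_def)
  show "dlog \<O> \<Omega> d U \<in> hom (invertibles \<O> U) (forms \<Omega> U)"
  proof (rule homI)
    fix f assume "f \<in> carrier (invertibles \<O> U)"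
    then show "dlog \<O> \<Omega> d U f \<in> carrier (forms \<Omega> U)"
      using d by (simp add: dlog_def units_of_carrier R.Units_closed)
  next
    fix f g assume "f \<in> carrier (invertibles \<O> U)" "g \<in> carrier (invertibles \<O> U)"
    then have u: "f \<in> Units (\<O> U)" "g \<in> Units (\<O> U)" by (simp_all add: units_of_carrier)
    then have c: "f \<in> carrier (\<O> U)" "g \<in> carrier (\<O> U)" "inv\<^bsub>\<O> U\<^esub> f \<in> carrier (\<O> U)"
        "inv\<^bsub>\<O> U\<^esub> g \<in> carrier (\<O> U)"
      by auto
    have i: "inv\<^bsub>\<O> U\<^esub> (f \<otimes>\<^bsub>\<O> U\<^esub> g) = inv\<^bsub>\<O> U\<^esub> f \<otimes>\<^bsub>\<O> U\<^esub> inv\<^bsub>\<O> U\<^esub> g"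
    proof (rule R.comm_inv_char)
      have "f \<otimes>\<^bsub>\<O> U\<^esub> g \<otimes>\<^bsub>\<O> U\<^esub> (inv\<^bsub>\<O> U\<^esub> f \<otimes>\<^bsub>\<O> U\<^esub> inv\<^bsub>\<O> U\<^esub> g)
          = (f \<otimes>\<^bsub>\<O> U\<^esub> inv\<^bsub>\<O> U\<^esub> f) \<otimes>\<^bsub>\<O> U\<^esub> (g \<otimes>\<^bsub>\<O> U\<^esub> inv\<^bsub>\<O> U\<^esub> g)"
        using c by (simp add: R.m_ac)
      then show "f \<otimes>\<^bsub>\<O> U\<^esub> g \<otimes>\<^bsub>\<O> U\<^esub> (inv\<^bsub>\<O> U\<^esub> f \<otimes>\<^bsub>\<O> U\<^esub> inv\<^bsub>\<O> U\<^esub> g) = \<one>\<^bsub>\<O> U\<^esub>"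
        using u by simp
    qed (use c in simp_all)
    have "inv\<^bsub>\<O> U\<^esub> f \<otimes>\<^bsub>\<O> U\<^esub> inv\<^bsub>\<O> U\<^esub> g \<otimes>\<^bsub>\<O> U\<^esub> f
        = inv\<^bsub>\<O> U\<^esub> g \<otimes>\<^bsub>\<O> U\<^esub> (inv\<^bsub>\<O> U\<^esub> f \<otimes>\<^bsub>\<O> U\<^esub> f)"
      "inv\<^bsub>\<O> U\<^esub> f \<otimes>\<^bsub>\<O> U\<^esub> inv\<^bsub>\<O> U\<^esub> g \<otimes>\<^bsub>\<O> U\<^esub> g
        = inv\<^bsub>\<O> U\<^esub> f \<otimes>\<^bsub>\<O> U\<^esub> (inv\<^bsub>\<O> U\<^esub> g \<otimes>\<^bsub>\<O> U\<^esub> g)"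
      using c by (simp_all add: R.m_ac)
    then have *: "inv\<^bsub>\<O> U\<^esub> f \<otimes>\<^bsub>\<O> U\<^esub> inv\<^bsub>\<O> U\<^esub> g \<otimes>\<^bsub>\<O> U\<^esub> f = inv\<^bsub>\<O> U\<^esub> g"
      "inv\<^bsub>\<O> U\<^esub> f \<otimes>\<^bsub>\<O> U\<^esub> inv\<^bsub>\<O> U\<^esub> g \<otimes>\<^bsub>\<O> U\<^esub> g = inv\<^bsub>\<O> U\<^esub> f"
      using c u by simp_all
    show "dlog \<O> \<Omega> d U (f \<otimes>\<^bsub>invertibles \<O> U\<^esub> g) =
        dlog \<O> \<Omega> d U f \<otimes>\<^bsub>forms \<Omega> U\<^esub> dlog \<O> \<Omega> d U g"
      using c d u by (simp add: dlog_def units_of_mult i d_Leibniz[OF U] smult_r_distr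
          smult_assoc1[symmetric] * M.a_comm)
  qed
next
  fix i f assume i: "i \<in> Arr C" and f: "f \<in> carrier (invertibles \<O> (Cod C i))"
  interpret c: cring "\<O> (Cod C i)" by (rule functions_cring[OF Cod_closed[OF i]])
  have u: "f \<in> Units (\<O> (Cod C i))" using f by (simp add: units_of_carrier)
  have "d (Cod C i) f \<in> carrier (\<Omega> (Cod C i))"
    using d_hom[OF Cod_closed[OF i]] u by (auto simp: hom_def)
  then show "dlog \<O> \<Omega> d (Dom C i) (r\<O> i f) = r\<Omega> i (dlog \<O> \<Omega> d (Cod C i) f)"
    using u i by (simp add: dlog_def forms_res_smult d_res res_Units(2) c.Units_closed)
qed


section \<open>Connective structures\<close>

text \<open>\<open>Co x\<close> is the torsor of an object \<open>x\<close>, \<open>push f\<close> is \<open>f\<^sub>*\<close>, and \<open>alp (i, x)\<close> is the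
  isomorphism \<open>\<alpha>\<^sub>i(x) : i\<^sup>* Co(x) \<rightarrow> Co(i\<^sup>* x)\<close>.\<close>

record ('x, 'f, 'a, 'y, 'h) conn_data =
  Co :: "'x \<Rightarrow> 'y"
  push :: "'f \<Rightarrow> 'h"
  alp :: "'a \<times> 'x \<Rightarrow> 'h"

definition restr_pairs :: "('o, 'a, 'm) site_scheme \<Rightarrow> ('x, 'f, 'o, 'a, 'n) fibcat_scheme \<Rightarrow>
    ('a \<times> 'x) set" where
  "restr_pairs C G = {(i, x). i \<in> Arr C \<and> x \<in> Obj G \<and> Cod C i = pObj G x}"

text \<open>The isomorphisms of \<open>B|\<^sub>U\<close>-torsors are the invertible arrows of the fibre of \<open>Tors(B)\<close>
  over \<open>U\<close>; \<open>B\<close> is \<open>\<Omega>\<^sup>1\<close> and \<open>\<delta>\<close> is \<open>d log\<close>.\<close>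

definition is_connective :: "('o, 'a, 'm) site_scheme \<Rightarrow>
    ('x, 'f, 'o, 'a, 'n) fibcat_scheme \<Rightarrow> ('x \<Rightarrow> 'f \<Rightarrow> 'g) \<Rightarrow>
    ('o \<Rightarrow> ('b, 'z) monoid_scheme) \<Rightarrow> ('a \<Rightarrow> 'b \<Rightarrow> 'b) \<Rightarrow> ('o \<Rightarrow> 'g \<Rightarrow> 'b) \<Rightarrow>
    ('x, 'f, 'a, 'o \<times> ('a, 'a \<times> 'a, 'b, 't) torsor, ('o, 'a, 'b, 't) tors_arr) conn_data
    \<Rightarrow> bool" where
  "is_connective C G a B rB \<delta> \<C> \<longleftrightarrow>
     (let \<T> = Tors C B rB in
     Co \<C> \<in> extensional (Obj G) \<and> push \<C> \<in> extensional (vert_arrows C G) \<and>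
     alp \<C> \<in> extensional (restr_pairs C G) \<and>
     (\<forall>x\<in>Obj G. Co \<C> x \<in> fib \<T> (pObj G x)) \<and>
     (\<forall>x\<in>Obj G. \<forall>y\<in>Obj G. \<forall>f\<in>vert C G x y. iso_arr G f \<longrightarrow>
        push \<C> f \<in> vert C \<T> (Co \<C> x) (Co \<C> y) \<and> iso_arr \<T> (push \<C> f)) \<and>
     (\<forall>x\<in>Obj G. \<forall>f\<in>carrier (aut_group C G x).
        \<forall>j\<in>Obj (slice C (pObj G x)). \<forall>s\<in>Sec (snd (Co \<C> x)) j.
          t_map (push \<C> f) j s = Act (snd (Co \<C> x)) j s (rB j (\<delta> (pObj G x) (a x f)))) \<and>
     (\<forall>x\<in>Obj G. \<forall>y\<in>Obj G. \<forall>z\<in>Obj G. \<forall>f\<in>vert C G x y. \<forall>g\<in>vert C G y z.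
        push \<C> (g \<cdot>\<^bsub>G\<^esub> f) = push \<C> g \<cdot>\<^bsub>\<T>\<^esub> push \<C> f) \<and>
     (\<forall>(i, x)\<in>restr_pairs C G.
        alp \<C> (i, x) \<in> vert C \<T> (restr_obj \<T> i (Co \<C> x)) (Co \<C> (restr_obj G i x)) \<and>
        iso_arr \<T> (alp \<C> (i, x))) \<and>
     (\<forall>x\<in>Obj G. \<forall>y\<in>Obj G. \<forall>f\<in>vert C G x y. \<forall>i\<in>Arr C. Cod C i = pObj G x \<longrightarrow>
        push \<C> (restr_arr C G i f) \<cdot>\<^bsub>\<T>\<^esub> alp \<C> (i, x)
          = alp \<C> (i, y) \<cdot>\<^bsub>\<T>\<^esub> restr_arr C \<T> i (push \<C> f)) \<and>
     (\<forall>(i, x)\<in>restr_pairs C G. \<forall>j\<in>Arr C. Cod C j = Dom C i \<longrightarrow>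
        alp \<C> (i \<cdot>\<^bsub>C\<^esub> j, x) \<cdot>\<^bsub>\<T>\<^esub> coh C \<T> i j (Co \<C> x)
          = push \<C> (coh C G i j x) \<cdot>\<^bsub>\<T>\<^esub>
              (alp \<C> (j, restr_obj G i x) \<cdot>\<^bsub>\<T>\<^esub> restr_arr C \<T> j (alp \<C> (i, x)))))"

definition connective_structures :: "('o, 'a, 'm) site_scheme \<Rightarrow>
    ('x, 'f, 'o, 'a, 'n) fibcat_scheme \<Rightarrow> ('x \<Rightarrow> 'f \<Rightarrow> 'r) \<Rightarrow>
    ('o \<Rightarrow> ('r, 'y) ring_scheme) \<Rightarrow> ('o \<Rightarrow> ('r, 'w, 'z) module_scheme) \<Rightarrow> ('a \<Rightarrow> 'w \<Rightarrow> 'w) \<Rightarrow>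
    ('o \<Rightarrow> 'r \<Rightarrow> 'w) \<Rightarrow>
    ('x, 'f, 'a, 'o \<times> ('a, 'a \<times> 'a, 'w, 't) torsor, ('o, 'a, 'w, 't) tors_arr) conn_data set" where
  "connective_structures C G a \<O> \<Omega> r\<Omega> d =
     {\<C>. is_connective C G a (forms \<Omega>) r\<Omega> (dlog \<O> \<Omega> d) \<C>}"

text \<open>The datum carried by a cartesian functor \<open>\<mu> : G \<rightarrow> H\<close>: the objects \<open>\<mu>(x)\<close>, the action of
  \<open>\<mu>\<close> on the arrows of the fibres, and the comparison of the arrow \<open>\<mu>(clv i x)\<close> with the chosen
  cartesian arrow \<open>i\<^sup>* \<mu>(x) \<rightarrow> \<mu>(x)\<close>.\<close>

definition conn_of :: "('o, 'a, 'm) site_scheme \<Rightarrow>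
    ('x, 'f, 'o, 'a, 'n) fibcat_scheme \<Rightarrow> ('y, 'h, 'o, 'a, 'k) fibcat_scheme \<Rightarrow>
    ('x, 'f, 'y, 'h) fun_data \<Rightarrow> ('x, 'f, 'a, 'y, 'h) conn_data" where
  "conn_of C G H \<mu> = \<lparr>
     Co = FObj \<mu>,
     push = restrict (FArr \<mu>) (vert_arrows C G),
     alp = (\<lambda>(i, x)\<in>restr_pairs C G.
        THE h. h \<in> vert C H (restr_obj H i (FObj \<mu> x)) (FObj \<mu> (restr_obj G i x)) \<and>
          FArr \<mu> (clv G i x) \<cdot>\<^bsub>H\<^esub> h = clv H i (FObj \<mu> x)) \<rparr>"

end

theory Submission
  imports Defs
begin

text \<open>
  A connective structure and a \<open>d log\<close>-morphism \<open>\<mu> : G \<rightarrow> Tors(\<Omega>\<^sup>1)\<close> are the same thing written in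
  two languages. Removing the condition on automorphisms, a connective structure is a pseudonatural
  transformation from \<open>U \<mapsto> G\<^sub>U\<close> to \<open>U \<mapsto> Tors(\<Omega>\<^sup>1)\<^sub>U\<close>: a functor \<open>Co\<close> on each fibre with comparison
  isomorphisms \<open>\<alpha>\<^sub>i(x) : i\<^sup>* Co(x) \<rightarrow> Co(i\<^sup>* x)\<close>. Removing the same condition, a \<open>d log\<close>-morphism is a
  cartesian functor of fibred categories. Such data correspond to each other for every fibred category
  \<open>H\<close> in place of \<open>Tors(\<Omega>\<^sup>1)\<close> (\<open>bij_betw_conn_of\<close>), for the following reason.

  An arrow \<open>f\<close> of \<open>G\<close> over \<open>i\<close> with target \<open>y\<close> is uniquely \<open>clv i y \<sqdot> h\<close> with \<open>h\<close> in a fibre. Hence a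
  cartesian functor \<open>\<mu>\<close> is determined by its values on the fibres and on the arrows \<open>clv i y\<close>. The arrow
  \<open>\<mu>(clv i y)\<close> is cartesian over \<open>i\<close> with target \<open>\<mu>(y)\<close>, as is \<open>clv i \<mu>(y)\<close>, so that it amounts to the
  isomorphism \<open>\<alpha>\<^sub>i(y)\<close> with \<open>\<mu>(clv i y) \<sqdot> \<alpha>\<^sub>i(y) = clv i \<mu>(y)\<close>. Conversely \<open>Co\<close> and \<open>\<alpha>\<close> define
  \<open>\<mu>(f) = clv i Co(y) \<sqdot> \<alpha>\<^sub>i(y)\<^sup>-\<^sup>1 \<sqdot> h\<^sub>*\<close>. To compose two such arrows one has to move a fibre arrow across
  some \<open>clv i y\<close>, which is the naturality of \<open>\<alpha>\<close>, and to compare \<open>clv j z \<sqdot> clv i (j\<^sup>* z)\<close> with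
  \<open>clv (j i) z\<close>, which is the compatibility of \<open>\<alpha>\<close> with \<open>\<phi>\<close>. The identities are preserved although no axiom
  says so: \<open>\<mu>(id)\<close> is idempotent and invertible.

  It remains to match the conditions on automorphisms. By definition the band of \<open>Tors(B)\<close> sends an
  automorphism of a torsor to the section of \<open>B\<close> by which it translates. Such a section exists and is
  unique (\<open>ex1_translation\<close>): where the torsor has a section the translation is read off from it,
  independently of the section as \<open>B\<close> is commutative, and these local translations glue as \<open>B\<close> is a sheaf. So
  \<open>band (\<mu>(f)) = d log (a(f))\<close> says the same as \<open>f\<^sub>* \<nabla> = \<nabla> + d log (a(f))\<close>.
\<close>

section \<open>Isomorphisms and cartesian arrows\<close>

text \<open>The inverse of a non-invertible arrow is arbitrary. Inverses are unique, so that the choice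
  does not matter for the others.\<close>

definition inverse_arr :: "('o, 'a, 'm) cat_scheme \<Rightarrow> 'a \<Rightarrow> 'a" where
  "inverse_arr C f = (SOME g. g \<in> arrows C (Cod C f) (Dom C f) \<and>
     g \<cdot>\<^bsub>C\<^esub> f = Ident C (Dom C f) \<and> f \<cdot>\<^bsub>C\<^esub> g = Ident C (Cod C f))"

context category
begin

lemma Ident_simps:
  "x \<in> Obj C \<Longrightarrow> Ident C x \<in> Arr C \<and> Dom C (Ident C x) = x \<and> Cod C (Ident C x) = x"
  using Ident_closed by (simp add: arrows_def)

lemma inverse_arr:
  assumes "iso_arr C f"
  shows "f \<in> Arr C" "inverse_arr C f \<in> Arr C"
    "Dom C (inverse_arr C f) = Cod C f" "Cod C (inverse_arr C f) = Dom C f"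
    "inverse_arr C f \<cdot>\<^bsub>C\<^esub> f = Ident C (Dom C f)" "f \<cdot>\<^bsub>C\<^esub> inverse_arr C f = Ident C (Cod C f)"
proof -
  have "\<exists>g. g \<in> arrows C (Cod C f) (Dom C f) \<and>
     g \<cdot>\<^bsub>C\<^esub> f = Ident C (Dom C f) \<and> f \<cdot>\<^bsub>C\<^esub> g = Ident C (Cod C f)"
    using assms by (auto simp: iso_arr_def)
  from someI_ex[OF this] show "inverse_arr C f \<in> Arr C"
    "Dom C (inverse_arr C f) = Cod C f" "Cod C (inverse_arr C f) = Dom C f"
    "inverse_arr C f \<cdot>\<^bsub>C\<^esub> f = Ident C (Dom C f)" "f \<cdot>\<^bsub>C\<^esub> inverse_arr C f = Ident C (Cod C f)"
    by (simp_all add: inverse_arr_def arrows_def)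
  show "f \<in> Arr C" using assms by (simp add: iso_arr_def)
qed

lemma iso_arrI:
  assumes "f \<in> Arr C" "g \<in> Arr C" "Dom C g = Cod C f" "Cod C g = Dom C f"
    "g \<cdot>\<^bsub>C\<^esub> f = Ident C (Dom C f)" "f \<cdot>\<^bsub>C\<^esub> g = Ident C (Cod C f)"
  shows "iso_arr C f"
  using assms by (auto simp: iso_arr_def arrows_def)

lemma iso_inverse_arr: "iso_arr C f \<Longrightarrow> iso_arr C (inverse_arr C f)"
  using inverse_arr[of f] by (intro iso_arrI[of _ f]) auto

text \<open>The two cancellation rules below are stated for right-nested composites, the normal form
  under associativity, and can thus be used for rewriting.\<close>

lemma iso_inverse_Comp:
  assumes "iso_arr C f" "g \<in> Arr C" "Cod C g = Dom C f"
  shows "inverse_arr C f \<cdot>\<^bsub>C\<^esub> (f \<cdot>\<^bsub>C\<^esub> g) = g"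
proof -
  note i = inverse_arr[OF assms(1)]
  have "inverse_arr C f \<cdot>\<^bsub>C\<^esub> (f \<cdot>\<^bsub>C\<^esub> g) = (inverse_arr C f \<cdot>\<^bsub>C\<^esub> f) \<cdot>\<^bsub>C\<^esub> g"
    using i assms Comp_assoc[of g f "inverse_arr C f"] by simp
  then show ?thesis using i assms Comp_Ident_left[of g] by simp
qed

lemma iso_Comp_inverse:
  assumes "iso_arr C f" "g \<in> Arr C" "Cod C g = Cod C f"
  shows "f \<cdot>\<^bsub>C\<^esub> (inverse_arr C f \<cdot>\<^bsub>C\<^esub> g) = g"
proof -
  note i = inverse_arr[OF assms(1)]
  have "f \<cdot>\<^bsub>C\<^esub> (inverse_arr C f \<cdot>\<^bsub>C\<^esub> g) = (f \<cdot>\<^bsub>C\<^esub> inverse_arr C f) \<cdot>\<^bsub>C\<^esub> g"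
    using i assms Comp_assoc[of g "inverse_arr C f" f] by simp
  then show ?thesis using i assms Comp_Ident_left[of g] by simp
qed

lemma iso_cancel_left:
  assumes "iso_arr C f" "g \<in> Arr C" "h \<in> Arr C" "Cod C g = Dom C f" "Cod C h = Dom C f"
    "f \<cdot>\<^bsub>C\<^esub> g = f \<cdot>\<^bsub>C\<^esub> h"
  shows "g = h"
  using iso_inverse_Comp[OF assms(1)] assms by metis

lemma iso_cancel_right:
  assumes "iso_arr C f" "g \<in> Arr C" "h \<in> Arr C" "Dom C g = Cod C f" "Dom C h = Cod C f"
    "g \<cdot>\<^bsub>C\<^esub> f = h \<cdot>\<^bsub>C\<^esub> f"
  shows "g = h"
proof -
  note i = inverse_arr[OF assms(1)]
  have "k = (k \<cdot>\<^bsub>C\<^esub> f) \<cdot>\<^bsub>C\<^esub> inverse_arr C f" if "k \<in> Arr C" "Dom C k = Cod C f" for k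
    using i that Comp_Ident_right[of k] by (simp add: Comp_assoc)
  then show ?thesis using assms by metis
qed

lemma iso_Comp:
  assumes "iso_arr C f" "iso_arr C g" "Dom C g = Cod C f"
  shows "iso_arr C (g \<cdot>\<^bsub>C\<^esub> f)"
proof (rule iso_arrI)
  note i = inverse_arr[OF assms(1)] and j = inverse_arr[OF assms(2)]
  let ?h = "inverse_arr C f \<cdot>\<^bsub>C\<^esub> inverse_arr C g"
  show "g \<cdot>\<^bsub>C\<^esub> f \<in> Arr C" "?h \<in> Arr C" "Dom C ?h = Cod C (g \<cdot>\<^bsub>C\<^esub> f)" "Cod C ?h = Dom C (g \<cdot>\<^bsub>C\<^esub> f)"
    using i j assms by (simp_all add: CompD)
  show "?h \<cdot>\<^bsub>C\<^esub> (g \<cdot>\<^bsub>C\<^esub> f) = Ident C (Dom C (g \<cdot>\<^bsub>C\<^esub> f))"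
    using i j assms by (simp add: CompD Comp_assoc iso_inverse_Comp)
  show "(g \<cdot>\<^bsub>C\<^esub> f) \<cdot>\<^bsub>C\<^esub> ?h = Ident C (Cod C (g \<cdot>\<^bsub>C\<^esub> f))"
    using i j assms by (simp add: CompD Comp_assoc iso_Comp_inverse)
qed

text \<open>This is what yields preservation of identities from preservation of composition.\<close>

lemma idempotent_iso_is_Ident:
  assumes "iso_arr C f" "Cod C f = Dom C f" "f \<cdot>\<^bsub>C\<^esub> f = f"
  shows "f = Ident C (Dom C f)"
proof (rule iso_cancel_left[OF assms(1)])
  have f: "f \<in> Arr C" by (rule inverse_arr(1)[OF assms(1)])
  then have "Dom C f \<in> Obj C" by (rule Dom_closed)
  then show "f \<in> Arr C" "Ident C (Dom C f) \<in> Arr C" "Cod C f = Dom C f"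
    "Cod C (Ident C (Dom C f)) = Dom C f"
    using f assms by (simp_all add: Ident_simps)
  show "f \<cdot>\<^bsub>C\<^esub> f = f \<cdot>\<^bsub>C\<^esub> Ident C (Dom C f)" using f assms Comp_Ident_right by simp
qed

end

text \<open>The factor \<open>h\<close> of \<open>f = clv i y \<sqdot> h\<close> in the fibre over the source of \<open>i\<close>.\<close>

definition vertical_part :: "('o, 'a, 'm) site_scheme \<Rightarrow> ('x, 'f, 'o, 'a, 'n) fibcat_scheme \<Rightarrow>
    'f \<Rightarrow> 'f" where
  "vertical_part C G f =
     (THE h. h \<in> vert C G (Dom G f) (restr_obj G (pArr G f) (Cod G f)) \<and>
        clv G (pArr G f) (Cod G f) \<cdot>\<^bsub>G\<^esub> h = f)"

context fibration
begin

lemma pArr_simps: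
  "f \<in> Arr G \<Longrightarrow> pArr G f \<in> Arr C \<and> Dom C (pArr G f) = pObj G (Dom G f) \<and>
     Cod C (pArr G f) = pObj G (Cod G f)"
  using pArr_closed[of f] by (simp add: arrows_def)

lemma vertD:
  assumes "f \<in> vert C G x y"
  shows "f \<in> Arr G \<and> Dom G f = x \<and> Cod G f = y \<and> pArr G f = Ident C (pObj G x) \<and>
    x \<in> Obj G \<and> y \<in> Obj G \<and> pObj G y = pObj G x"
proof -
  have f: "f \<in> Arr G" "Dom G f = x" "Cod G f = y" "pArr G f = Ident C (pObj G x)"
    using assms by (simp_all add: vert_def arrows_def)
  then have "x \<in> Obj G" "y \<in> Obj G" using total.Dom_closed total.Cod_closed by blast+
  moreover have "pObj G y = pObj G x"
    using pArr_simps[OF f(1)] f base.Ident_simps[OF pObj_closed[OF \<open>x \<in> Obj G\<close>]] by simp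
  ultimately show ?thesis using f by simp
qed

lemma vert_simps: "f \<in> vert C G x y \<Longrightarrow> f \<in> Arr G \<and> Dom G f = x \<and> Cod G f = y"
  by (simp add: vert_def arrows_def)

lemma vertI:
  "\<lbrakk>f \<in> Arr G; Dom G f = x; Cod G f = y; pArr G f = Ident C (pObj G x)\<rbrakk> \<Longrightarrow> f \<in> vert C G x y"
  by (simp add: vert_def arrows_def)

lemma vert_Ident: "x \<in> Obj G \<Longrightarrow> Ident G x \<in> vert C G x x"
  by (simp add: vertI total.Ident_simps pArr_Ident)

lemma vert_Comp:
  assumes "f \<in> vert C G x y" "g \<in> vert C G y z"
  shows "g \<cdot>\<^bsub>G\<^esub> f \<in> vert C G x z"
  using vertD[OF assms(1)] vertD[OF assms(2)] base.Comp_Ident_left[of "Ident C (pObj G x)"]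
    base.Ident_simps[OF pObj_closed, of x]
  by (intro vertI) (simp_all add: total.CompD pArr_Comp)

lemma vert_inverse:
  assumes "f \<in> vert C G x y" "iso_arr G f"
  shows "inverse_arr G f \<in> vert C G y x"
proof (rule vertI)
  note i = total.inverse_arr[OF assms(2)] and f = vertD[OF assms(1)]
  then show a: "inverse_arr G f \<in> Arr G" "Dom G (inverse_arr G f) = y" "Cod G (inverse_arr G f) = x"
    by simp_all
  have "pArr G (inverse_arr G f) \<cdot>\<^bsub>C\<^esub> pArr G f = Ident C (pObj G x)"
    using i f pArr_Comp[of f "inverse_arr G f"] pArr_Ident[of x] by simp
  then show "pArr G (inverse_arr G f) = Ident C (pObj G y)"
    using f base.Comp_Ident_right[of "pArr G (inverse_arr G f)"] pArr_simps[OF a(1)] a by simp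
qed

lemma clv_simps:
  assumes "i \<in> Arr C" "x \<in> Obj G" "Cod C i = pObj G x"
  shows "clv G i x \<in> Arr G \<and> Dom G (clv G i x) = restr_obj G i x \<and> Cod G (clv G i x) = x \<and>
    pArr G (clv G i x) = i \<and> restr_obj G i x \<in> Obj G \<and> pObj G (restr_obj G i x) = Dom C i"
proof -
  have 1: "clv G i x \<in> Arr G" using clv_cartesian[of x i] assms by (simp add: cartesian_def)
  then show ?thesis using clv_over[of x i] assms pArr_simps[OF 1] total.Dom_closed[OF 1]
    by (simp add: restr_obj_def)
qed

lemma cartesian_ex1:
  "\<lbrakk>cartesian C G f; g \<in> Arr G; k \<in> Arr C; Cod G g = Cod G f; Cod C k = Dom C (pArr G f);
     pArr G g = pArr G f \<cdot>\<^bsub>C\<^esub> k\<rbrakk>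
   \<Longrightarrow> \<exists>!h. h \<in> arrows G (Dom G g) (Dom G f) \<and> pArr G h = k \<and> f \<cdot>\<^bsub>G\<^esub> h = g"
  unfolding cartesian_def by blast

lemma cartesian_cancel:
  assumes "cartesian C G f" "h \<in> Arr G" "h' \<in> Arr G" "Cod G h = Dom G f" "Cod G h' = Dom G f"
    "pArr G h = pArr G h'" "f \<cdot>\<^bsub>G\<^esub> h = f \<cdot>\<^bsub>G\<^esub> h'"
  shows "h = h'"
proof -
  have f: "f \<in> Arr G" using assms(1) by (simp add: cartesian_def)
  note c = total.CompD[OF assms(2) f] total.CompD[OF assms(3) f]
  have d: "Dom G h' = Dom G h" using c assms by metis
  have "\<exists>!k. k \<in> arrows G (Dom G (f \<cdot>\<^bsub>G\<^esub> h)) (Dom G f) \<and> pArr G k = pArr G h \<and> f \<cdot>\<^bsub>G\<^esub> k = f \<cdot>\<^bsub>G\<^esub> h"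
    using c assms pArr_simps[OF assms(2)] pArr_simps[OF f] pArr_Comp[OF assms(2) f]
    by (intro cartesian_ex1[OF assms(1)]) simp_all
  then show ?thesis using c assms d by (auto simp: arrows_def)
qed

lemma cartesian_lift:
  assumes "cartesian C G f" "g \<in> Arr G" "Cod G g = Cod G f" "pArr G g = pArr G f"
  obtains h where "h \<in> vert C G (Dom G g) (Dom G f)" "f \<cdot>\<^bsub>G\<^esub> h = g"
proof -
  have f: "f \<in> Arr G" using assms(1) by (simp add: cartesian_def)
  let ?k = "Ident C (pObj G (Dom G f))"
  have "pObj G (Dom G f) \<in> Obj C" using f total.Dom_closed pObj_closed by blast
  then have k: "?k \<in> Arr C" "Cod C ?k = Dom C (pArr G f)" "pArr G g = pArr G f \<cdot>\<^bsub>C\<^esub> ?k"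
    using base.Ident_simps pArr_simps[OF f] base.Comp_Ident_right[of "pArr G f"] assms by simp_all
  have d: "pObj G (Dom G g) = pObj G (Dom G f)"
    using pArr_simps[OF f] pArr_simps[OF assms(2)] assms by simp
  have "\<exists>!h. h \<in> arrows G (Dom G g) (Dom G f) \<and> pArr G h = ?k \<and> f \<cdot>\<^bsub>G\<^esub> h = g"
    using k by (intro cartesian_ex1 assms) simp_all
  then show thesis using that d by (auto simp: vert_def)
qed

lemma vert_cartesian_cancel:
  assumes "cartesian C G f" "h \<in> vert C G x (Dom G f)" "h' \<in> vert C G x' (Dom G f)"
    "f \<cdot>\<^bsub>G\<^esub> h = f \<cdot>\<^bsub>G\<^esub> h'"
  shows "h = h'"
proof (rule cartesian_cancel[OF assms(1)])
  show "h \<in> Arr G" "h' \<in> Arr G" "Cod G h = Dom G f" "Cod G h' = Dom G f" "f \<cdot>\<^bsub>G\<^esub> h = f \<cdot>\<^bsub>G\<^esub> h'"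
    using vertD[OF assms(2)] vertD[OF assms(3)] assms by simp_all
  show "pArr G h = pArr G h'" using vertD[OF assms(2)] vertD[OF assms(3)] by simp
qed

lemma vert_cartesian_ex1:
  assumes "cartesian C G f" "g \<in> Arr G" "Cod G g = Cod G f" "pArr G g = pArr G f"
  shows "\<exists>!h. h \<in> vert C G (Dom G g) (Dom G f) \<and> f \<cdot>\<^bsub>G\<^esub> h = g"
  using cartesian_lift[OF assms] vert_cartesian_cancel[OF assms(1)] by metis

text \<open>Two cartesian arrows with the same target and the same image in the base differ by an
  isomorphism of the fibre: the lift of each along the other is inverse to \<open>h\<close>.\<close>

lemma cartesian_comparison_iso:
  assumes f: "cartesian C G f" and g: "cartesian C G (f \<cdot>\<^bsub>G\<^esub> h)" and h: "h \<in> vert C G x (Dom G f)"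
  shows "iso_arr G h"
proof -
  have fA: "f \<in> Arr G" using f by (simp add: cartesian_def)
  note hd = vertD[OF h]
  have x: "Dom G (f \<cdot>\<^bsub>G\<^esub> h) = x" "Cod G (f \<cdot>\<^bsub>G\<^esub> h) = Cod G f" using hd fA total.CompD by simp_all
  have "pArr G (f \<cdot>\<^bsub>G\<^esub> h) = pArr G f"
    using hd fA pArr_Comp[of h f] pArr_simps[OF fA] base.Comp_Ident_right[of "pArr G f"] by simp
  then obtain k where k: "k \<in> vert C G (Dom G f) x" "f \<cdot>\<^bsub>G\<^esub> h \<cdot>\<^bsub>G\<^esub> k = f"
    using cartesian_lift[OF g fA] x by metis
  note kd = vertD[OF k(1)]
  have 1: "h \<cdot>\<^bsub>G\<^esub> k = Ident G (Dom G f)"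
  proof (rule vert_cartesian_cancel[OF f vert_Comp[OF k(1) h] vert_Ident])
    show "Dom G f \<in> Obj G" using hd by simp
    show "f \<cdot>\<^bsub>G\<^esub> (h \<cdot>\<^bsub>G\<^esub> k) = f \<cdot>\<^bsub>G\<^esub> Ident G (Dom G f)"
      using k hd kd fA by (simp add: total.Comp_assoc[symmetric] total.Comp_Ident_right)
  qed
  have 2: "k \<cdot>\<^bsub>G\<^esub> h = Ident G x"
  proof (rule vert_cartesian_cancel[OF g, unfolded x, OF vert_Comp[OF h k(1)] vert_Ident])
    show "x \<in> Obj G" using hd by simp
    have "f \<cdot>\<^bsub>G\<^esub> h \<cdot>\<^bsub>G\<^esub> (k \<cdot>\<^bsub>G\<^esub> h) = f \<cdot>\<^bsub>G\<^esub> h \<cdot>\<^bsub>G\<^esub> k \<cdot>\<^bsub>G\<^esub> h"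
      using hd kd fA x by (simp add: total.Comp_assoc total.CompD)
    also have "\<dots> = f \<cdot>\<^bsub>G\<^esub> h \<cdot>\<^bsub>G\<^esub> Ident G x"
      using k hd fA x total.CompD[of h f] total.Comp_Ident_right[of "f \<cdot>\<^bsub>G\<^esub> h"] by simp
    finally show "f \<cdot>\<^bsub>G\<^esub> h \<cdot>\<^bsub>G\<^esub> (k \<cdot>\<^bsub>G\<^esub> h) = f \<cdot>\<^bsub>G\<^esub> h \<cdot>\<^bsub>G\<^esub> Ident G x" .
  qed
  show ?thesis using hd kd 1 2 by (intro total.iso_arrI[of _ k]) simp_all
qed

lemma cartesian_Comp_iso:
  assumes f: "cartesian C G f" and h: "h \<in> vert C G x (Dom G f)" "iso_arr G h"
  shows "cartesian C G (f \<cdot>\<^bsub>G\<^esub> h)"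
  unfolding cartesian_def
proof (intro conjI ballI impI)
  have fA: "f \<in> Arr G" using f by (simp add: cartesian_def)
  note hd = vertD[OF h(1)] and hi = vertD[OF vert_inverse[OF h]]
  show "f \<cdot>\<^bsub>G\<^esub> h \<in> Arr G" using hd fA by (simp add: total.CompD)
  have p: "pArr G (f \<cdot>\<^bsub>G\<^esub> h) = pArr G f" "Dom G (f \<cdot>\<^bsub>G\<^esub> h) = x" "Cod G (f \<cdot>\<^bsub>G\<^esub> h) = Cod G f"
    using hd fA pArr_Comp[of h f] pArr_simps[OF fA] base.Comp_Ident_right[of "pArr G f"]
    by (simp_all add: total.CompD)
  fix g k assume g: "g \<in> Arr G" and k: "k \<in> Arr C" and
    "Cod G g = Cod G (f \<cdot>\<^bsub>G\<^esub> h) \<and> Cod C k = Dom C (pArr G (f \<cdot>\<^bsub>G\<^esub> h)) \<and> pArr G g = pArr G (f \<cdot>\<^bsub>G\<^esub> h) \<cdot>\<^bsub>C\<^esub> k"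
  then have a: "Cod G g = Cod G f" "Cod C k = Dom C (pArr G f)" "pArr G g = pArr G f \<cdot>\<^bsub>C\<^esub> k"
    using p by simp_all
  have ex: "\<exists>!u. u \<in> arrows G (Dom G g) (Dom G f) \<and> pArr G u = k \<and> f \<cdot>\<^bsub>G\<^esub> u = g"
    by (rule cartesian_ex1[OF f g k a])
  then obtain u where u: "u \<in> Arr G" "Dom G u = Dom G g" "Cod G u = Dom G f" "pArr G u = k"
      "f \<cdot>\<^bsub>G\<^esub> u = g"
    by (auto simp: arrows_def)
  have vert_k: "Ident C (pObj G x) \<cdot>\<^bsub>C\<^esub> k = k"
    using hd a pArr_simps[OF fA] base.Comp_Ident_left[OF k] by simp
  show "\<exists>!u. u \<in> arrows G (Dom G g) (Dom G (f \<cdot>\<^bsub>G\<^esub> h)) \<and> pArr G u = k \<and> f \<cdot>\<^bsub>G\<^esub> h \<cdot>\<^bsub>G\<^esub> u = g"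
  proof (rule ex1I[of _ "inverse_arr G h \<cdot>\<^bsub>G\<^esub> u"], intro conjI)
    show "inverse_arr G h \<cdot>\<^bsub>G\<^esub> u \<in> arrows G (Dom G g) (Dom G (f \<cdot>\<^bsub>G\<^esub> h))"
      using u hi hd p by (simp add: arrows_def total.CompD)
    show "pArr G (inverse_arr G h \<cdot>\<^bsub>G\<^esub> u) = k"
      using u hi hd vert_k by (simp add: pArr_Comp)
    show "f \<cdot>\<^bsub>G\<^esub> h \<cdot>\<^bsub>G\<^esub> (inverse_arr G h \<cdot>\<^bsub>G\<^esub> u) = g"
      using u hi hd fA h by (simp add: total.Comp_assoc total.CompD total.iso_Comp_inverse)
  next
    fix v assume "v \<in> arrows G (Dom G g) (Dom G (f \<cdot>\<^bsub>G\<^esub> h)) \<and> pArr G v = k \<and> f \<cdot>\<^bsub>G\<^esub> h \<cdot>\<^bsub>G\<^esub> v = g"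
    then have v: "v \<in> Arr G" "Dom G v = Dom G g" "Cod G v = x" "pArr G v = k" "f \<cdot>\<^bsub>G\<^esub> h \<cdot>\<^bsub>G\<^esub> v = g"
      using p by (auto simp: arrows_def)
    have "f \<cdot>\<^bsub>G\<^esub> (h \<cdot>\<^bsub>G\<^esub> v) = g" using v hd fA by (simp add: total.Comp_assoc)
    moreover have "h \<cdot>\<^bsub>G\<^esub> v \<in> arrows G (Dom G g) (Dom G f)" using v hd
      by (simp add: arrows_def total.CompD)
    moreover have "pArr G (h \<cdot>\<^bsub>G\<^esub> v) = k" using v hd vert_k by (simp add: pArr_Comp)
    ultimately have "h \<cdot>\<^bsub>G\<^esub> v = u" using ex u by (auto simp: arrows_def)
    then show "v = inverse_arr G h \<cdot>\<^bsub>G\<^esub> u"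
      using v hd h by (auto simp: total.iso_inverse_Comp)
  qed
qed

lemma Comp_clv:
  assumes "i \<in> Arr C" "x \<in> Obj G" "Cod C i = pObj G x" "h \<in> vert C G y (restr_obj G i x)"
  shows "clv G i x \<cdot>\<^bsub>G\<^esub> h \<in> Arr G \<and> Dom G (clv G i x \<cdot>\<^bsub>G\<^esub> h) = y \<and> Cod G (clv G i x \<cdot>\<^bsub>G\<^esub> h) = x \<and>
    pArr G (clv G i x \<cdot>\<^bsub>G\<^esub> h) = i"
  using clv_simps[OF assms(1-3)] vertD[OF assms(4)] base.Comp_Ident_right[OF assms(1)]
  by (simp add: total.CompD pArr_Comp)

lemma clv_cancel:
  assumes "i \<in> Arr C" "x \<in> Obj G" "Cod C i = pObj G x"
    "h \<in> vert C G y (restr_obj G i x)" "h' \<in> vert C G y' (restr_obj G i x)"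
    "clv G i x \<cdot>\<^bsub>G\<^esub> h = clv G i x \<cdot>\<^bsub>G\<^esub> h'"
  shows "h = h'"
  using vert_cartesian_cancel[OF clv_cartesian[OF assms(2,1,3)]] clv_simps[OF assms(1-3)] assms
  by metis

lemma vertical_part:
  assumes "f \<in> Arr G"
  shows "vertical_part C G f \<in> vert C G (Dom G f) (restr_obj G (pArr G f) (Cod G f))"
    "clv G (pArr G f) (Cod G f) \<cdot>\<^bsub>G\<^esub> vertical_part C G f = f"
proof -
  have c: "pArr G f \<in> Arr C" "Cod G f \<in> Obj G" "Cod C (pArr G f) = pObj G (Cod G f)"
    using assms pArr_simps total.Cod_closed by simp_all
  have "\<exists>!h. h \<in> vert C G (Dom G f) (restr_obj G (pArr G f) (Cod G f)) \<and>
      clv G (pArr G f) (Cod G f) \<cdot>\<^bsub>G\<^esub> h = f"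
    using vert_cartesian_ex1[OF clv_cartesian[OF c(2,1,3)] assms] clv_simps[OF c] by simp
  from theI'[OF this] show "vertical_part C G f \<in> vert C G (Dom G f) (restr_obj G (pArr G f) (Cod G f))"
    "clv G (pArr G f) (Cod G f) \<cdot>\<^bsub>G\<^esub> vertical_part C G f = f"
    by (simp_all add: vertical_part_def)
qed

lemma vertical_part_clv_Comp:
  assumes "i \<in> Arr C" "x \<in> Obj G" "Cod C i = pObj G x" "h \<in> vert C G y (restr_obj G i x)"
  shows "vertical_part C G (clv G i x \<cdot>\<^bsub>G\<^esub> h) = h"
  using vertical_part[of "clv G i x \<cdot>\<^bsub>G\<^esub> h"] Comp_clv[OF assms] clv_cancel[OF assms(1-3) _ assms(4)]
  by simp

lemma restr_arr:
  assumes "f \<in> vert C G x y" "i \<in> Arr C" "Cod C i = pObj G x"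
  shows "restr_arr C G i f \<in> vert C G (restr_obj G i x) (restr_obj G i y)"
    "clv G i y \<cdot>\<^bsub>G\<^esub> restr_arr C G i f = f \<cdot>\<^bsub>G\<^esub> clv G i x"
proof -
  note f = vertD[OF assms(1)]
  note c = clv_simps[OF assms(2) _ assms(3)] clv_simps[OF assms(2), of y]
  have "\<exists>!h. h \<in> vert C G (Dom G (f \<cdot>\<^bsub>G\<^esub> clv G i x)) (Dom G (clv G i y)) \<and>
      clv G i y \<cdot>\<^bsub>G\<^esub> h = f \<cdot>\<^bsub>G\<^esub> clv G i x"
    using f c assms base.Comp_Ident_left[OF assms(2)]
    by (intro vert_cartesian_ex1 clv_cartesian) (simp_all add: total.CompD pArr_Comp)
  then have "\<exists>!h. h \<in> vert C G (restr_obj G i x) (restr_obj G i y) \<and>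
      clv G i y \<cdot>\<^bsub>G\<^esub> h = f \<cdot>\<^bsub>G\<^esub> clv G i x"
    using f c assms by (simp add: total.CompD)
  from theI'[OF this] show "restr_arr C G i f \<in> vert C G (restr_obj G i x) (restr_obj G i y)"
    "clv G i y \<cdot>\<^bsub>G\<^esub> restr_arr C G i f = f \<cdot>\<^bsub>G\<^esub> clv G i x"
    using f by (simp_all add: restr_arr_def)
qed

text \<open>Restriction is a functor, since both sides solve the same lifting problem.\<close>

lemma restr_arr_Comp:
  assumes "f \<in> vert C G x y" "g \<in> vert C G y z" "i \<in> Arr C" "Cod C i = pObj G x"
  shows "restr_arr C G i (g \<cdot>\<^bsub>G\<^esub> f) = restr_arr C G i g \<cdot>\<^bsub>G\<^esub> restr_arr C G i f"
proof (rule clv_cancel)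
  note f = vertD[OF assms(1)] and g = vertD[OF assms(2)]
  have e: "Cod C i = pObj G y" using f assms by simp
  note rf = restr_arr[OF assms(1,3,4)] and rg = restr_arr[OF assms(2,3) e]
  note rgf = restr_arr[OF vert_Comp[OF assms(1,2)] assms(3,4)]
  show "i \<in> Arr C" "z \<in> Obj G" "Cod C i = pObj G z" using assms f g by simp_all
  show "restr_arr C G i (g \<cdot>\<^bsub>G\<^esub> f) \<in> vert C G (restr_obj G i x) (restr_obj G i z)" by (rule rgf)
  show "restr_arr C G i g \<cdot>\<^bsub>G\<^esub> restr_arr C G i f \<in> vert C G (restr_obj G i x) (restr_obj G i z)"
    by (rule vert_Comp[OF rf(1) rg(1)])
  note c = clv_simps[OF assms(3), of x] clv_simps[OF assms(3), of y] clv_simps[OF assms(3), of z]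
  note rfd = vertD[OF rf(1)] and rgd = vertD[OF rg(1)]
  have "clv G i z \<cdot>\<^bsub>G\<^esub> (restr_arr C G i g \<cdot>\<^bsub>G\<^esub> restr_arr C G i f) =
      (clv G i z \<cdot>\<^bsub>G\<^esub> restr_arr C G i g) \<cdot>\<^bsub>G\<^esub> restr_arr C G i f"
    using c f g assms rfd rgd by (simp add: total.Comp_assoc)
  also have "\<dots> = g \<cdot>\<^bsub>G\<^esub> (clv G i y \<cdot>\<^bsub>G\<^esub> restr_arr C G i f)"
    unfolding rg(2) using c f g assms rfd rgd by (simp add: total.Comp_assoc)
  also have "\<dots> = g \<cdot>\<^bsub>G\<^esub> f \<cdot>\<^bsub>G\<^esub> clv G i x"
    unfolding rf(2) using c f g assms by (simp add: total.Comp_assoc)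
  finally show "clv G i z \<cdot>\<^bsub>G\<^esub> restr_arr C G i (g \<cdot>\<^bsub>G\<^esub> f) =
      clv G i z \<cdot>\<^bsub>G\<^esub> (restr_arr C G i g \<cdot>\<^bsub>G\<^esub> restr_arr C G i f)"
    using rgf(2) by simp
qed

lemma coh:
  assumes "i \<in> Arr C" "x \<in> Obj G" "Cod C i = pObj G x" "j \<in> Arr C" "Cod C j = Dom C i"
  shows "coh C G i j x \<in> vert C G (restr_obj G j (restr_obj G i x)) (restr_obj G (i \<cdot>\<^bsub>C\<^esub> j) x)"
    "clv G (i \<cdot>\<^bsub>C\<^esub> j) x \<cdot>\<^bsub>G\<^esub> coh C G i j x = clv G i x \<cdot>\<^bsub>G\<^esub> clv G j (restr_obj G i x)"
proof -
  note c = clv_simps[OF assms(1-3)]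
  have j: "Cod C j = pObj G (restr_obj G i x)" using c assms by simp
  note d = clv_simps[OF assms(4) _ j]
  have ij: "i \<cdot>\<^bsub>C\<^esub> j \<in> Arr C" "Cod C (i \<cdot>\<^bsub>C\<^esub> j) = pObj G x" using assms base.CompD[of j i] by simp_all
  note e = clv_simps[OF ij(1) assms(2) ij(2)]
  have "\<exists>!h. h \<in> vert C G (Dom G (clv G i x \<cdot>\<^bsub>G\<^esub> clv G j (restr_obj G i x))) (Dom G (clv G (i \<cdot>\<^bsub>C\<^esub> j) x)) \<and>
      clv G (i \<cdot>\<^bsub>C\<^esub> j) x \<cdot>\<^bsub>G\<^esub> h = clv G i x \<cdot>\<^bsub>G\<^esub> clv G j (restr_obj G i x)"
    using c d e assms ij
    by (intro vert_cartesian_ex1 clv_cartesian) (simp_all add: total.CompD pArr_Comp)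
  then have "\<exists>!h. h \<in> vert C G (restr_obj G j (restr_obj G i x)) (restr_obj G (i \<cdot>\<^bsub>C\<^esub> j) x) \<and>
      clv G (i \<cdot>\<^bsub>C\<^esub> j) x \<cdot>\<^bsub>G\<^esub> h = clv G i x \<cdot>\<^bsub>G\<^esub> clv G j (restr_obj G i x)"
    using c d e by (simp add: total.CompD)
  from theI'[OF this] show "coh C G i j x \<in> vert C G (restr_obj G j (restr_obj G i x)) (restr_obj G (i \<cdot>\<^bsub>C\<^esub> j) x)"
    "clv G (i \<cdot>\<^bsub>C\<^esub> j) x \<cdot>\<^bsub>G\<^esub> coh C G i j x = clv G i x \<cdot>\<^bsub>G\<^esub> clv G j (restr_obj G i x)"
    by (simp_all add: coh_def)
qed

end

section \<open>Cartesian functors and pseudonatural transformations\<close>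

text \<open>The conditions of a connective structure with values in an arbitrary fibred category \<open>H\<close>, except
  for the one on automorphisms.\<close>

definition pseudonatural :: "('o, 'a, 'm) site_scheme \<Rightarrow>
    ('x, 'f, 'o, 'a, 'n) fibcat_scheme \<Rightarrow> ('y, 'h, 'o, 'a, 'k) fibcat_scheme \<Rightarrow>
    ('x, 'f, 'a, 'y, 'h) conn_data \<Rightarrow> bool" where
  "pseudonatural C G H \<C> \<longleftrightarrow>
     Co \<C> \<in> extensional (Obj G) \<and> push \<C> \<in> extensional (vert_arrows C G) \<and>
     alp \<C> \<in> extensional (restr_pairs C G) \<and>
     (\<forall>x\<in>Obj G. Co \<C> x \<in> fib H (pObj G x)) \<and>
     (\<forall>x\<in>Obj G. \<forall>y\<in>Obj G. \<forall>f\<in>vert C G x y. iso_arr G f \<longrightarrow>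
        push \<C> f \<in> vert C H (Co \<C> x) (Co \<C> y) \<and> iso_arr H (push \<C> f)) \<and>
     (\<forall>x\<in>Obj G. \<forall>y\<in>Obj G. \<forall>z\<in>Obj G. \<forall>f\<in>vert C G x y. \<forall>g\<in>vert C G y z.
        push \<C> (g \<cdot>\<^bsub>G\<^esub> f) = push \<C> g \<cdot>\<^bsub>H\<^esub> push \<C> f) \<and>
     (\<forall>(i, x)\<in>restr_pairs C G.
        alp \<C> (i, x) \<in> vert C H (restr_obj H i (Co \<C> x)) (Co \<C> (restr_obj G i x)) \<and>
        iso_arr H (alp \<C> (i, x))) \<and>
     (\<forall>x\<in>Obj G. \<forall>y\<in>Obj G. \<forall>f\<in>vert C G x y. \<forall>i\<in>Arr C. Cod C i = pObj G x \<longrightarrow>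
        push \<C> (restr_arr C G i f) \<cdot>\<^bsub>H\<^esub> alp \<C> (i, x)
          = alp \<C> (i, y) \<cdot>\<^bsub>H\<^esub> restr_arr C H i (push \<C> f)) \<and>
     (\<forall>(i, x)\<in>restr_pairs C G. \<forall>j\<in>Arr C. Cod C j = Dom C i \<longrightarrow>
        alp \<C> (i \<cdot>\<^bsub>C\<^esub> j, x) \<cdot>\<^bsub>H\<^esub> coh C H i j (Co \<C> x)
          = push \<C> (coh C G i j x) \<cdot>\<^bsub>H\<^esub>
              (alp \<C> (j, restr_obj G i x) \<cdot>\<^bsub>H\<^esub> restr_arr C H j (alp \<C> (i, x))))"

text \<open>The candidate for the inverse of \<^const>\<open>conn_of\<close>: the formula
  \<open>\<mu>(f) = clv i Co(y) \<sqdot> \<alpha>\<^sub>i(y)\<^sup>-\<^sup>1 \<sqdot> h\<^sub>*\<close> for \<open>f = clv i y \<sqdot> h\<close> is forced by functoriality.\<close>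

definition functor_of :: "('o, 'a, 'm) site_scheme \<Rightarrow>
    ('x, 'f, 'o, 'a, 'n) fibcat_scheme \<Rightarrow> ('y, 'h, 'o, 'a, 'k) fibcat_scheme \<Rightarrow>
    ('x, 'f, 'a, 'y, 'h) conn_data \<Rightarrow> ('x, 'f, 'y, 'h) fun_data" where
  "functor_of C G H \<C> = \<lparr>
     FObj = Co \<C>,
     FArr = (\<lambda>f\<in>Arr G. clv H (pArr G f) (Co \<C> (Cod G f)) \<cdot>\<^bsub>H\<^esub>
       (inverse_arr H (alp \<C> (pArr G f, Cod G f)) \<cdot>\<^bsub>H\<^esub> push \<C> (vertical_part C G f)))\<rparr>"

lemma (in fibration) vert_arrows_iff:
  "f \<in> vert_arrows C G \<longleftrightarrow> (\<exists>x y. f \<in> vert C G x y)"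
  by (auto simp: vert_arrows_def vert_def arrows_def)

locale fibration_pair = G: fibration C G + H: fibration C H
  for C :: "('o, 'a, 'm) site_scheme" and G :: "('x, 'f, 'o, 'a, 'n) fibcat_scheme"
    and H :: "('y, 'h, 'o, 'a, 'k) fibcat_scheme" +
  assumes vert_iso: "f \<in> vert_arrows C G \<Longrightarrow> iso_arr G f"

locale functor_over = fibration_pair C G H
  for C :: "('o, 'a, 'm) site_scheme" and G :: "('x, 'f, 'o, 'a, 'n) fibcat_scheme"
    and H :: "('y, 'h, 'o, 'a, 'k) fibcat_scheme" +
  fixes \<mu> :: "('x, 'f, 'y, 'h) fun_data"
  assumes cartesian: "cartesian_functor C G H \<mu>"
begin

lemma extensional: "FObj \<mu> \<in> extensional (Obj G)" "FArr \<mu> \<in> extensional (Arr G)"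
  using cartesian by (simp_all add: cartesian_functor_def)

lemma FObj_simps:
  "x \<in> Obj G \<Longrightarrow> FObj \<mu> x \<in> Obj H \<and> pObj H (FObj \<mu> x) = pObj G x \<and> FObj \<mu> x \<in> fib H (pObj G x)"
  using cartesian by (simp add: cartesian_functor_def fib_def)

lemma FArr_Ident: "x \<in> Obj G \<Longrightarrow> FArr \<mu> (Ident G x) = Ident H (FObj \<mu> x)"
  using cartesian by (simp add: cartesian_functor_def)

lemma FArr_simps:
  "f \<in> Arr G \<Longrightarrow> FArr \<mu> f \<in> Arr H \<and> Dom H (FArr \<mu> f) = FObj \<mu> (Dom G f) \<and>
     Cod H (FArr \<mu> f) = FObj \<mu> (Cod G f) \<and> pArr H (FArr \<mu> f) = pArr G f"
  using cartesian by (simp add: cartesian_functor_def arrows_def)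

lemma FArr_Comp:
  "\<lbrakk>f \<in> Arr G; g \<in> Arr G; Dom G g = Cod G f\<rbrakk> \<Longrightarrow> FArr \<mu> (g \<cdot>\<^bsub>G\<^esub> f) = FArr \<mu> g \<cdot>\<^bsub>H\<^esub> FArr \<mu> f"
  using cartesian by (simp add: cartesian_functor_def)

lemma FArr_cartesian: "cartesian C G f \<Longrightarrow> cartesian C H (FArr \<mu> f)"
  using cartesian by (simp add: cartesian_functor_def)

lemma FArr_vert: "f \<in> vert C G x y \<Longrightarrow> FArr \<mu> f \<in> vert C H (FObj \<mu> x) (FObj \<mu> y)"
  using G.vertD[of f x y] FArr_simps[of f] FObj_simps[of x] by (intro H.vertI) simp_all

lemma FArr_iso:
  assumes "iso_arr G f"
  shows "iso_arr H (FArr \<mu> f)"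
proof (rule H.total.iso_arrI)
  note i = G.total.inverse_arr[OF assms]
  note F = FArr_simps[OF i(1)] FArr_simps[OF i(2)]
  show "FArr \<mu> f \<in> Arr H" "FArr \<mu> (inverse_arr G f) \<in> Arr H"
    "Dom H (FArr \<mu> (inverse_arr G f)) = Cod H (FArr \<mu> f)"
    "Cod H (FArr \<mu> (inverse_arr G f)) = Dom H (FArr \<mu> f)"
    using i F by simp_all
  show "FArr \<mu> (inverse_arr G f) \<cdot>\<^bsub>H\<^esub> FArr \<mu> f = Ident H (Dom H (FArr \<mu> f))"
    using i F FArr_Ident[of "Dom G f"] FArr_Comp[of f "inverse_arr G f"] G.total.Dom_closed by simp
  show "FArr \<mu> f \<cdot>\<^bsub>H\<^esub> FArr \<mu> (inverse_arr G f) = Ident H (Cod H (FArr \<mu> f))"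
    using i F FArr_Ident[of "Cod G f"] FArr_Comp[of "inverse_arr G f" f] G.total.Cod_closed by simp
qed

abbreviation \<C> where "\<C> \<equiv> conn_of C G H \<mu>"

lemma FArr_clv_simps:
  assumes "i \<in> Arr C" "x \<in> Obj G" "Cod C i = pObj G x"
  shows "FArr \<mu> (clv G i x) \<in> Arr H" "Dom H (FArr \<mu> (clv G i x)) = FObj \<mu> (restr_obj G i x)"
    "Cod H (FArr \<mu> (clv G i x)) = FObj \<mu> x" "pArr H (FArr \<mu> (clv G i x)) = i"
    "cartesian C H (FArr \<mu> (clv G i x))"
  using FArr_simps[of "clv G i x"] G.clv_simps[OF assms] G.clv_cartesian[OF assms(2,1,3)]
    FArr_cartesian by simp_all

text \<open>The comparison is invertible because \<open>\<mu>(clv i x)\<close> is cartesian like \<open>clv i \<mu>(x)\<close>.\<close>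

lemma alp:
  assumes "i \<in> Arr C" "x \<in> Obj G" "Cod C i = pObj G x"
  shows "alp \<C> (i, x) \<in> vert C H (restr_obj H i (FObj \<mu> x)) (FObj \<mu> (restr_obj G i x))"
    "FArr \<mu> (clv G i x) \<cdot>\<^bsub>H\<^esub> alp \<C> (i, x) = clv H i (FObj \<mu> x)"
    "iso_arr H (alp \<C> (i, x))"
proof -
  note c = FArr_clv_simps[OF assms]
  have x: "FObj \<mu> x \<in> Obj H" "Cod C i = pObj H (FObj \<mu> x)" using FObj_simps[OF assms(2)] assms by simp_all
  note d = H.clv_simps[OF assms(1) x]
  have "\<exists>!h. h \<in> vert C H (restr_obj H i (FObj \<mu> x)) (FObj \<mu> (restr_obj G i x)) \<and>
      FArr \<mu> (clv G i x) \<cdot>\<^bsub>H\<^esub> h = clv H i (FObj \<mu> x)"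
    using H.vert_cartesian_ex1[OF c(5), of "clv H i (FObj \<mu> x)"] c d by simp
  from theI'[OF this]
  show a: "alp \<C> (i, x) \<in> vert C H (restr_obj H i (FObj \<mu> x)) (FObj \<mu> (restr_obj G i x))"
    "FArr \<mu> (clv G i x) \<cdot>\<^bsub>H\<^esub> alp \<C> (i, x) = clv H i (FObj \<mu> x)"
    using assms by (simp_all add: conn_of_def restr_pairs_def)
  show "iso_arr H (alp \<C> (i, x))"
  proof (rule H.cartesian_comparison_iso[OF c(5)])
    show "cartesian C H (FArr \<mu> (clv G i x) \<cdot>\<^bsub>H\<^esub> alp \<C> (i, x))"
      unfolding a(2) by (rule H.clv_cartesian[OF x(1) assms(1) x(2)])
    show "alp \<C> (i, x) \<in> vert C H (restr_obj H i (FObj \<mu> x)) (Dom H (FArr \<mu> (clv G i x)))"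
      using a c by simp
  qed
qed

lemma FArr_clv:
  assumes "i \<in> Arr C" "x \<in> Obj G" "Cod C i = pObj G x"
  shows "FArr \<mu> (clv G i x) = clv H i (FObj \<mu> x) \<cdot>\<^bsub>H\<^esub> inverse_arr H (alp \<C> (i, x))"
proof -
  note a = alp[OF assms] and c = FArr_clv_simps[OF assms]
  note ai = H.total.inverse_arr[OF a(3)] and ad = H.vertD[OF a(1)]
  have "clv H i (FObj \<mu> x) \<cdot>\<^bsub>H\<^esub> inverse_arr H (alp \<C> (i, x)) =
      FArr \<mu> (clv G i x) \<cdot>\<^bsub>H\<^esub> (alp \<C> (i, x) \<cdot>\<^bsub>H\<^esub> inverse_arr H (alp \<C> (i, x)))"
    unfolding a(2)[symmetric] using ai ad c by (simp add: H.total.Comp_assoc)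
  also have "\<dots> = FArr \<mu> (clv G i x)"
    using ai ad c H.total.Comp_Ident_right[of "FArr \<mu> (clv G i x)"] by simp
  finally show ?thesis by simp
qed

text \<open>Hence \<open>\<mu>\<close> is recovered from its values on the fibres and the comparisons.\<close>

lemma FArr_eq:
  assumes "f \<in> Arr G"
  shows "FArr \<mu> f = clv H (pArr G f) (FObj \<mu> (Cod G f)) \<cdot>\<^bsub>H\<^esub>
     (inverse_arr H (alp \<C> (pArr G f, Cod G f)) \<cdot>\<^bsub>H\<^esub> push \<C> (vertical_part C G f))"
proof -
  have c: "pArr G f \<in> Arr C" "Cod G f \<in> Obj G" "Cod C (pArr G f) = pObj G (Cod G f)"
    using assms G.pArr_simps G.total.Cod_closed by simp_all
  note v = G.vertical_part[OF assms]
  note a = alp[OF c] and vd = G.vertD[OF v(1)] and k = G.clv_simps[OF c]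
  note ai = H.total.inverse_arr[OF a(3)] and ad = H.vertD[OF a(1)]
  note Fv = H.vertD[OF FArr_vert[OF v(1)]]
  have p: "push \<C> (vertical_part C G f) = FArr \<mu> (vertical_part C G f)"
    using v G.vert_arrows_iff by (auto simp: conn_of_def)
  have "FArr \<mu> f = FArr \<mu> (clv G (pArr G f) (Cod G f)) \<cdot>\<^bsub>H\<^esub> FArr \<mu> (vertical_part C G f)"
    using FArr_Comp[of "vertical_part C G f" "clv G (pArr G f) (Cod G f)"] vd k v by simp
  then show ?thesis
    unfolding p FArr_clv[OF c]
    using ai ad Fv FObj_simps[OF c(2)] H.clv_simps[of "pArr G f" "FObj \<mu> (Cod G f)"] c
    by (simp add: H.total.Comp_assoc)
qed

lemma functor_of_conn_of: "functor_of C G H \<C> = \<mu>"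
proof -
  have "FArr (functor_of C G H \<C>) = FArr \<mu>"
  proof (rule extensionalityI[of _ "Arr G"])
    show "FArr (functor_of C G H \<C>) f = FArr \<mu> f" if "f \<in> Arr G" for f
      using FArr_eq[OF that] that by (simp add: functor_of_def conn_of_def)
  qed (simp_all add: functor_of_def extensional)
  moreover have "FObj (functor_of C G H \<C>) = FObj \<mu>" by (simp add: functor_of_def conn_of_def)
  ultimately show ?thesis by (simp add: fun_data.equality)
qed

lemma push: "f \<in> vert C G x y \<Longrightarrow> push \<C> f = FArr \<mu> f"
  using G.vert_arrows_iff by (auto simp: conn_of_def)

text \<open>Both sides have the same composite with the cartesian arrow \<open>\<mu>(clv i y)\<close>: on the left
  \<open>clv i y \<sqdot> i\<^sup>*f = f \<sqdot> clv i x\<close> in \<open>G\<close> is used, on the right the same equation in \<open>H\<close> for \<open>\<mu>(f)\<close>. The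
  coherence law below is obtained in the same way, from the two descriptions of
  \<open>clv i x \<sqdot> clv j (i\<^sup>*x)\<close>.\<close>

lemma alp_natural:
  assumes f: "f \<in> vert C G x y" and i: "i \<in> Arr C" "Cod C i = pObj G x"
  shows "FArr \<mu> (restr_arr C G i f) \<cdot>\<^bsub>H\<^esub> alp \<C> (i, x) =
     alp \<C> (i, y) \<cdot>\<^bsub>H\<^esub> restr_arr C H i (FArr \<mu> f)" (is "?l = ?r")
proof -
  note fd = G.vertD[OF f]
  have x: "x \<in> Obj G" and y: "y \<in> Obj G" "Cod C i = pObj G y" using fd i by simp_all
  note a = alp[OF i(1) x i(2)] and b = alp[OF i(1) y]
  note r = G.restr_arr[OF f i]
  have Ff: "FArr \<mu> f \<in> vert C H (FObj \<mu> x) (FObj \<mu> y)" by (rule FArr_vert[OF f])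
  note Fx = FObj_simps[OF x] and Fy = FObj_simps[OF y(1)]
  have i': "Cod C i = pObj H (FObj \<mu> x)" using Fx i by simp
  note s = H.restr_arr[OF Ff i(1) i']
  note cx = G.clv_simps[OF i(1) x i(2)] and cy = G.clv_simps[OF i(1) y]
    and Fcx = FArr_clv_simps[OF i(1) x i(2)] and Fcy = FArr_clv_simps[OF i(1) y]
  note ad = H.vertD[OF a(1)] and bd = H.vertD[OF b(1)] and rd = G.vertD[OF r(1)]
    and sd = H.vertD[OF s(1)] and Frd = H.vertD[OF FArr_vert[OF r(1)]] and Ffd = H.vertD[OF Ff]
  have l: "?l \<in> vert C H (restr_obj H i (FObj \<mu> x)) (FObj \<mu> (restr_obj G i y))"
    by (rule H.vert_Comp[OF a(1) FArr_vert[OF r(1)]])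
  have r': "?r \<in> vert C H (restr_obj H i (FObj \<mu> x)) (FObj \<mu> (restr_obj G i y))"
    by (rule H.vert_Comp[OF s(1) b(1)])
  have e: "FArr \<mu> (clv G i y) \<cdot>\<^bsub>H\<^esub> FArr \<mu> (restr_arr C G i f) = FArr \<mu> f \<cdot>\<^bsub>H\<^esub> FArr \<mu> (clv G i x)"
    using r FArr_Comp[of "restr_arr C G i f" "clv G i y"] FArr_Comp[of "clv G i x" f] cx cy rd fd
    by simp
  have "FArr \<mu> (clv G i y) \<cdot>\<^bsub>H\<^esub> ?l =
      (FArr \<mu> (clv G i y) \<cdot>\<^bsub>H\<^esub> FArr \<mu> (restr_arr C G i f)) \<cdot>\<^bsub>H\<^esub> alp \<C> (i, x)"
    using Fcy Frd ad by (simp add: H.total.Comp_assoc)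
  also have "\<dots> = FArr \<mu> f \<cdot>\<^bsub>H\<^esub> (FArr \<mu> (clv G i x) \<cdot>\<^bsub>H\<^esub> alp \<C> (i, x))"
    unfolding e using Ffd Fcx ad by (simp add: H.total.Comp_assoc)
  also have "\<dots> = (FArr \<mu> (clv G i y) \<cdot>\<^bsub>H\<^esub> alp \<C> (i, y)) \<cdot>\<^bsub>H\<^esub> restr_arr C H i (FArr \<mu> f)"
    unfolding a(2) b(2) s(2) ..
  also have "\<dots> = FArr \<mu> (clv G i y) \<cdot>\<^bsub>H\<^esub> ?r"
    using Fcy bd sd by (simp add: H.total.Comp_assoc)
  finally show ?thesis
    using H.vert_cartesian_cancel[OF Fcy(5)] l r' Fcy by metis
qed

lemma alp_coherent:
  assumes i: "i \<in> Arr C" "Cod C i = pObj G x" and x: "x \<in> Obj G"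
    and j: "j \<in> Arr C" "Cod C j = Dom C i"
  shows "alp \<C> (i \<cdot>\<^bsub>C\<^esub> j, x) \<cdot>\<^bsub>H\<^esub> coh C H i j (FObj \<mu> x) = FArr \<mu> (coh C G i j x) \<cdot>\<^bsub>H\<^esub>
      (alp \<C> (j, restr_obj G i x) \<cdot>\<^bsub>H\<^esub> restr_arr C H j (alp \<C> (i, x)))" (is "?l = ?r")
proof -
  let ?y = "restr_obj G i x"
  note Fx = FObj_simps[OF x]
  have i': "Cod C i = pObj H (FObj \<mu> x)" using Fx i by simp
  have ij: "i \<cdot>\<^bsub>C\<^esub> j \<in> Arr C" "Cod C (i \<cdot>\<^bsub>C\<^esub> j) = pObj G x" "Cod C (i \<cdot>\<^bsub>C\<^esub> j) = pObj H (FObj \<mu> x)"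
    using i i' j G.base.CompD[of j i] by simp_all
  note c = G.clv_simps[OF i(1) x i(2)] and Fc = FArr_clv_simps[OF i(1) x i(2)]
  have y: "?y \<in> Obj G" "Cod C j = pObj G ?y" using c j by simp_all
  note Fy = FObj_simps[OF y(1)]
  have j': "Cod C j = pObj H (FObj \<mu> ?y)" using Fy y by simp
  note cj = G.clv_simps[OF j(1) y] and Fcj = FArr_clv_simps[OF j(1) y]
  note cij = G.clv_simps[OF ij(1) x ij(2)] and Fcij = FArr_clv_simps[OF ij(1) x ij(2)]
  note a = alp[OF i(1) x i(2)] and b = alp[OF j(1) y] and e = alp[OF ij(1) x ij(2)]
  note ad = H.vertD[OF a(1)] and bd = H.vertD[OF b(1)] and ed = H.vertD[OF e(1)]
  note k = G.coh[OF i(1) x i(2) j]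
  have FxO: "FObj \<mu> x \<in> Obj H" using Fx by simp
  note h = H.coh[OF i(1) FxO i' j]
  note kd = G.vertD[OF k(1)] and Fk = FArr_vert[OF k(1)] and hd = H.vertD[OF h(1)]
  note Fkd = H.vertD[OF Fk]
  have j'': "Cod C j = pObj H (restr_obj H i (FObj \<mu> x))"
    using H.clv_simps[OF i(1) FxO i'] j by simp
  note s = H.restr_arr[OF a(1) j(1) j'']
  note sd = H.vertD[OF s(1)]
  note ci = H.clv_simps[OF i(1) FxO i']
  note cj' = H.clv_simps[OF j(1) _ j''] H.clv_simps[OF j(1) _ j']
  note cij' = H.clv_simps[OF ij(1) FxO ij(3)]
  have l: "?l \<in> vert C H (restr_obj H j (restr_obj H i (FObj \<mu> x))) (FObj \<mu> (restr_obj G (i \<cdot>\<^bsub>C\<^esub> j) x))"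
    by (rule H.vert_Comp[OF h(1) e(1)])
  have r: "?r \<in> vert C H (restr_obj H j (restr_obj H i (FObj \<mu> x))) (FObj \<mu> (restr_obj G (i \<cdot>\<^bsub>C\<^esub> j) x))"
    by (rule H.vert_Comp[OF H.vert_Comp[OF s(1) b(1)] Fk])
  have "FArr \<mu> (clv G (i \<cdot>\<^bsub>C\<^esub> j) x) \<cdot>\<^bsub>H\<^esub> ?l =
      (FArr \<mu> (clv G (i \<cdot>\<^bsub>C\<^esub> j) x) \<cdot>\<^bsub>H\<^esub> alp \<C> (i \<cdot>\<^bsub>C\<^esub> j, x)) \<cdot>\<^bsub>H\<^esub> coh C H i j (FObj \<mu> x)"
    using Fcij ed hd by (simp add: H.total.Comp_assoc)
  also have "\<dots> = (FArr \<mu> (clv G i x) \<cdot>\<^bsub>H\<^esub> alp \<C> (i, x)) \<cdot>\<^bsub>H\<^esub> clv H j (restr_obj H i (FObj \<mu> x))"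
    unfolding e(2) h(2) a(2) ..
  also have "\<dots> = FArr \<mu> (clv G i x) \<cdot>\<^bsub>H\<^esub> (clv H j (FObj \<mu> ?y) \<cdot>\<^bsub>H\<^esub> restr_arr C H j (alp \<C> (i, x)))"
    unfolding s(2) using Fc ad ci cj' by (simp add: H.total.Comp_assoc)
  also have "\<dots> = FArr \<mu> (clv G i x) \<cdot>\<^bsub>H\<^esub>
      (FArr \<mu> (clv G j ?y) \<cdot>\<^bsub>H\<^esub> (alp \<C> (j, ?y) \<cdot>\<^bsub>H\<^esub> restr_arr C H j (alp \<C> (i, x))))"
    unfolding b(2)[symmetric] using Fcj bd sd by (simp add: H.total.Comp_assoc)
  also have "\<dots> = (FArr \<mu> (clv G i x) \<cdot>\<^bsub>H\<^esub> FArr \<mu> (clv G j ?y)) \<cdot>\<^bsub>H\<^esub>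
      (alp \<C> (j, ?y) \<cdot>\<^bsub>H\<^esub> restr_arr C H j (alp \<C> (i, x)))"
    using Fc Fcj bd sd by (simp add: H.total.Comp_assoc H.total.CompD)
  also have "FArr \<mu> (clv G i x) \<cdot>\<^bsub>H\<^esub> FArr \<mu> (clv G j ?y) =
      FArr \<mu> (clv G (i \<cdot>\<^bsub>C\<^esub> j) x) \<cdot>\<^bsub>H\<^esub> FArr \<mu> (coh C G i j x)"
    using k FArr_Comp[of "coh C G i j x" "clv G (i \<cdot>\<^bsub>C\<^esub> j) x"] FArr_Comp[of "clv G j ?y" "clv G i x"]
      c cj cij kd by simp
  also have "\<dots> \<cdot>\<^bsub>H\<^esub> (alp \<C> (j, ?y) \<cdot>\<^bsub>H\<^esub> restr_arr C H j (alp \<C> (i, x))) =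
      FArr \<mu> (clv G (i \<cdot>\<^bsub>C\<^esub> j) x) \<cdot>\<^bsub>H\<^esub> ?r"
    using Fcij Fkd bd sd by (simp add: H.total.Comp_assoc H.total.CompD)
  finally show ?thesis
    using H.vert_cartesian_cancel[OF Fcij(5)] l r Fcij by metis
qed

lemma conn_extensional:
  "push \<C> \<in> extensional (vert_arrows C G)" "alp \<C> \<in> extensional (restr_pairs C G)"
  by (simp_all add: conn_of_def)

lemma conn_of_pseudonatural: "pseudonatural C G H \<C>"
proof -
  have Co: "Co \<C> = FObj \<mu>" by (simp add: conn_of_def)
  show ?thesis
    unfolding pseudonatural_def Co
  proof (intro conjI)
    show "FObj \<mu> \<in> extensional (Obj G)" by (rule extensional)
    show "push \<C> \<in> extensional (vert_arrows C G)" "alp \<C> \<in> extensional (restr_pairs C G)"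
      by (rule conn_extensional)+
    show "\<forall>x\<in>Obj G. FObj \<mu> x \<in> fib H (pObj G x)" using FObj_simps by blast
    show "\<forall>x\<in>Obj G. \<forall>y\<in>Obj G. \<forall>f\<in>vert C G x y. iso_arr G f \<longrightarrow>
        push \<C> f \<in> vert C H (FObj \<mu> x) (FObj \<mu> y) \<and> iso_arr H (push \<C> f)"
      using push FArr_vert FArr_iso by metis
    show "\<forall>x\<in>Obj G. \<forall>y\<in>Obj G. \<forall>z\<in>Obj G. \<forall>f\<in>vert C G x y. \<forall>g\<in>vert C G y z.
        push \<C> (g \<cdot>\<^bsub>G\<^esub> f) = push \<C> g \<cdot>\<^bsub>H\<^esub> push \<C> f"
    proof (intro ballI)
      fix x y z f g assume fg: "f \<in> vert C G x y" "g \<in> vert C G y z"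
      show "push \<C> (g \<cdot>\<^bsub>G\<^esub> f) = push \<C> g \<cdot>\<^bsub>H\<^esub> push \<C> f"
        using push[OF fg(1)] push[OF fg(2)] push[OF G.vert_Comp[OF fg]]
          G.vertD[OF fg(1)] G.vertD[OF fg(2)] FArr_Comp[of f g] by simp
    qed
    show "\<forall>(i, x)\<in>restr_pairs C G.
        alp \<C> (i, x) \<in> vert C H (restr_obj H i (FObj \<mu> x)) (FObj \<mu> (restr_obj G i x)) \<and>
        iso_arr H (alp \<C> (i, x))"
    proof (rule ballI, unfold split_paired_all prod.case)
      fix i x assume "(i, x) \<in> restr_pairs C G"
      then show "alp \<C> (i, x) \<in> vert C H (restr_obj H i (FObj \<mu> x)) (FObj \<mu> (restr_obj G i x)) \<and>
        iso_arr H (alp \<C> (i, x))"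
        using alp[of i x] unfolding restr_pairs_def by blast
    qed
    show "\<forall>x\<in>Obj G. \<forall>y\<in>Obj G. \<forall>f\<in>vert C G x y. \<forall>i\<in>Arr C. Cod C i = pObj G x \<longrightarrow>
        push \<C> (restr_arr C G i f) \<cdot>\<^bsub>H\<^esub> alp \<C> (i, x)
          = alp \<C> (i, y) \<cdot>\<^bsub>H\<^esub> restr_arr C H i (push \<C> f)"
    proof (intro ballI impI)
      fix x y f i assume f: "f \<in> vert C G x y" "i \<in> Arr C" "Cod C i = pObj G x"
      show "push \<C> (restr_arr C G i f) \<cdot>\<^bsub>H\<^esub> alp \<C> (i, x)
          = alp \<C> (i, y) \<cdot>\<^bsub>H\<^esub> restr_arr C H i (push \<C> f)"
        unfolding push[OF f(1)] push[OF G.restr_arr(1)[OF f]] by (rule alp_natural[OF f])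
    qed
    show "\<forall>(i, x)\<in>restr_pairs C G. \<forall>j\<in>Arr C. Cod C j = Dom C i \<longrightarrow>
        alp \<C> (i \<cdot>\<^bsub>C\<^esub> j, x) \<cdot>\<^bsub>H\<^esub> coh C H i j (FObj \<mu> x)
          = push \<C> (coh C G i j x) \<cdot>\<^bsub>H\<^esub>
              (alp \<C> (j, restr_obj G i x) \<cdot>\<^bsub>H\<^esub> restr_arr C H j (alp \<C> (i, x)))"
    proof (rule ballI, unfold split_paired_all prod.case, intro ballI impI)
      fix i x j assume "(i, x) \<in> restr_pairs C G" and j: "j \<in> Arr C" "Cod C j = Dom C i"
      then have i: "i \<in> Arr C" "x \<in> Obj G" "Cod C i = pObj G x" by (simp_all add: restr_pairs_def)
      show "alp \<C> (i \<cdot>\<^bsub>C\<^esub> j, x) \<cdot>\<^bsub>H\<^esub> coh C H i j (FObj \<mu> x) = push \<C> (coh C G i j x) \<cdot>\<^bsub>H\<^esub>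
          (alp \<C> (j, restr_obj G i x) \<cdot>\<^bsub>H\<^esub> restr_arr C H j (alp \<C> (i, x)))"
        unfolding push[OF G.coh(1)[OF i j]] by (rule alp_coherent[OF i(1,3,2) j])
    qed
  qed
qed

end

locale pseudonatural_over = fibration_pair C G H
  for C :: "('o, 'a, 'm) site_scheme" and G :: "('x, 'f, 'o, 'a, 'n) fibcat_scheme"
    and H :: "('y, 'h, 'o, 'a, 'k) fibcat_scheme" +
  fixes \<C> :: "('x, 'f, 'a, 'y, 'h) conn_data"
  assumes pseudonatural: "pseudonatural C G H \<C>"
begin

abbreviation \<mu> where "\<mu> \<equiv> functor_of C G H \<C>"

lemma extensional:
  "push \<C> \<in> extensional (vert_arrows C G)" "alp \<C> \<in> extensional (restr_pairs C G)"
  "Co \<C> \<in> extensional (Obj G)"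
  using pseudonatural unfolding pseudonatural_def by blast+

lemma Co_simps: "x \<in> Obj G \<Longrightarrow> Co \<C> x \<in> Obj H \<and> pObj H (Co \<C> x) = pObj G x"
  using pseudonatural unfolding pseudonatural_def fib_def by blast

lemma push_vert:
  assumes "f \<in> vert C G x y"
  shows "push \<C> f \<in> vert C H (Co \<C> x) (Co \<C> y)" "iso_arr H (push \<C> f)"
proof -
  have *: "\<forall>x\<in>Obj G. \<forall>y\<in>Obj G. \<forall>f\<in>vert C G x y. iso_arr G f \<longrightarrow>
      push \<C> f \<in> vert C H (Co \<C> x) (Co \<C> y) \<and> iso_arr H (push \<C> f)"
    using pseudonatural unfolding pseudonatural_def by (elim conjE)
  have "iso_arr G f" using vert_iso G.vert_arrows_iff assms by blast
  then show "push \<C> f \<in> vert C H (Co \<C> x) (Co \<C> y)" "iso_arr H (push \<C> f)"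
    using * G.vertD[OF assms] assms by blast+
qed

lemma push_Comp:
  assumes "f \<in> vert C G x y" "g \<in> vert C G y z"
  shows "push \<C> (g \<cdot>\<^bsub>G\<^esub> f) = push \<C> g \<cdot>\<^bsub>H\<^esub> push \<C> f"
proof -
  have *: "\<forall>x\<in>Obj G. \<forall>y\<in>Obj G. \<forall>z\<in>Obj G. \<forall>f\<in>vert C G x y. \<forall>g\<in>vert C G y z.
      push \<C> (g \<cdot>\<^bsub>G\<^esub> f) = push \<C> g \<cdot>\<^bsub>H\<^esub> push \<C> f"
    using pseudonatural unfolding pseudonatural_def by (elim conjE)
  have "x \<in> Obj G" "y \<in> Obj G" "z \<in> Obj G"
    using G.vertD[OF assms(1)] G.vertD[OF assms(2)] by simp_all
  then show ?thesis using * assms by blast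
qed

lemma alp:
  assumes "i \<in> Arr C" "x \<in> Obj G" "Cod C i = pObj G x"
  shows "alp \<C> (i, x) \<in> vert C H (restr_obj H i (Co \<C> x)) (Co \<C> (restr_obj G i x))"
    "iso_arr H (alp \<C> (i, x))"
    "inverse_arr H (alp \<C> (i, x)) \<in> vert C H (Co \<C> (restr_obj G i x)) (restr_obj H i (Co \<C> x))"
proof -
  have *: "\<forall>(i, x)\<in>restr_pairs C G.
      alp \<C> (i, x) \<in> vert C H (restr_obj H i (Co \<C> x)) (Co \<C> (restr_obj G i x)) \<and>
      iso_arr H (alp \<C> (i, x))"
    using pseudonatural unfolding pseudonatural_def by (elim conjE)
  have "(i, x) \<in> restr_pairs C G" using assms by (simp add: restr_pairs_def)
  from bspec[OF * this]
  show a: "alp \<C> (i, x) \<in> vert C H (restr_obj H i (Co \<C> x)) (Co \<C> (restr_obj G i x))"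
    "iso_arr H (alp \<C> (i, x))"
    unfolding prod.case by blast+
  show "inverse_arr H (alp \<C> (i, x)) \<in> vert C H (Co \<C> (restr_obj G i x)) (restr_obj H i (Co \<C> x))"
    by (rule H.vert_inverse[OF a])
qed

lemma alp_natural:
  assumes "f \<in> vert C G x y" "i \<in> Arr C" "Cod C i = pObj G x"
  shows "push \<C> (restr_arr C G i f) \<cdot>\<^bsub>H\<^esub> alp \<C> (i, x) = alp \<C> (i, y) \<cdot>\<^bsub>H\<^esub> restr_arr C H i (push \<C> f)"
proof -
  have *: "\<forall>x\<in>Obj G. \<forall>y\<in>Obj G. \<forall>f\<in>vert C G x y. \<forall>i\<in>Arr C. Cod C i = pObj G x \<longrightarrow>
      push \<C> (restr_arr C G i f) \<cdot>\<^bsub>H\<^esub> alp \<C> (i, x)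
        = alp \<C> (i, y) \<cdot>\<^bsub>H\<^esub> restr_arr C H i (push \<C> f)"
    using pseudonatural unfolding pseudonatural_def by (elim conjE)
  have "x \<in> Obj G" "y \<in> Obj G" using G.vertD[OF assms(1)] by simp_all
  then show ?thesis using * assms by blast
qed

lemma alp_coherent:
  assumes "i \<in> Arr C" "x \<in> Obj G" "Cod C i = pObj G x" "j \<in> Arr C" "Cod C j = Dom C i"
  shows "alp \<C> (i \<cdot>\<^bsub>C\<^esub> j, x) \<cdot>\<^bsub>H\<^esub> coh C H i j (Co \<C> x) = push \<C> (coh C G i j x) \<cdot>\<^bsub>H\<^esub>
      (alp \<C> (j, restr_obj G i x) \<cdot>\<^bsub>H\<^esub> restr_arr C H j (alp \<C> (i, x)))"
proof -
  have *: "\<forall>(i, x)\<in>restr_pairs C G. \<forall>j\<in>Arr C. Cod C j = Dom C i \<longrightarrow>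
      alp \<C> (i \<cdot>\<^bsub>C\<^esub> j, x) \<cdot>\<^bsub>H\<^esub> coh C H i j (Co \<C> x)
        = push \<C> (coh C G i j x) \<cdot>\<^bsub>H\<^esub>
            (alp \<C> (j, restr_obj G i x) \<cdot>\<^bsub>H\<^esub> restr_arr C H j (alp \<C> (i, x)))"
    using pseudonatural unfolding pseudonatural_def by (elim conjE)
  have "(i, x) \<in> restr_pairs C G" using assms by (simp add: restr_pairs_def)
  from bspec[OF * this] assms(4,5) show ?thesis unfolding prod.case by blast
qed

text \<open>Only composites are preserved by assumption, but \<open>id\<^sub>*\<close> is invertible as well.\<close>

lemma push_Ident:
  assumes "x \<in> Obj G"
  shows "push \<C> (Ident G x) = Ident H (Co \<C> x)"
proof -
  note v = G.vert_Ident[OF assms]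
  note p = push_vert[OF v]
  have "Ident G x \<cdot>\<^bsub>G\<^esub> Ident G x = Ident G x"
    using G.total.Comp_Ident_left[of "Ident G x"] G.vertD[OF v] by simp
  then have "push \<C> (Ident G x) \<cdot>\<^bsub>H\<^esub> push \<C> (Ident G x) = push \<C> (Ident G x)"
    using push_Comp[OF v v] by simp
  then show ?thesis using H.total.idempotent_iso_is_Ident[OF p(2)] H.vertD[OF p(1)] by simp
qed

lemma FArr_eq:
  assumes "f \<in> Arr G"
  shows "FArr \<mu> f = clv H (pArr G f) (Co \<C> (Cod G f)) \<cdot>\<^bsub>H\<^esub>
       (inverse_arr H (alp \<C> (pArr G f, Cod G f)) \<cdot>\<^bsub>H\<^esub> push \<C> (vertical_part C G f))"
  using assms by (simp add: functor_of_def)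

lemma FArr_clv_Comp:
  assumes "i \<in> Arr C" "y \<in> Obj G" "Cod C i = pObj G y" "h \<in> vert C G x (restr_obj G i y)"
  shows "FArr \<mu> (clv G i y \<cdot>\<^bsub>G\<^esub> h) =
    clv H i (Co \<C> y) \<cdot>\<^bsub>H\<^esub> (inverse_arr H (alp \<C> (i, y)) \<cdot>\<^bsub>H\<^esub> push \<C> h)"
  using G.Comp_clv[OF assms] G.vertical_part_clv_Comp[OF assms] FArr_eq[of "clv G i y \<cdot>\<^bsub>G\<^esub> h"] by simp

lemma FArr_vertical_part:
  assumes "f \<in> Arr G"
  shows "inverse_arr H (alp \<C> (pArr G f, Cod G f)) \<cdot>\<^bsub>H\<^esub> push \<C> (vertical_part C G f)
     \<in> vert C H (Co \<C> (Dom G f)) (restr_obj H (pArr G f) (Co \<C> (Cod G f)))" (is ?v)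
   "iso_arr H (inverse_arr H (alp \<C> (pArr G f, Cod G f)) \<cdot>\<^bsub>H\<^esub> push \<C> (vertical_part C G f))" (is ?i)
proof -
  have c: "pArr G f \<in> Arr C" "Cod G f \<in> Obj G" "Cod C (pArr G f) = pObj G (Cod G f)"
    using assms G.pArr_simps G.total.Cod_closed by simp_all
  note a = alp[OF c] and p = push_vert[OF G.vertical_part(1)[OF assms]]
  show ?v by (rule H.vert_Comp[OF p(1) a(3)])
  show ?i using H.vertD[OF p(1)] H.vertD[OF a(3)]
    by (intro H.total.iso_Comp p(2) H.total.iso_inverse_arr a(2)) simp
qed

lemma FArr_simps:
  assumes "f \<in> Arr G"
  shows "FArr \<mu> f \<in> Arr H \<and> Dom H (FArr \<mu> f) = Co \<C> (Dom G f) \<and>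
    Cod H (FArr \<mu> f) = Co \<C> (Cod G f) \<and> pArr H (FArr \<mu> f) = pArr G f"
    "cartesian C H (FArr \<mu> f)"
proof -
  have c: "pArr G f \<in> Arr C" "Cod G f \<in> Obj G" "Cod C (pArr G f) = pObj G (Cod G f)"
    using assms G.pArr_simps G.total.Cod_closed by simp_all
  have d: "Co \<C> (Cod G f) \<in> Obj H" "Cod C (pArr G f) = pObj H (Co \<C> (Cod G f))"
    using c Co_simps by simp_all
  note v = FArr_vertical_part[OF assms]
  show "FArr \<mu> f \<in> Arr H \<and> Dom H (FArr \<mu> f) = Co \<C> (Dom G f) \<and>
      Cod H (FArr \<mu> f) = Co \<C> (Cod G f) \<and> pArr H (FArr \<mu> f) = pArr G f"
    unfolding FArr_eq[OF assms] by (rule H.Comp_clv[OF c(1) d v(1)])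
  show "cartesian C H (FArr \<mu> f)"
    unfolding FArr_eq[OF assms] using v H.clv_simps[OF c(1) d]
    by (intro H.cartesian_Comp_iso[where x = "Co \<C> (Dom G f)"] H.clv_cartesian d c) simp_all
qed

text \<open>For \<open>f = clv i y \<sqdot> h\<close> and \<open>g = clv j z \<sqdot> k\<close> the composite in normal form is
  \<open>g f = clv (j i) z \<sqdot> \<phi> \<sqdot> i\<^sup>*k \<sqdot> h\<close> with \<open>\<phi>\<close> the coherence isomorphism. In \<open>H\<close> the same rearrangement
  is applied to \<open>m = \<alpha>\<^sub>j(z)\<^sup>-\<^sup>1 \<sqdot> k\<^sub>*\<close> in place of \<open>k\<close>. The two normal forms agree after composition with
  \<open>\<alpha>\<^sub>j\<^sub>i(z)\<close>, by the coherence of \<open>\<alpha>\<close> (which turns \<open>\<phi>\<close> of \<open>H\<close> into \<open>\<phi>\<close> of \<open>G\<close>) followed by its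
  naturality for \<open>k\<close>.\<close>

lemma FArr_Comp:
  assumes f: "f \<in> Arr G" and g: "g \<in> Arr G" and fg: "Dom G g = Cod G f"
  shows "FArr \<mu> (g \<cdot>\<^bsub>G\<^esub> f) = FArr \<mu> g \<cdot>\<^bsub>H\<^esub> FArr \<mu> f"
proof -
  define x y z i j where d: "x = Dom G f" "y = Cod G f" "z = Cod G g" "i = pArr G f" "j = pArr G g"
  let ?h = "vertical_part C G f" and ?k = "vertical_part C G g"
  have i: "i \<in> Arr C" "y \<in> Obj G" "Cod C i = pObj G y"
    and j: "j \<in> Arr C" "z \<in> Obj G" "Cod C j = pObj G z" "Cod C i = Dom C j"
    using f g fg G.pArr_simps G.total.Cod_closed by (simp_all add: d)
  have ji: "j \<cdot>\<^bsub>C\<^esub> i \<in> Arr C" "Cod C (j \<cdot>\<^bsub>C\<^esub> i) = pObj G z"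
    using i j G.base.CompD[of i j] by simp_all
  have h: "?h \<in> vert C G x (restr_obj G i y)" "clv G i y \<cdot>\<^bsub>G\<^esub> ?h = f"
    and k: "?k \<in> vert C G y (restr_obj G j z)" "clv G j z \<cdot>\<^bsub>G\<^esub> ?k = g"
    using G.vertical_part[OF f] G.vertical_part[OF g] fg by (simp_all add: d)
  let ?z' = "restr_obj G j z"
  note ci = G.clv_simps[OF i] and cj = G.clv_simps[OF j(1-3)] and cji = G.clv_simps[OF ji(1) j(2) ji(2)]
  have z': "?z' \<in> Obj G" "Cod C i = pObj G ?z'" using cj j by simp_all
  note ci' = G.clv_simps[OF i(1) z']
  note rk = G.restr_arr[OF k(1) i(1,3)]
  note co = G.coh[OF j(1-3) i(1) j(4)]
  let ?rk = "restr_arr C G i ?k" and ?co = "coh C G j i z"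
  note hd = G.vert_simps[OF h(1)] and kd = G.vert_simps[OF k(1)] and rkd = G.vert_simps[OF rk(1)]
    and cod = G.vert_simps[OF co(1)]
  have gf: "g \<cdot>\<^bsub>G\<^esub> f = clv G (j \<cdot>\<^bsub>C\<^esub> i) z \<cdot>\<^bsub>G\<^esub> (?co \<cdot>\<^bsub>G\<^esub> (?rk \<cdot>\<^bsub>G\<^esub> ?h))"
  proof -
    have "clv G (j \<cdot>\<^bsub>C\<^esub> i) z \<cdot>\<^bsub>G\<^esub> (?co \<cdot>\<^bsub>G\<^esub> (?rk \<cdot>\<^bsub>G\<^esub> ?h)) = (clv G (j \<cdot>\<^bsub>C\<^esub> i) z \<cdot>\<^bsub>G\<^esub> ?co) \<cdot>\<^bsub>G\<^esub> (?rk \<cdot>\<^bsub>G\<^esub> ?h)"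
      by (simp add: cji cod rkd hd G.total.Comp_assoc G.total.CompD)
    also have "\<dots> = clv G j z \<cdot>\<^bsub>G\<^esub> ((clv G i ?z' \<cdot>\<^bsub>G\<^esub> ?rk) \<cdot>\<^bsub>G\<^esub> ?h)"
      unfolding co(2) using cj ci' rkd hd by (simp add: G.total.Comp_assoc G.total.CompD)
    also have "\<dots> = (clv G j z \<cdot>\<^bsub>G\<^esub> ?k) \<cdot>\<^bsub>G\<^esub> (clv G i y \<cdot>\<^bsub>G\<^esub> ?h)"
      unfolding rk(2) by (simp add: cj kd ci hd G.total.Comp_assoc G.total.CompD)
    finally show ?thesis using h k by simp
  qed
  have v: "?co \<cdot>\<^bsub>G\<^esub> (?rk \<cdot>\<^bsub>G\<^esub> ?h) \<in> vert C G x (restr_obj G (j \<cdot>\<^bsub>C\<^esub> i) z)"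
    by (rule G.vert_Comp[OF G.vert_Comp[OF h(1) rk(1)] co(1)])
  define a b c e where abc: "a = alp \<C> (j, z)" "b = alp \<C> (i, y)" "c = alp \<C> (i, ?z')"
    "e = alp \<C> (j \<cdot>\<^bsub>C\<^esub> i, z)"
  note a = alp[OF j(1-3), folded abc] and b = alp[OF i, folded abc]
    and c = alp[OF i(1) z', folded abc] and e = alp[OF ji(1) j(2) ji(2), folded abc]
  \<comment> \<open>The restriction of \<open>m = a\<^sup>-\<^sup>1 \<sqdot> k\<^sub>*\<close> is determined by \<open>i\<^sup>*a \<sqdot> i\<^sup>*m = i\<^sup>*(k\<^sub>*)\<close>, without restricting
    an inverse.\<close>
  define m where "m = inverse_arr H a \<cdot>\<^bsub>H\<^esub> push \<C> ?k"
  note ph = push_vert[OF h(1)] and pk = push_vert[OF k(1)] and prk = push_vert[OF rk(1)]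
    and pco = push_vert[OF co(1)]
  have m: "m \<in> vert C H (Co \<C> y) (restr_obj H j (Co \<C> z))"
    unfolding m_def by (rule H.vert_Comp[OF pk(1) a(3)])
  have am: "a \<cdot>\<^bsub>H\<^esub> m = push \<C> ?k"
    using H.vert_simps[OF pk(1)] H.vert_simps[OF a(1)] a(2) by (simp add: m_def H.total.iso_Comp_inverse)
  have y: "Co \<C> y \<in> Obj H" "Cod C i = pObj H (Co \<C> y)" and z: "Co \<C> z \<in> Obj H" "Cod C j = pObj H (Co \<C> z)"
    and jiz: "Cod C (j \<cdot>\<^bsub>C\<^esub> i) = pObj H (Co \<C> z)"
    using Co_simps i j ji by simp_all
  note cHi = H.clv_simps[OF i(1) y] and cHj = H.clv_simps[OF j(1) z] and cHji = H.clv_simps[OF ji(1) z(1) jiz]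
  have z'': "restr_obj H j (Co \<C> z) \<in> Obj H" "Cod C i = pObj H (restr_obj H j (Co \<C> z))"
    using cHj j by simp_all
  note cHi' = H.clv_simps[OF i(1) z'']
  note rm = H.restr_arr[OF m i(1) y(2)] and ra = H.restr_arr[OF a(1) i(1) z''(2)]
    and coH = H.coh[OF j(1) z i(1) j(4)]
  let ?rm = "restr_arr C H i m" and ?ra = "restr_arr C H i a" and ?coH = "coh C H j i (Co \<C> z)"
  note D = m[THEN H.vert_simps] a(1)[THEN H.vert_simps] b(1)[THEN H.vert_simps]
    c(1)[THEN H.vert_simps] e(1)[THEN H.vert_simps] b(3)[THEN H.vert_simps]
    e(3)[THEN H.vert_simps] ph(1)[THEN H.vert_simps] pk(1)[THEN H.vert_simps]
    prk(1)[THEN H.vert_simps] pco(1)[THEN H.vert_simps] rm(1)[THEN H.vert_simps]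
    ra(1)[THEN H.vert_simps] coH(1)[THEN H.vert_simps]
  have ram: "restr_arr C H i (push \<C> ?k) = ?ra \<cdot>\<^bsub>H\<^esub> ?rm"
    unfolding am[symmetric] by (rule H.restr_arr_Comp[OF m a(1) i(1) y(2)])
  have nat: "push \<C> ?rk \<cdot>\<^bsub>H\<^esub> b = c \<cdot>\<^bsub>H\<^esub> (?ra \<cdot>\<^bsub>H\<^esub> ?rm)"
    using alp_natural[OF k(1) i(1,3)] by (simp add: abc ram)
  have coherent: "e \<cdot>\<^bsub>H\<^esub> ?coH = push \<C> ?co \<cdot>\<^bsub>H\<^esub> (c \<cdot>\<^bsub>H\<^esub> ?ra)"
    using alp_coherent[OF j(1-3) i(1) j(4)] by (simp add: abc)
  let ?t = "inverse_arr H b \<cdot>\<^bsub>H\<^esub> push \<C> ?h"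
  have td: "?t \<in> Arr H" "Cod H ?t = restr_obj H i (Co \<C> y)" by (simp_all add: D H.total.CompD)
  have "e \<cdot>\<^bsub>H\<^esub> (?coH \<cdot>\<^bsub>H\<^esub> (?rm \<cdot>\<^bsub>H\<^esub> ?t)) = (e \<cdot>\<^bsub>H\<^esub> ?coH) \<cdot>\<^bsub>H\<^esub> (?rm \<cdot>\<^bsub>H\<^esub> ?t)"
    by (simp add: D td H.total.Comp_assoc H.total.CompD)
  also have "\<dots> = push \<C> ?co \<cdot>\<^bsub>H\<^esub> ((c \<cdot>\<^bsub>H\<^esub> (?ra \<cdot>\<^bsub>H\<^esub> ?rm)) \<cdot>\<^bsub>H\<^esub> ?t)"
    unfolding coherent by (simp add: D td H.total.Comp_assoc H.total.CompD)
  also have "\<dots> = push \<C> ?co \<cdot>\<^bsub>H\<^esub> (push \<C> ?rk \<cdot>\<^bsub>H\<^esub> (b \<cdot>\<^bsub>H\<^esub> ?t))"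
    unfolding nat[symmetric] by (simp add: D td H.total.Comp_assoc H.total.CompD)
  also have "\<dots> = push \<C> ?co \<cdot>\<^bsub>H\<^esub> (push \<C> ?rk \<cdot>\<^bsub>H\<^esub> push \<C> ?h)"
    by (simp add: D b(2) H.total.iso_Comp_inverse)
  also have "\<dots> = push \<C> (?co \<cdot>\<^bsub>G\<^esub> (?rk \<cdot>\<^bsub>G\<^esub> ?h))"
    using push_Comp[OF h(1) rk(1)] push_Comp[OF G.vert_Comp[OF h(1) rk(1)] co(1)] by simp
  finally have main: "?coH \<cdot>\<^bsub>H\<^esub> (?rm \<cdot>\<^bsub>H\<^esub> ?t) = inverse_arr H e \<cdot>\<^bsub>H\<^esub> push \<C> (?co \<cdot>\<^bsub>G\<^esub> (?rk \<cdot>\<^bsub>G\<^esub> ?h))"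
    using H.total.iso_inverse_Comp[OF e(2), of "?coH \<cdot>\<^bsub>H\<^esub> (?rm \<cdot>\<^bsub>H\<^esub> ?t)"]
    by (simp add: D td H.total.CompD)
  have "FArr \<mu> (g \<cdot>\<^bsub>G\<^esub> f) = clv H (j \<cdot>\<^bsub>C\<^esub> i) (Co \<C> z) \<cdot>\<^bsub>H\<^esub> (?coH \<cdot>\<^bsub>H\<^esub> (?rm \<cdot>\<^bsub>H\<^esub> ?t))"
    unfolding gf main using FArr_clv_Comp[OF ji(1) j(2) ji(2) v] by (simp add: abc)
  also have "\<dots> = (clv H (j \<cdot>\<^bsub>C\<^esub> i) (Co \<C> z) \<cdot>\<^bsub>H\<^esub> ?coH) \<cdot>\<^bsub>H\<^esub> (?rm \<cdot>\<^bsub>H\<^esub> ?t)"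
    by (simp add: cHji D td H.total.Comp_assoc H.total.CompD)
  also have "\<dots> = clv H j (Co \<C> z) \<cdot>\<^bsub>H\<^esub> ((clv H i (restr_obj H j (Co \<C> z)) \<cdot>\<^bsub>H\<^esub> ?rm) \<cdot>\<^bsub>H\<^esub> ?t)"
    unfolding coH(2) using cHj cHi' D td by (simp add: H.total.Comp_assoc H.total.CompD)
  also have "\<dots> = (clv H j (Co \<C> z) \<cdot>\<^bsub>H\<^esub> m) \<cdot>\<^bsub>H\<^esub> (clv H i (Co \<C> y) \<cdot>\<^bsub>H\<^esub> ?t)"
    unfolding rm(2) by (simp add: cHj cHi D td H.total.Comp_assoc H.total.CompD)
  also have "\<dots> = FArr \<mu> g \<cdot>\<^bsub>H\<^esub> FArr \<mu> f"
    using FArr_eq[OF f] FArr_eq[OF g] fg by (simp add: m_def abc d)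
  finally show ?thesis .
qed

text \<open>\<open>\<mu>(id)\<close> is idempotent since \<open>\<mu>\<close> preserves composites, and invertible since it is vertical and
  cartesian.\<close>

lemma FArr_Ident:
  assumes "x \<in> Obj G"
  shows "FArr \<mu> (Ident G x) = Ident H (Co \<C> x)"
proof -
  note I = G.total.Ident_simps[OF assms]
  have IA: "Ident G x \<in> Arr G" using I by simp
  note F = FArr_simps[OF IA]
  have x: "Co \<C> x \<in> Obj H" "pObj H (Co \<C> x) = pObj G x" using Co_simps[OF assms] by simp_all
  have v: "FArr \<mu> (Ident G x) \<in> vert C H (Co \<C> x) (Co \<C> x)"
    using F I x by (intro H.vertI) (simp_all add: G.pArr_Ident assms)
  have idem: "FArr \<mu> (Ident G x) \<cdot>\<^bsub>H\<^esub> FArr \<mu> (Ident G x) = FArr \<mu> (Ident G x)"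
    using FArr_Comp[OF IA IA] I G.total.Comp_Ident_left[OF IA] by simp
  then have "iso_arr H (FArr \<mu> (Ident G x))"
    using F I v by (intro H.cartesian_comparison_iso[of "FArr \<mu> (Ident G x)"]) simp_all
  from H.total.idempotent_iso_is_Ident[OF this _ idem] H.vert_simps[OF v] show ?thesis by simp
qed

text \<open>This is not immediate from the formula for \<open>\<mu>\<close>, because restriction along an identity need not be
  the identity functor: for vertical \<open>f\<close> the formula gives \<open>u \<sqdot> h\<^sub>*\<close> with \<open>u = clv id Co(y) \<sqdot> \<alpha>\<^sub>i\<^sub>d(y)\<^sup>-\<^sup>1\<close> and
  \<open>f = c \<sqdot> h\<close>, where \<open>c = clv id y\<close>. That \<open>u = c\<^sub>*\<close> follows by taking for \<open>f\<close> the identity, for which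
  \<open>h = c\<^sup>-\<^sup>1\<close> and \<open>\<mu>(id) = id = c\<^sub>* \<sqdot> (c\<^sup>-\<^sup>1)\<^sub>*\<close>.\<close>

lemma FArr_vert:
  assumes "f \<in> vert C G x y"
  shows "FArr \<mu> f = push \<C> f"
proof -
  note fd = G.vertD[OF assms]
  let ?i = "Ident C (pObj G y)"
  let ?c = "clv G ?i y"
  have y: "y \<in> Obj G" using fd by simp
  have i: "?i \<in> Arr C" "Cod C ?i = pObj G y" "Dom C ?i = pObj G y"
    using G.base.Ident_simps[OF G.pObj_closed[OF y]] by simp_all
  note cd = G.clv_simps[OF i(1) y i(2)]
  have c: "?c \<in> vert C G (restr_obj G ?i y) y" using cd i by (intro G.vertI) simp_all
  have ci: "iso_arr G ?c" using vert_iso G.vert_arrows_iff c by blast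
  let ?d = "inverse_arr G ?c"
  have d: "?d \<in> vert C G y (restr_obj G ?i y)" by (rule G.vert_inverse[OF c ci])
  have y': "Co \<C> y \<in> Obj H" "Cod C ?i = pObj H (Co \<C> y)" using Co_simps[OF y] i by simp_all
  note a = alp[OF i(1) y i(2)] and cH = H.clv_simps[OF i(1) y']
  note ad = H.vert_simps[OF a(3)]
  let ?u = "clv H ?i (Co \<C> y) \<cdot>\<^bsub>H\<^esub> inverse_arr H (alp \<C> (?i, y))"
  have FArr_u: "FArr \<mu> (?c \<cdot>\<^bsub>G\<^esub> h) = ?u \<cdot>\<^bsub>H\<^esub> push \<C> h" if "h \<in> vert C G z (restr_obj G ?i y)" for h z
    using FArr_clv_Comp[OF i(1) y i(2) that]
    by (simp add: cH ad H.vert_simps[OF push_vert(1)[OF that]] H.total.Comp_assoc)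
  have u: "?u = push \<C> ?c"
  proof (rule H.total.iso_cancel_right)
    note pc = H.vert_simps[OF push_vert(1)[OF c]] and pd = H.vert_simps[OF push_vert(1)[OF d]]
    show "iso_arr H (push \<C> ?d)" by (rule push_vert(2)[OF d])
    show "?u \<in> Arr H" "push \<C> ?c \<in> Arr H" "Dom H ?u = Cod H (push \<C> ?d)"
      "Dom H (push \<C> ?c) = Cod H (push \<C> ?d)"
      by (simp_all add: cH ad pc pd H.total.CompD)
    have "?c \<cdot>\<^bsub>G\<^esub> ?d = Ident G y" using G.total.inverse_arr(6)[OF ci] cd by simp
    then show "?u \<cdot>\<^bsub>H\<^esub> push \<C> ?d = push \<C> ?c \<cdot>\<^bsub>H\<^esub> push \<C> ?d"
      using FArr_u[OF d] FArr_Ident[OF y] push_Comp[OF d c] push_Ident[OF y] by (metis)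
  qed
  have h: "vertical_part C G f \<in> vert C G x (restr_obj G ?i y)" "?c \<cdot>\<^bsub>G\<^esub> vertical_part C G f = f"
    using G.vertical_part[of f] fd by simp_all
  show ?thesis using FArr_u[OF h(1)] push_Comp[OF h(1) c] h(2) u by simp
qed

lemma functor_of_cartesian: "cartesian_functor C G H \<mu>"
  unfolding cartesian_functor_def
proof (intro conjI ballI allI impI)
  show "FObj \<mu> \<in> extensional (Obj G)" "FArr \<mu> \<in> extensional (Arr G)"
    using extensional by (simp_all add: functor_of_def)
  have FObj: "FObj \<mu> = Co \<C>" by (simp add: functor_of_def)
  show "FObj \<mu> x \<in> fib H (pObj G x)" "FArr \<mu> (Ident G x) = Ident H (FObj \<mu> x)" if "x \<in> Obj G" for x
    using Co_simps FArr_Ident that by (simp_all add: FObj fib_def)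
  show "FArr \<mu> f \<in> arrows H (FObj \<mu> (Dom G f)) (FObj \<mu> (Cod G f))" "pArr H (FArr \<mu> f) = pArr G f"
    if "f \<in> Arr G" for f
    using FArr_simps(1)[OF that] by (simp_all add: FObj arrows_def)
  show "FArr \<mu> (g \<cdot>\<^bsub>G\<^esub> f) = FArr \<mu> g \<cdot>\<^bsub>H\<^esub> FArr \<mu> f" if "f \<in> Arr G" "g \<in> Arr G" "Dom G g = Cod G f" for f g
    by (rule FArr_Comp[OF that])
  show "cartesian C H (FArr \<mu> f)" if "cartesian C G f" for f
    using that unfolding cartesian_def[of C G] by (intro FArr_simps(2)) blast
qed

lemma conn_of_functor_of: "conn_of C G H \<mu> = \<C>"
proof -
  interpret F: functor_over C G H \<mu>
    by unfold_locales (rule functor_of_cartesian)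
  have FObj: "FObj \<mu> = Co \<C>" by (simp add: functor_of_def)
  have push: "push F.\<C> = push \<C>"
  proof (rule extensionalityI[of _ "vert_arrows C G"])
    show "push F.\<C> \<in> extensional (vert_arrows C G)" "push \<C> \<in> extensional (vert_arrows C G)"
      by (rule F.conn_extensional extensional)+
    show "push F.\<C> f = push \<C> f" if f: "f \<in> vert_arrows C G" for f
    proof -
      obtain x y where "f \<in> vert C G x y" using f G.vert_arrows_iff by blast
      from trans[OF F.push[OF this] FArr_vert[OF this]] show ?thesis .
    qed
  qed
  have "alp F.\<C> (i, x) = alp \<C> (i, x)" if ix: "i \<in> Arr C" "x \<in> Obj G" "Cod C i = pObj G x" for i x
  proof -
    have x: "Co \<C> x \<in> Obj H" "Cod C i = pObj H (Co \<C> x)" using Co_simps ix by simp_all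
    note a = alp[OF ix] and c = G.clv_simps[OF ix] and cH = H.clv_simps[OF ix(1) x]
    let ?k = "clv G i x" and ?K = "clv H i (Co \<C> x)" and ?b = "inverse_arr H (alp \<C> (i, x))"
    have yO: "restr_obj G i x \<in> Obj G" using c by simp
    note ad = H.vert_simps[OF a(1)] and bd = H.vert_simps[OF a(3)]
    have "?k \<cdot>\<^bsub>G\<^esub> Ident G (restr_obj G i x) = ?k"
      using c G.total.Comp_Ident_right[of ?k] by simp
    moreover have "?b \<cdot>\<^bsub>H\<^esub> Ident H (Co \<C> (restr_obj G i x)) = ?b"
      using bd H.total.Comp_Ident_right[of ?b] by simp
    ultimately have k: "FArr \<mu> ?k = ?K \<cdot>\<^bsub>H\<^esub> ?b"
      using FArr_clv_Comp[OF ix G.vert_Ident[OF yO]] push_Ident[OF yO] by metis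
    have "FArr \<mu> ?k \<cdot>\<^bsub>H\<^esub> alp \<C> (i, x) = ?K \<cdot>\<^bsub>H\<^esub> (?b \<cdot>\<^bsub>H\<^esub> alp \<C> (i, x))"
      unfolding k by (simp add: cH ad bd H.total.Comp_assoc)
    also have "\<dots> = FArr \<mu> ?k \<cdot>\<^bsub>H\<^esub> alp F.\<C> (i, x)"
      using H.total.Comp_Ident_right[of ?K] F.alp(2)[OF ix]
      by (simp add: H.total.inverse_arr(5)[OF a(2)] ad cH FObj)
    finally have eq: "FArr \<mu> ?k \<cdot>\<^bsub>H\<^esub> alp \<C> (i, x) = FArr \<mu> ?k \<cdot>\<^bsub>H\<^esub> alp F.\<C> (i, x)" .
    have D: "Dom H (FArr \<mu> ?k) = Co \<C> (restr_obj G i x)"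
      using F.FArr_clv_simps(2)[OF ix] unfolding FObj .
    have "alp \<C> (i, x) = alp F.\<C> (i, x)"
    proof (rule H.vert_cartesian_cancel[OF F.FArr_clv_simps(5)[OF ix] _ _ eq])
      show "alp \<C> (i, x) \<in> vert C H (restr_obj H i (Co \<C> x)) (Dom H (FArr \<mu> ?k))"
        unfolding D by (rule a(1))
      show "alp F.\<C> (i, x) \<in> vert C H (restr_obj H i (Co \<C> x)) (Dom H (FArr \<mu> ?k))"
        unfolding D using F.alp(1)[OF ix] unfolding FObj .
    qed
    then show ?thesis ..
  qed
  then have "alp F.\<C> = alp \<C>"
    using F.conn_extensional(2) extensional(2)
    by (intro extensionalityI[of _ "restr_pairs C G"]) (force simp: restr_pairs_def)+
  moreover have "Co F.\<C> = Co \<C>" using FObj by (simp add: conn_of_def)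
  ultimately show ?thesis using push by (intro conn_data.equality) simp_all
qed

end

text \<open>The correspondence between fibred categories and pseudofunctors, on morphisms.\<close>

lemma (in fibration_pair) bij_betw_conn_of:
  "bij_betw (conn_of C G H) {\<mu>. cartesian_functor C G H \<mu>} {\<C>. pseudonatural C G H \<C>}"
proof (rule bij_betw_byWitness[where f' = "functor_of C G H"])
  have F: "functor_over C G H \<mu>" if "cartesian_functor C G H \<mu>" for \<mu>
    using that fibration_pair_axioms by (simp add: functor_over_def functor_over_axioms_def)
  have P: "pseudonatural_over C G H \<C>" if "pseudonatural C G H \<C>" for \<C>
    using that fibration_pair_axioms by (simp add: pseudonatural_over_def pseudonatural_over_axioms_def)
  show "\<forall>\<mu>\<in>{\<mu>. cartesian_functor C G H \<mu>}. functor_of C G H (conn_of C G H \<mu>) = \<mu>"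
    using F functor_over.functor_of_conn_of by blast
  show "\<forall>\<C>\<in>{\<C>. pseudonatural C G H \<C>}. conn_of C G H (functor_of C G H \<C>) = \<C>"
    using P pseudonatural_over.conn_of_functor_of by blast
  show "conn_of C G H ` {\<mu>. cartesian_functor C G H \<mu>} \<subseteq> {\<C>. pseudonatural C G H \<C>}"
    using F functor_over.conn_of_pseudonatural by blast
  show "functor_of C G H ` {\<C>. pseudonatural C G H \<C>} \<subseteq> {\<mu>. cartesian_functor C G H \<mu>}"
    using P pseudonatural_over.functor_of_cartesian by blast
qed

section \<open>The fibred category of torsors\<close>

context site
begin

lemma slice_simps:
  "j \<in> Obj (slice C U) \<longleftrightarrow> j \<in> Arr C \<and> Cod C j = U"
  "(j, k) \<in> Arr (slice C U) \<longleftrightarrow> j \<in> Arr C \<and> Cod C j = U \<and> k \<in> Arr C \<and> Cod C k = Dom C j"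
  "Dom (slice C U) (j, k) = j \<cdot>\<^bsub>C\<^esub> k"
  "Cod (slice C U) (j, k) = j"
  "Ident (slice C U) j = (j, Ident C (Dom C j))"
  "Comp (slice C U) (j, k) (j', l) = (j, k \<cdot>\<^bsub>C\<^esub> l)"
  "R \<in> Cov (slice C U) j \<longleftrightarrow> (\<exists>R0\<in>Cov C (Dom C j). R = Pair j ` R0)"
  by (auto simp: slice_def)

text \<open>A covering of \<open>j : W \<rightarrow> V\<close> in \<open>C/V\<close> and one of \<open>i \<sqdot> j\<close> in \<open>C/U\<close> are given by the same covering of
  \<open>W\<close> in \<open>C\<close>, so that the gluing problems over \<open>V\<close> and over \<open>U\<close> coincide.\<close>

lemma sheaf_slice_pullback:
  assumes i: "i \<in> Arr C" and S: "is_sheaf (slice C (Cod C i)) S r"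
  shows "is_sheaf (slice C (Dom C i)) (\<lambda>j. S (i \<cdot>\<^bsub>C\<^esub> j)) (\<lambda>(j, k). r (i \<cdot>\<^bsub>C\<^esub> j, k))"
  unfolding is_sheaf_def
proof (intro conjI ballI allI impI)
  have pre: "is_presheaf (slice C (Cod C i)) S r" using S by (simp add: is_sheaf_def)
  have ij: "i \<cdot>\<^bsub>C\<^esub> j \<in> Arr C" "Cod C (i \<cdot>\<^bsub>C\<^esub> j) = Cod C i" "Dom C (i \<cdot>\<^bsub>C\<^esub> j) = Dom C j"
    if "j \<in> Arr C" "Cod C j = Dom C i" for j
    using that i CompD[of j i] by simp_all
  have assoc: "i \<cdot>\<^bsub>C\<^esub> j \<cdot>\<^bsub>C\<^esub> k = i \<cdot>\<^bsub>C\<^esub> (j \<cdot>\<^bsub>C\<^esub> k)"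
    if "j \<in> Arr C" "Cod C j = Dom C i" "k \<in> Arr C" "Cod C k = Dom C j" for j k
    using that i Comp_assoc by simp
  show "is_presheaf (slice C (Dom C i)) (\<lambda>j. S (i \<cdot>\<^bsub>C\<^esub> j)) (\<lambda>(j, k). r (i \<cdot>\<^bsub>C\<^esub> j, k))"
    unfolding is_presheaf_def
  proof (intro conjI ballI impI)
    fix f assume "f \<in> Arr (slice C (Dom C i))"
    then obtain j k where f: "f = (j, k)" "j \<in> Arr C" "Cod C j = Dom C i" "k \<in> Arr C"
        "Cod C k = Dom C j"
      by (cases f) (auto simp: slice_simps)
    then have "(i \<cdot>\<^bsub>C\<^esub> j, k) \<in> Arr (slice C (Cod C i))" using ij by (simp add: slice_simps)
    then have "r (i \<cdot>\<^bsub>C\<^esub> j, k) \<in> S (i \<cdot>\<^bsub>C\<^esub> j) \<rightarrow> S (i \<cdot>\<^bsub>C\<^esub> j \<cdot>\<^bsub>C\<^esub> k)"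
      using pre unfolding is_presheaf_def by (metis slice_simps(3,4))
    then show "(case f of (j, k) \<Rightarrow> r (i \<cdot>\<^bsub>C\<^esub> j, k)) \<in> S (i \<cdot>\<^bsub>C\<^esub> Cod (slice C (Dom C i)) f) \<rightarrow>
        S (i \<cdot>\<^bsub>C\<^esub> Dom (slice C (Dom C i)) f)"
      using f assoc by (simp add: slice_simps)
  next
    fix j s assume j: "j \<in> Obj (slice C (Dom C i))" and s: "s \<in> S (i \<cdot>\<^bsub>C\<^esub> j)"
    then have "i \<cdot>\<^bsub>C\<^esub> j \<in> Obj (slice C (Cod C i))" using ij by (simp add: slice_simps)
    then have "r (Ident (slice C (Cod C i)) (i \<cdot>\<^bsub>C\<^esub> j)) s = s"
      using pre s unfolding is_presheaf_def by blast
    then show "(case Ident (slice C (Dom C i)) j of (j, k) \<Rightarrow> r (i \<cdot>\<^bsub>C\<^esub> j, k)) s = s"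
      using j ij by (simp add: slice_simps)
  next
    fix f g s assume f: "f \<in> Arr (slice C (Dom C i))" and g: "g \<in> Arr (slice C (Dom C i))"
      and fg: "Cod (slice C (Dom C i)) g = Dom (slice C (Dom C i)) f"
      and s: "s \<in> S (i \<cdot>\<^bsub>C\<^esub> Cod (slice C (Dom C i)) f)"
    obtain j k l where fk: "f = (j, k)" "j \<in> Arr C" "Cod C j = Dom C i" "k \<in> Arr C"
        "Cod C k = Dom C j" "g = (j \<cdot>\<^bsub>C\<^esub> k, l)" "l \<in> Arr C" "Cod C l = Dom C k"
      using f g fg by (cases f; cases g) (auto simp: slice_simps CompD)
    let ?f = "(i \<cdot>\<^bsub>C\<^esub> j, k)" and ?g = "(i \<cdot>\<^bsub>C\<^esub> j \<cdot>\<^bsub>C\<^esub> k, l)" and ?D = "slice C (Cod C i)"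
    have "?f \<in> Arr ?D" "?g \<in> Arr ?D" "Cod ?D ?g = Dom ?D ?f" "s \<in> S (Cod ?D ?f)"
      using fk ij s CompD[of k "i \<cdot>\<^bsub>C\<^esub> j"] by (simp_all add: slice_simps)
    then have "r (Comp ?D ?f ?g) s = r ?g (r ?f s)" using pre unfolding is_presheaf_def by blast
    then show "(case Comp (slice C (Dom C i)) f g of (j, k) \<Rightarrow> r (i \<cdot>\<^bsub>C\<^esub> j, k)) s =
        (case g of (j, k) \<Rightarrow> r (i \<cdot>\<^bsub>C\<^esub> j, k)) ((case f of (j, k) \<Rightarrow> r (i \<cdot>\<^bsub>C\<^esub> j, k)) s)"
      using fk assoc by (simp add: slice_simps)
  qed
  fix j R s assume j: "j \<in> Obj (slice C (Dom C i))" and R: "R \<in> Cov (slice C (Dom C i)) j"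
    and s: "(\<forall>f\<in>R. s f \<in> S (i \<cdot>\<^bsub>C\<^esub> Dom (slice C (Dom C i)) f)) \<and>
      (\<forall>f\<in>R. \<forall>g\<in>R. \<forall>p\<in>Arr (slice C (Dom C i)). \<forall>q\<in>Arr (slice C (Dom C i)).
         Cod (slice C (Dom C i)) p = Dom (slice C (Dom C i)) f \<and>
         Cod (slice C (Dom C i)) q = Dom (slice C (Dom C i)) g \<and>
         Comp (slice C (Dom C i)) f p = Comp (slice C (Dom C i)) g q \<longrightarrow>
         (case p of (j, k) \<Rightarrow> r (i \<cdot>\<^bsub>C\<^esub> j, k)) (s f) = (case q of (j, k) \<Rightarrow> r (i \<cdot>\<^bsub>C\<^esub> j, k)) (s g))"
  have jA: "j \<in> Arr C" "Cod C j = Dom C i" using j by (simp_all add: slice_simps)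
  obtain R0 where R0: "R0 \<in> Cov C (Dom C j)" "R = Pair j ` R0" using R by (auto simp: slice_simps)
  have m: "m \<in> Arr C" "Cod C m = Dom C j" if "m \<in> R0" for m
    using Cov_arrows[OF Dom_closed[OF jA(1)] R0(1) that] by simp_all
  let ?j = "i \<cdot>\<^bsub>C\<^esub> j" and ?D = "slice C (Cod C i)"
  have "\<exists>!t. t \<in> S ?j \<and> (\<forall>f\<in>Pair ?j ` R0. r f t = s (j, snd f))"
  proof (rule S[unfolded is_sheaf_def, THEN conjunct2, THEN bspec, THEN bspec, THEN spec, THEN mp])
    show "?j \<in> Obj ?D" using ij jA by (simp add: slice_simps)
    show "Pair ?j ` R0 \<in> Cov ?D ?j" using R0 ij jA by (auto simp: slice_simps)
    show "(\<forall>f\<in>Pair ?j ` R0. s (j, snd f) \<in> S (Dom ?D f)) \<and>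
      (\<forall>f\<in>Pair ?j ` R0. \<forall>g\<in>Pair ?j ` R0. \<forall>p\<in>Arr ?D. \<forall>q\<in>Arr ?D.
         Cod ?D p = Dom ?D f \<and> Cod ?D q = Dom ?D g \<and> Comp ?D f p = Comp ?D g q \<longrightarrow>
         r p (s (j, snd f)) = r q (s (j, snd g)))"
    proof (intro conjI ballI impI)
      fix f assume "f \<in> Pair ?j ` R0"
      then show "s (j, snd f) \<in> S (Dom ?D f)"
        using s R0 m assoc jA by (auto simp: slice_simps)
    next
      fix f g p q assume f: "f \<in> Pair ?j ` R0" and g: "g \<in> Pair ?j ` R0"
        and p: "p \<in> Arr ?D" and q: "q \<in> Arr ?D"
        and e: "Cod ?D p = Dom ?D f \<and> Cod ?D q = Dom ?D g \<and> Comp ?D f p = Comp ?D g q"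
      obtain m1 m2 where m12: "f = (?j, m1)" "m1 \<in> R0" "g = (?j, m2)" "m2 \<in> R0" using f g by blast
      obtain k l where kl: "p = (?j \<cdot>\<^bsub>C\<^esub> m1, k)" "q = (?j \<cdot>\<^bsub>C\<^esub> m2, l)" using p q e m12
        by (cases p; cases q) (auto simp: slice_simps)
      note M = m[OF m12(2)] m[OF m12(4)]
      have kl': "k \<in> Arr C" "l \<in> Arr C" "Cod C k = Dom C m1" "Cod C l = Dom C m2" "m1 \<cdot>\<^bsub>C\<^esub> k = m2 \<cdot>\<^bsub>C\<^esub> l"
        using p q e m12 kl M ij[OF jA] CompD[of m1 ?j] CompD[of m2 ?j] by (simp_all add: slice_simps)
      have "(j \<cdot>\<^bsub>C\<^esub> m1, k) \<in> Arr (slice C (Dom C i))" "(j \<cdot>\<^bsub>C\<^esub> m2, l) \<in> Arr (slice C (Dom C i))"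
        using kl' M jA CompD[of m1 j] CompD[of m2 j] by (simp_all add: slice_simps)
      moreover have "(j, m1) \<in> R" "(j, m2) \<in> R" using m12 R0 by auto
      ultimately have "(case (j \<cdot>\<^bsub>C\<^esub> m1, k) of (j, k) \<Rightarrow> r (i \<cdot>\<^bsub>C\<^esub> j, k)) (s (j, m1)) =
          (case (j \<cdot>\<^bsub>C\<^esub> m2, l) of (j, k) \<Rightarrow> r (i \<cdot>\<^bsub>C\<^esub> j, k)) (s (j, m2))"
        using s[THEN conjunct2, THEN bspec, THEN bspec, THEN bspec, THEN bspec, THEN mp,
            of "(j, m1)" "(j, m2)" "(j \<cdot>\<^bsub>C\<^esub> m1, k)" "(j \<cdot>\<^bsub>C\<^esub> m2, l)"] kl' by (simp add: slice_simps)
      then show "r p (s (j, snd f)) = r q (s (j, snd g))"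
        using m12 kl assoc[OF jA] M by simp
    qed
  qed
  then show "\<exists>!t. t \<in> S (i \<cdot>\<^bsub>C\<^esub> j) \<and> (\<forall>f\<in>R. (case f of (j, k) \<Rightarrow> r (i \<cdot>\<^bsub>C\<^esub> j, k)) t = s f)"
    using R0 by simp
qed

lemma torsor_over_pullback:
  assumes i: "i \<in> Arr C" and T: "torsor_over C B rB (Cod C i) T"
  shows "torsor_over C B rB (Dom C i) (torsor_pullback C i T)"
proof -
  have ij: "i \<cdot>\<^bsub>C\<^esub> j \<in> Arr C" "Cod C (i \<cdot>\<^bsub>C\<^esub> j) = Cod C i" "Dom C (i \<cdot>\<^bsub>C\<^esub> j) = Dom C j"
    if "j \<in> Arr C" "Cod C j = Dom C i" for j
    using that i CompD[of j i] by simp_all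
  have obj: "i \<cdot>\<^bsub>C\<^esub> j \<in> Obj (slice C (Cod C i))" if "j \<in> Obj (slice C (Dom C i))" for j
    using that ij by (simp add: slice_simps)
  have Dom_obj: "Dom C (i \<cdot>\<^bsub>C\<^esub> j) = Dom C j" if "j \<in> Obj (slice C (Dom C i))" for j
    using that ij by (simp add: slice_simps)
  have assoc: "i \<cdot>\<^bsub>C\<^esub> j \<cdot>\<^bsub>C\<^esub> k = i \<cdot>\<^bsub>C\<^esub> (j \<cdot>\<^bsub>C\<^esub> k)"
    if "j \<in> Arr C" "Cod C j = Dom C i" "k \<in> Arr C" "Cod C k = Dom C j" for j k
    using that i Comp_assoc by simp
  note T' = T[unfolded torsor_over_def is_torsor_def]
  show ?thesis
    unfolding torsor_over_def is_torsor_def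
  proof (intro conjI)
    show "is_sheaf (slice C (Dom C i)) (Sec (torsor_pullback C i T)) (Res (torsor_pullback C i T))"
      using sheaf_slice_pullback[OF i T'[THEN conjunct1]] by (simp add: torsor_pullback_def)
    show "\<forall>U\<in>Obj (slice C (Dom C i)). \<forall>s\<in>Sec (torsor_pullback C i T) U.
       Act (torsor_pullback C i T) U s \<one>\<^bsub>B (Dom C U)\<^esub> = s \<and>
       (\<forall>b\<in>carrier (B (Dom C U)).
           Act (torsor_pullback C i T) U s b \<in> Sec (torsor_pullback C i T) U \<and>
           (\<forall>c\<in>carrier (B (Dom C U)).
               Act (torsor_pullback C i T) U s (b \<otimes>\<^bsub>B (Dom C U)\<^esub> c) =
               Act (torsor_pullback C i T) U (Act (torsor_pullback C i T) U s b) c))"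
      using T'[THEN conjunct2, THEN conjunct1] obj Dom_obj unfolding torsor_pullback_def
      by (metis torsor.select_convs(1,3))
    show "\<forall>f\<in>Arr (slice C (Dom C i)). \<forall>s\<in>Sec (torsor_pullback C i T) (Cod (slice C (Dom C i)) f).
       \<forall>b\<in>carrier (B (Dom C (Cod (slice C (Dom C i)) f))).
          Res (torsor_pullback C i T) f (Act (torsor_pullback C i T) (Cod (slice C (Dom C i)) f) s b) =
          Act (torsor_pullback C i T) (Dom (slice C (Dom C i)) f) (Res (torsor_pullback C i T) f s)
           ((case f of (i, k) \<Rightarrow> rB k) b)"
    proof (intro ballI)
      fix f s b assume "f \<in> Arr (slice C (Dom C i))"
        "s \<in> Sec (torsor_pullback C i T) (Cod (slice C (Dom C i)) f)"
        and b: "b \<in> carrier (B (Dom C (Cod (slice C (Dom C i)) f)))"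
      then obtain j k where f: "f = (j, k)" "j \<in> Arr C" "Cod C j = Dom C i" "k \<in> Arr C"
          "Cod C k = Dom C j" "s \<in> Sec T (i \<cdot>\<^bsub>C\<^esub> j)"
        by (cases f) (auto simp: slice_simps torsor_pullback_def)
      then have "Res T (i \<cdot>\<^bsub>C\<^esub> j, k) (Act T (i \<cdot>\<^bsub>C\<^esub> j) s b) =
          Act T (i \<cdot>\<^bsub>C\<^esub> j \<cdot>\<^bsub>C\<^esub> k) (Res T (i \<cdot>\<^bsub>C\<^esub> j, k) s) (rB k b)"
        using T'[THEN conjunct2, THEN conjunct2, THEN conjunct1, THEN bspec, of "(i \<cdot>\<^bsub>C\<^esub> j, k)"] ij b
        by (simp add: slice_simps)
      then show "Res (torsor_pullback C i T) f (Act (torsor_pullback C i T) (Cod (slice C (Dom C i)) f) s b) =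
          Act (torsor_pullback C i T) (Dom (slice C (Dom C i)) f) (Res (torsor_pullback C i T) f s)
           ((case f of (i, k) \<Rightarrow> rB k) b)"
        using f assoc by (simp add: slice_simps torsor_pullback_def)
    qed
    show "\<forall>U\<in>Obj (slice C (Dom C i)). \<forall>s\<in>Sec (torsor_pullback C i T) U.
       \<forall>t\<in>Sec (torsor_pullback C i T) U. \<exists>!b. b \<in> carrier (B (Dom C U)) \<and>
         Act (torsor_pullback C i T) U s b = t"
      using T'[THEN conjunct2, THEN conjunct2, THEN conjunct2, THEN conjunct1] obj Dom_obj
      unfolding torsor_pullback_def by (metis torsor.select_convs(1,3))
    show "\<forall>U\<in>Obj (slice C (Dom C i)). \<exists>R\<in>Cov (slice C (Dom C i)) U.
       \<forall>f\<in>R. Sec (torsor_pullback C i T) (Dom (slice C (Dom C i)) f) \<noteq> {}"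
    proof
      fix j assume j: "j \<in> Obj (slice C (Dom C i))"
      then have jA: "j \<in> Arr C" "Cod C j = Dom C i" by (simp_all add: slice_simps)
      obtain R0 where R0: "R0 \<in> Cov C (Dom C j)" "\<forall>f\<in>Pair (i \<cdot>\<^bsub>C\<^esub> j) ` R0. Sec T (Dom (slice C (Cod C i)) f) \<noteq> {}"
        using T'[THEN conjunct2, THEN conjunct2, THEN conjunct2, THEN conjunct2, THEN bspec, OF obj[OF j]]
          Dom_obj[OF j] by (auto simp: slice_simps)
      have "Sec T (i \<cdot>\<^bsub>C\<^esub> (j \<cdot>\<^bsub>C\<^esub> m)) \<noteq> {}" if "m \<in> R0" for m
        using R0(2) that assoc[OF jA] Cov_arrows[OF Dom_closed[OF jA(1)] R0(1) that]
        by (auto simp: slice_simps)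
      then show "\<exists>R\<in>Cov (slice C (Dom C i)) j.
          \<forall>f\<in>R. Sec (torsor_pullback C i T) (Dom (slice C (Dom C i)) f) \<noteq> {}"
        using R0(1) by (intro bexI[of _ "Pair j ` R0"]) (auto simp: slice_simps torsor_pullback_def)
    qed
  qed
qed

lemma torsor_map_slice_iff:
  "torsor_map (slice C U) (\<lambda>i. B (Dom C i)) S T h \<longleftrightarrow>
     h \<in> (\<Pi>\<^sub>E j\<in>Obj (slice C U). Sec S j \<rightarrow>\<^sub>E Sec T j) \<and>
     (\<forall>j k s. j \<in> Arr C \<longrightarrow> Cod C j = U \<longrightarrow> k \<in> Arr C \<longrightarrow> Cod C k = Dom C j \<longrightarrow> s \<in> Sec S j \<longrightarrow>
        h (j \<cdot>\<^bsub>C\<^esub> k) (Res S (j, k) s) = Res T (j, k) (h j s)) \<and>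
     (\<forall>j s b. j \<in> Arr C \<longrightarrow> Cod C j = U \<longrightarrow> s \<in> Sec S j \<longrightarrow> b \<in> carrier (B (Dom C j)) \<longrightarrow>
        h j (Act S j s b) = Act T j (h j s) b)"
proof -
  have 1: "(\<forall>f\<in>Arr (slice C U). P f) \<longleftrightarrow>
      (\<forall>j k. j \<in> Arr C \<longrightarrow> Cod C j = U \<longrightarrow> k \<in> Arr C \<longrightarrow> Cod C k = Dom C j \<longrightarrow> P (j, k))" for P
    by (auto simp: slice_def)
  have 2: "(\<forall>j\<in>Obj (slice C U). P j) \<longleftrightarrow> (\<forall>j. j \<in> Arr C \<longrightarrow> Cod C j = U \<longrightarrow> P j)" for P
    by (auto simp: slice_def)
  show ?thesis
    unfolding torsor_map_def 1 2 slice_simps by blast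
qed

lemma torsor_map_closed:
  assumes "torsor_map D B S T h" "j \<in> Obj D" "s \<in> Sec S j"
  shows "h j s \<in> Sec T j"
  using assms by (auto simp: torsor_map_def PiE_iff)

lemma torsor_map_eqI:
  assumes "torsor_map D B S T h" "torsor_map D B S T' h'"
    "\<And>j s. j \<in> Obj D \<Longrightarrow> s \<in> Sec S j \<Longrightarrow> h j s = h' j s"
  shows "h = h'"
proof (rule extensionalityI[of _ "Obj D"])
  show "h \<in> extensional (Obj D)" "h' \<in> extensional (Obj D)"
    using assms(1,2) by (simp_all add: torsor_map_def PiE_def)
  fix j assume j: "j \<in> Obj D"
  then have "h j \<in> extensional (Sec S j)" "h' j \<in> extensional (Sec S j)"
    using assms(1,2) by (auto simp: torsor_map_def PiE_def Pi_def)
  then show "h j = h' j" using assms(3)[OF j] by (rule extensionalityI)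
qed

text \<open>The two iterated pullbacks differ as records outside of \<open>C/W\<close>, where \<open>W\<close> is the source of \<open>k\<close>.
  Maps into them are nevertheless the same.\<close>

lemma torsor_map_pullback_Comp:
  assumes "i \<in> Arr C" "k \<in> Arr C" "Cod C k = Dom C i"
  shows "torsor_map (slice C (Dom C k)) B S (torsor_pullback C (i \<cdot>\<^bsub>C\<^esub> k) T) h \<longleftrightarrow>
     torsor_map (slice C (Dom C k)) B S (torsor_pullback C k (torsor_pullback C i T)) h"
proof -
  have "i \<cdot>\<^bsub>C\<^esub> k \<cdot>\<^bsub>C\<^esub> j = i \<cdot>\<^bsub>C\<^esub> (k \<cdot>\<^bsub>C\<^esub> j)" if "j \<in> Obj (slice C (Dom C k))" for j
    using that assms Comp_assoc[of j k i] by (simp add: slice_simps)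
  moreover have "Dom (slice C (Dom C k)) f \<in> Obj (slice C (Dom C k))"
    "Cod (slice C (Dom C k)) f \<in> Obj (slice C (Dom C k))"
    "f = (Cod (slice C (Dom C k)) f, snd f)"
    if "f \<in> Arr (slice C (Dom C k))" for f
    using that CompD by (auto simp: slice_def)
  ultimately show ?thesis
    unfolding torsor_map_def torsor_pullback_def
    by (intro conj_cong ball_cong refl) (auto simp: PiE_iff split: prod.splits)
qed

lemma torsor_over_closed:
  assumes T: "torsor_over C B rB U T" and j: "j \<in> Arr C" "Cod C j = U" and s: "s \<in> Sec T j"
  shows "b \<in> carrier (B (Dom C j)) \<Longrightarrow> Act T j s b \<in> Sec T j"
    "\<lbrakk>k \<in> Arr C; Cod C k = Dom C j\<rbrakk> \<Longrightarrow> Res T (j, k) s \<in> Sec T (j \<cdot>\<^bsub>C\<^esub> k)"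
proof -
  note T' = T[unfolded torsor_over_def is_torsor_def]
  have jO: "j \<in> Obj (slice C U)" using j by (simp add: slice_simps)
  show "b \<in> carrier (B (Dom C j)) \<Longrightarrow> Act T j s b \<in> Sec T j"
    using T'[THEN conjunct2, THEN conjunct1, THEN bspec, OF jO, THEN bspec, OF s] by blast
  have "is_presheaf (slice C U) (Sec T) (Res T)" using T' by (simp add: is_sheaf_def)
  then have "\<forall>f\<in>Arr (slice C U). Res T f \<in> Sec T (Cod (slice C U) f) \<rightarrow> Sec T (Dom (slice C U) f)"
    unfolding is_presheaf_def by (rule conjunct1)
  from bspec[OF this, of "(j, k)"]
  show "Res T (j, k) s \<in> Sec T (j \<cdot>\<^bsub>C\<^esub> k)" if "k \<in> Arr C" "Cod C k = Dom C j"
    using that j s by (simp add: slice_simps Pi_iff)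
qed

lemma torsor_map_slice_Res:
  "\<lbrakk>torsor_map (slice C U) (\<lambda>i. B (Dom C i)) S T h; j \<in> Arr C; Cod C j = U; k \<in> Arr C;
     Cod C k = Dom C j; s \<in> Sec S j\<rbrakk> \<Longrightarrow> h (j \<cdot>\<^bsub>C\<^esub> k) (Res S (j, k) s) = Res T (j, k) (h j s)"
  unfolding torsor_map_slice_iff by blast

lemma torsor_map_slice_Act:
  "\<lbrakk>torsor_map (slice C U) (\<lambda>i. B (Dom C i)) S T h; j \<in> Arr C; Cod C j = U; s \<in> Sec S j;
     b \<in> carrier (B (Dom C j))\<rbrakk> \<Longrightarrow> h j (Act S j s b) = Act T j (h j s) b"
  unfolding torsor_map_slice_iff by blast

lemma torsor_map_Comp:
  assumes i: "i \<in> Arr C" and S: "torsor_over C B rB (Dom C i) S"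
    and f: "torsor_map (slice C (Dom C i)) (\<lambda>i. B (Dom C i)) S (torsor_pullback C i T) f"
    and g: "torsor_map (slice C (Cod C i)) (\<lambda>i. B (Dom C i)) T R g"
  shows "torsor_map (slice C (Dom C i)) (\<lambda>i. B (Dom C i)) S (torsor_pullback C i R)
    (\<lambda>j\<in>Obj (slice C (Dom C i)). \<lambda>s\<in>Sec S j. g (i \<cdot>\<^bsub>C\<^esub> j) (f j s))"
  unfolding torsor_map_slice_iff
proof (intro conjI allI impI)
  let ?V = "slice C (Dom C i)" and ?P = "torsor_pullback C i T"
  let ?h = "\<lambda>j\<in>Obj ?V. \<lambda>s\<in>Sec S j. g (i \<cdot>\<^bsub>C\<^esub> j) (f j s)"
  have ij: "i \<cdot>\<^bsub>C\<^esub> j \<in> Arr C" "Cod C (i \<cdot>\<^bsub>C\<^esub> j) = Cod C i" "Dom C (i \<cdot>\<^bsub>C\<^esub> j) = Dom C j"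
    if "j \<in> Arr C" "Cod C j = Dom C i" for j
    using that i CompD[of j i] by simp_all
  have fj: "f j s \<in> Sec T (i \<cdot>\<^bsub>C\<^esub> j)" if "j \<in> Arr C" "Cod C j = Dom C i" "s \<in> Sec S j" for j s
    using torsor_map_closed[OF f, of j s] that by (simp add: slice_simps torsor_pullback_def)
  show "?h \<in> (\<Pi>\<^sub>E j\<in>Obj ?V. Sec S j \<rightarrow>\<^sub>E Sec (torsor_pullback C i R) j)"
  proof (intro PiE_I restrict_extensional)
    fix j s assume "j \<in> Obj ?V" and s: "s \<in> Sec S j"
    then have j: "j \<in> Arr C" "Cod C j = Dom C i" by (simp_all add: slice_simps)
    have "g (i \<cdot>\<^bsub>C\<^esub> j) (f j s) \<in> Sec R (i \<cdot>\<^bsub>C\<^esub> j)"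
      using ij[OF j] fj[OF j s] by (intro torsor_map_closed[OF g]) (simp_all add: slice_simps)
    then show "?h j s \<in> Sec (torsor_pullback C i R) j"
      using j s by (simp add: slice_simps torsor_pullback_def)
  qed simp_all
  have h: "?h j s = g (i \<cdot>\<^bsub>C\<^esub> j) (f j s)" if "j \<in> Arr C" "Cod C j = Dom C i" "s \<in> Sec S j" for j s
    using that by (simp add: slice_simps)
  fix j s assume j: "j \<in> Arr C" "Cod C j = Dom C i" and s: "s \<in> Sec S j"
  {
    fix k assume k: "k \<in> Arr C" "Cod C k = Dom C j"
    have jk: "j \<cdot>\<^bsub>C\<^esub> k \<in> Arr C" "Cod C (j \<cdot>\<^bsub>C\<^esub> k) = Dom C i" and assoc: "i \<cdot>\<^bsub>C\<^esub> (j \<cdot>\<^bsub>C\<^esub> k) = i \<cdot>\<^bsub>C\<^esub> j \<cdot>\<^bsub>C\<^esub> k"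
      using i j k CompD[of k j] Comp_assoc[of k j i] by simp_all
    have "Res S (j, k) s \<in> Sec S (j \<cdot>\<^bsub>C\<^esub> k)" by (rule torsor_over_closed(2)[OF S j s k])
    then have "?h (j \<cdot>\<^bsub>C\<^esub> k) (Res S (j, k) s) = g (i \<cdot>\<^bsub>C\<^esub> j \<cdot>\<^bsub>C\<^esub> k) (f (j \<cdot>\<^bsub>C\<^esub> k) (Res S (j, k) s))"
      using h jk assoc by simp
    also have "f (j \<cdot>\<^bsub>C\<^esub> k) (Res S (j, k) s) = Res T (i \<cdot>\<^bsub>C\<^esub> j, k) (f j s)"
      using torsor_map_slice_Res[OF f j k s] by (simp add: torsor_pullback_def)
    also have "g (i \<cdot>\<^bsub>C\<^esub> j \<cdot>\<^bsub>C\<^esub> k) \<dots> = Res R (i \<cdot>\<^bsub>C\<^esub> j, k) (g (i \<cdot>\<^bsub>C\<^esub> j) (f j s))"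
      using ij[OF j] k fj[OF j s] by (intro torsor_map_slice_Res[OF g]) simp_all
    finally show "?h (j \<cdot>\<^bsub>C\<^esub> k) (Res S (j, k) s) = Res (torsor_pullback C i R) (j, k) (?h j s)"
      unfolding h[OF j s] by (simp del: restrict_apply add: torsor_pullback_def)
  next
    fix b assume b: "b \<in> carrier (B (Dom C j))"
    have "Act S j s b \<in> Sec S j" by (rule torsor_over_closed(1)[OF S j s b])
    then have "?h j (Act S j s b) = g (i \<cdot>\<^bsub>C\<^esub> j) (f j (Act S j s b))" using h[OF j] by simp
    also have "f j (Act S j s b) = Act T (i \<cdot>\<^bsub>C\<^esub> j) (f j s) b"
      using torsor_map_slice_Act[OF f j s b] by (simp add: torsor_pullback_def)
    also have "g (i \<cdot>\<^bsub>C\<^esub> j) \<dots> = Act R (i \<cdot>\<^bsub>C\<^esub> j) (g (i \<cdot>\<^bsub>C\<^esub> j) (f j s)) b"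
      using ij[OF j] b fj[OF j s] by (intro torsor_map_slice_Act[OF g]) simp_all
    finally show "?h j (Act S j s b) = Act (torsor_pullback C i R) j (?h j s) b"
      unfolding h[OF j s] by (simp del: restrict_apply add: torsor_pullback_def)
  }
qed

lemma torsor_map_Ident:
  assumes "U \<in> Obj C" and T: "torsor_over C B rB U T"
  shows "torsor_map (slice C U) (\<lambda>i. B (Dom C i)) T (torsor_pullback C (Ident C U) T)
    (\<lambda>j\<in>Obj (slice C U). \<lambda>s\<in>Sec T j. s)"
proof -
  have "Ident C U \<cdot>\<^bsub>C\<^esub> j = j" if "j \<in> Arr C" "Cod C j = U" for j
    using Comp_Ident_left[OF that(1)] that by simp
  then show ?thesis
    unfolding torsor_map_slice_iff using torsor_over_closed[OF T] CompD
    by (auto simp: slice_simps torsor_pullback_def)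
qed

lemma torsor_map_clv:
  assumes i: "i \<in> Arr C" and T: "torsor_over C B rB (Cod C i) T"
  shows "torsor_map (slice C (Dom C i)) (\<lambda>i. B (Dom C i)) (torsor_pullback C i T) (torsor_pullback C i T)
    (\<lambda>j\<in>Obj (slice C (Dom C i)). \<lambda>s\<in>Sec T (i \<cdot>\<^bsub>C\<^esub> j). s)"
proof -
  have "i \<cdot>\<^bsub>C\<^esub> j \<cdot>\<^bsub>C\<^esub> k = i \<cdot>\<^bsub>C\<^esub> (j \<cdot>\<^bsub>C\<^esub> k)"
    if "j \<in> Arr C" "Cod C j = Dom C i" "k \<in> Arr C" "Cod C k = Dom C j" for j k
    using that i Comp_assoc by simp
  then show ?thesis
    unfolding torsor_map_slice_iff
    using torsor_over_closed[OF torsor_over_pullback[OF assms]] CompD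
    by (auto simp: slice_simps torsor_pullback_def)
qed

lemma Tors_Obj_iff: "x \<in> Obj (Tors C B rB) \<longleftrightarrow> fst x \<in> Obj C \<and> torsor_over C B rB (fst x) (snd x)"
  by (cases x) (simp add: Tors_def)

lemma Tors_simps:
  "Dom (Tors C B rB) = t_src" "Cod (Tors C B rB) = t_tgt" "pObj (Tors C B rB) = fst"
  "pArr (Tors C B rB) = t_base"
  by (simp_all add: Tors_def)

lemma Tors_Arr_iff: "f \<in> Arr (Tors C B rB) \<longleftrightarrow>
    t_src f \<in> Obj (Tors C B rB) \<and> t_tgt f \<in> Obj (Tors C B rB) \<and>
    t_base f \<in> Arr C \<and> fst (t_src f) = Dom C (t_base f) \<and> fst (t_tgt f) = Cod C (t_base f) \<and>
    torsor_map (slice C (fst (t_src f))) (\<lambda>i. B (Dom C i)) (snd (t_src f))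
      (torsor_pullback C (t_base f) (snd (t_tgt f))) (t_map f)"
  by (auto simp: Tors_Obj_iff Tors_def arrows_def)

lemma Tors_torsor_map:
  assumes "f \<in> Arr (Tors C B rB)"
  shows "torsor_map (slice C (Dom C (t_base f))) (\<lambda>i. B (Dom C i)) (snd (t_src f))
      (torsor_pullback C (t_base f) (snd (t_tgt f))) (t_map f)"
    "torsor_over C B rB (Dom C (t_base f)) (snd (t_src f))"
    "torsor_over C B rB (Cod C (t_base f)) (snd (t_tgt f))"
  using assms by (auto simp: Tors_Arr_iff Tors_Obj_iff)

text \<open>As \<open>t_map\<close> is extensional, it is enough to compare arrows on sections.\<close>

lemma Tors_Arr_eqI:
  assumes "f \<in> Arr (Tors C B rB)" "g \<in> Arr (Tors C B rB)"
    "t_src f = t_src g" "t_tgt f = t_tgt g" "t_base f = t_base g"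
    "\<And>j s. \<lbrakk>j \<in> Arr C; Cod C j = Dom C (t_base f); s \<in> Sec (snd (t_src f)) j\<rbrakk> \<Longrightarrow> t_map f j s = t_map g j s"
  shows "f = g"
proof -
  have "t_map f = t_map g"
  proof (rule torsor_map_eqI)
    show "torsor_map (slice C (Dom C (t_base f))) (\<lambda>i. B (Dom C i)) (snd (t_src f))
        (torsor_pullback C (t_base f) (snd (t_tgt f))) (t_map f)"
      by (rule Tors_torsor_map[OF assms(1)])
    show "torsor_map (slice C (Dom C (t_base f))) (\<lambda>i. B (Dom C i)) (snd (t_src f))
        (torsor_pullback C (t_base f) (snd (t_tgt f))) (t_map g)"
      using Tors_torsor_map[OF assms(2)] assms(3-5) by simp
    show "t_map f j s = t_map g j s"
      if "j \<in> Obj (slice C (Dom C (t_base f)))" "s \<in> Sec (snd (t_src f)) j" for j s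
      using assms(6) that by (simp add: slice_simps)
  qed
  then show ?thesis using assms by simp
qed

lemma Tors_Comp_simps:
  "t_src (Comp (Tors C B rB) g f) = t_src f" "t_tgt (Comp (Tors C B rB) g f) = t_tgt g"
  "t_base (Comp (Tors C B rB) g f) = t_base g \<cdot>\<^bsub>C\<^esub> t_base f"
  "t_map (Comp (Tors C B rB) g f) = (\<lambda>j\<in>Obj (slice C (fst (t_src f))). \<lambda>s\<in>Sec (snd (t_src f)) j.
      t_map g (t_base f \<cdot>\<^bsub>C\<^esub> j) (t_map f j s))"
  by (simp_all add: Tors_def)

lemma Tors_Ident_simps:
  "t_src (Ident (Tors C B rB) x) = x" "t_tgt (Ident (Tors C B rB) x) = x"
  "t_base (Ident (Tors C B rB) x) = Ident C (fst x)"
  "t_map (Ident (Tors C B rB) x) = (\<lambda>j\<in>Obj (slice C (fst x)). \<lambda>s\<in>Sec (snd x) j. s)"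
  by (simp_all add: Tors_def split_beta)

lemma Tors_clv_simps:
  "t_src (clv (Tors C B rB) i x) = (Dom C i, torsor_pullback C i (snd x))"
  "t_tgt (clv (Tors C B rB) i x) = x" "t_base (clv (Tors C B rB) i x) = i"
  "t_map (clv (Tors C B rB) i x) = (\<lambda>j\<in>Obj (slice C (Dom C i)). \<lambda>s\<in>Sec (snd x) (i \<cdot>\<^bsub>C\<^esub> j). s)"
  by (simp_all add: Tors_def split_beta)

lemma Tors_map_closed:
  assumes "f \<in> Arr (Tors C B rB)" "j \<in> Arr C" "Cod C j = Dom C (t_base f)" "s \<in> Sec (snd (t_src f)) j"
  shows "t_map f j s \<in> Sec (snd (t_tgt f)) (t_base f \<cdot>\<^bsub>C\<^esub> j)"
proof -
  have "t_map f j s \<in> Sec (torsor_pullback C (t_base f) (snd (t_tgt f))) j"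
    using assms by (intro torsor_map_closed[where j = j and s = s and h = "t_map f"])
      (auto simp: Tors_Arr_iff slice_simps)
  then show ?thesis by (simp add: torsor_pullback_def)
qed

lemma Tors_Comp_closed:
  assumes f: "f \<in> Arr (Tors C B rB)" and g: "g \<in> Arr (Tors C B rB)" and fg: "t_src g = t_tgt f"
  shows "Comp (Tors C B rB) g f \<in> Arr (Tors C B rB)"
proof -
  let ?i = "t_base f" and ?k = "t_base g"
  note f' = f[unfolded Tors_Arr_iff] and g' = g[unfolded Tors_Arr_iff]
  have ik: "?i \<in> Arr C" "?k \<in> Arr C" "Cod C ?i = Dom C ?k" using f' g' fg by simp_all
  have "torsor_map (slice C (Dom C ?i)) (\<lambda>i. B (Dom C i)) (snd (t_src f))
      (torsor_pullback C ?i (torsor_pullback C ?k (snd (t_tgt g))))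
      (t_map (Comp (Tors C B rB) g f))"
  proof -
    have "fst (t_src f) = Dom C ?i" using f' by simp
    moreover have "torsor_map (slice C (Cod C ?i)) (\<lambda>i. B (Dom C i)) (snd (t_tgt f))
        (torsor_pullback C ?k (snd (t_tgt g))) (t_map g)"
      using Tors_torsor_map(1)[OF g] ik fg by simp
    ultimately show ?thesis
      unfolding Tors_Comp_simps
      using torsor_map_Comp[OF ik(1) Tors_torsor_map(2)[OF f] Tors_torsor_map(1)[OF f]] by simp
  qed
  then have "torsor_map (slice C (Dom C ?i)) (\<lambda>i. B (Dom C i)) (snd (t_src f))
      (torsor_pullback C (?k \<cdot>\<^bsub>C\<^esub> ?i) (snd (t_tgt g))) (t_map (Comp (Tors C B rB) g f))"
    using torsor_map_pullback_Comp[OF ik(2,1,3)] by blast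
  then show ?thesis
    using f' g' CompD[OF ik(1,2)] ik(3) by (simp add: Tors_Arr_iff Tors_Comp_simps(1-3))
qed

lemma Tors_category: "category (Tors C B rB)"
proof
  let ?T = "Tors C B rB"
  show "Dom ?T f \<in> Obj ?T" "Cod ?T f \<in> Obj ?T" if "f \<in> Arr ?T" for f
    using that by (simp_all add: Tors_Arr_iff Tors_simps)
  have Id: "Ident ?T x \<in> Arr ?T" if "x \<in> Obj ?T" for x
    using that torsor_map_Ident Ident_simps by (auto simp: Tors_Arr_iff Tors_Obj_iff Tors_Ident_simps)
  then show "Ident ?T x \<in> arrows ?T x x" if "x \<in> Obj ?T" for x
    using that by (simp add: arrows_def Tors_simps Tors_Ident_simps)
  show "Comp ?T g f \<in> arrows ?T (Dom ?T f) (Cod ?T g)"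
    if "f \<in> Arr ?T" "g \<in> Arr ?T" "Dom ?T g = Cod ?T f" for f g
    using that Tors_Comp_closed[of f B rB g] by (simp add: arrows_def Tors_simps Tors_Comp_simps)
  show "Comp ?T (Ident ?T (Cod ?T f)) f = f" if f: "f \<in> Arr ?T" for f
  proof (rule Tors_Arr_eqI)
    note f' = f[unfolded Tors_Arr_iff]
    show "Comp ?T (Ident ?T (Cod ?T f)) f \<in> Arr ?T"
      using f f' by (intro Tors_Comp_closed Id) (simp_all add: Tors_simps Tors_Ident_simps)
    show "t_base (Comp ?T (Ident ?T (Cod ?T f)) f) = t_base f"
      using f' Comp_Ident_left[of "t_base f"] by (simp add: Tors_simps Tors_Comp_simps Tors_Ident_simps)
    fix j s assume "j \<in> Arr C" "Cod C j = Dom C (t_base (Comp ?T (Ident ?T (Cod ?T f)) f))"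
      "s \<in> Sec (snd (t_src (Comp ?T (Ident ?T (Cod ?T f)) f))) j"
    then show "t_map (Comp ?T (Ident ?T (Cod ?T f)) f) j s = t_map f j s"
      using f' Tors_map_closed[OF f, of j s] Comp_Ident_left[of "t_base f"] CompD[of j "t_base f"]
      by (simp add: Tors_simps Tors_Comp_simps Tors_Ident_simps slice_simps)
  qed (use f in \<open>simp_all add: Tors_simps Tors_Comp_simps Tors_Ident_simps\<close>)
  show "Comp ?T f (Ident ?T (Dom ?T f)) = f" if f: "f \<in> Arr ?T" for f
  proof (rule Tors_Arr_eqI)
    note f' = f[unfolded Tors_Arr_iff]
    show "Comp ?T f (Ident ?T (Dom ?T f)) \<in> Arr ?T"
      using f f' by (intro Tors_Comp_closed Id) (simp_all add: Tors_simps Tors_Ident_simps)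
    show "t_base (Comp ?T f (Ident ?T (Dom ?T f))) = t_base f"
      using f' Comp_Ident_right[of "t_base f"] by (simp add: Tors_simps Tors_Comp_simps Tors_Ident_simps)
    fix j s assume "j \<in> Arr C" "Cod C j = Dom C (t_base (Comp ?T f (Ident ?T (Dom ?T f))))"
      "s \<in> Sec (snd (t_src (Comp ?T f (Ident ?T (Dom ?T f))))) j"
    then show "t_map (Comp ?T f (Ident ?T (Dom ?T f))) j s = t_map f j s"
      using f' Comp_Ident_right[of "t_base f"] Comp_Ident_left[of j]
      by (simp add: Tors_simps Tors_Comp_simps Tors_Ident_simps slice_simps)
  qed (use f in \<open>simp_all add: Tors_simps Tors_Comp_simps Tors_Ident_simps\<close>)
  show "Comp ?T (Comp ?T h g) f = Comp ?T h (Comp ?T g f)"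
    if f: "f \<in> Arr ?T" and g: "g \<in> Arr ?T" and h: "h \<in> Arr ?T"
      and "Dom ?T g = Cod ?T f" "Dom ?T h = Cod ?T g" for f g h
  proof (rule Tors_Arr_eqI)
    have e: "t_src g = t_tgt f" "t_src h = t_tgt g" using that by (simp_all add: Tors_simps)
    note f' = f[unfolded Tors_Arr_iff] and g' = g[unfolded Tors_Arr_iff] and h' = h[unfolded Tors_Arr_iff]
    show "Comp ?T (Comp ?T h g) f \<in> Arr ?T" "Comp ?T h (Comp ?T g f) \<in> Arr ?T"
      using f g h e by (auto intro!: Tors_Comp_closed simp: Tors_Comp_simps)
    show base: "t_base (Comp ?T (Comp ?T h g) f) = t_base (Comp ?T h (Comp ?T g f))"
      using f' g' h' e by (simp add: Tors_Comp_simps Comp_assoc)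
    fix j s assume "j \<in> Arr C" "Cod C j = Dom C (t_base (Comp ?T (Comp ?T h g) f))"
      "s \<in> Sec (snd (t_src (Comp ?T (Comp ?T h g) f))) j"
    then have j: "j \<in> Arr C" "Cod C j = Dom C (t_base f)" "s \<in> Sec (snd (t_src f)) j"
      using f' g' h' e by (simp_all add: Tors_Comp_simps CompD)
    have "t_base f \<cdot>\<^bsub>C\<^esub> j \<in> Arr C" "Cod C (t_base f \<cdot>\<^bsub>C\<^esub> j) = Dom C (t_base g)"
      "t_map f j s \<in> Sec (snd (t_src g)) (t_base f \<cdot>\<^bsub>C\<^esub> j)"
      "t_base g \<cdot>\<^bsub>C\<^esub> t_base f \<cdot>\<^bsub>C\<^esub> j = t_base g \<cdot>\<^bsub>C\<^esub> (t_base f \<cdot>\<^bsub>C\<^esub> j)"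
      using f' g' e j Tors_map_closed[OF f j] CompD[of j "t_base f"]
        Comp_assoc[of j "t_base f" "t_base g"] by simp_all
    then show "t_map (Comp ?T (Comp ?T h g) f) j s = t_map (Comp ?T h (Comp ?T g f)) j s"
      using f' g' e j by (simp add: Tors_Comp_simps slice_simps)
  qed (simp_all add: Tors_Comp_simps)
qed

lemma Tors_clv_closed:
  assumes "x \<in> Obj (Tors C B rB)" "i \<in> Arr C" "Cod C i = fst x"
  shows "clv (Tors C B rB) i x \<in> Arr (Tors C B rB)"
  using assms torsor_over_pullback[of i B rB "snd x"] torsor_map_clv[of i B rB "snd x"] Dom_closed
  by (simp add: Tors_Arr_iff Tors_clv_simps Tors_Obj_iff torsor_pullback_def)

text \<open>The chosen lift of \<open>i\<close> is the identity on sections, so that an arrow over \<open>i \<sqdot> k\<close> into a torsor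
  \<open>T\<close> and its factor through \<open>i\<^sup>* T\<close> have the same underlying map.\<close>

lemma Tors_fibration: "fibration C (Tors C B rB)"
proof -
  let ?T = "Tors C B rB"
  interpret T: category ?T by (rule Tors_category)
  show ?thesis
  proof
    show "pObj ?T x \<in> Obj C" if "x \<in> Obj ?T" for x
      using that by (simp add: Tors_Obj_iff Tors_simps)
    show "pArr ?T f \<in> arrows C (pObj ?T (Dom ?T f)) (pObj ?T (Cod ?T f))" if "f \<in> Arr ?T" for f
      using that by (simp add: Tors_Arr_iff Tors_simps arrows_def)
    show "pArr ?T (Ident ?T x) = Ident C (pObj ?T x)" for x
      by (simp add: Tors_simps Tors_Ident_simps)
    show "pArr ?T (Comp ?T g f) = pArr ?T g \<cdot>\<^bsub>C\<^esub> pArr ?T f" for f g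
      by (simp add: Tors_simps Tors_Comp_simps)
    show "Cod ?T (clv ?T i x) = x \<and> pArr ?T (clv ?T i x) = i" for i x
      by (simp add: Tors_simps Tors_clv_simps)
    show "cartesian C ?T (clv ?T i x)" if "x \<in> Obj ?T" "i \<in> Arr C" "Cod C i = pObj ?T x" for i x
      unfolding cartesian_def
    proof (intro conjI ballI impI)
      have xi: "x \<in> Obj ?T" "i \<in> Arr C" "Cod C i = fst x" using that by (simp_all add: Tors_simps)
      show c: "clv ?T i x \<in> Arr ?T" by (rule Tors_clv_closed[OF xi])
      fix g k assume g: "g \<in> Arr ?T" and k: "k \<in> Arr C" and
        "Cod ?T g = Cod ?T (clv ?T i x) \<and> Cod C k = Dom C (pArr ?T (clv ?T i x)) \<and>
          pArr ?T g = pArr ?T (clv ?T i x) \<cdot>\<^bsub>C\<^esub> k"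
      then have e: "t_tgt g = x" "Cod C k = Dom C i" "t_base g = i \<cdot>\<^bsub>C\<^esub> k"
        by (simp_all add: Tors_simps Tors_clv_simps)
      note g' = g[unfolded Tors_Arr_iff] and c' = c[unfolded Tors_Arr_iff Tors_clv_simps]
      define h where "h = g\<lparr>t_tgt := (Dom C i, torsor_pullback C i (snd x)), t_base := k\<rparr>"
      have D: "fst (t_src g) = Dom C k" using g' e xi k CompD[of k i] by simp
      have Dik: "Dom C (i \<cdot>\<^bsub>C\<^esub> k) = Dom C k" using xi k e CompD[of k i] by simp
      have "torsor_map (slice C (Dom C k)) (\<lambda>i. B (Dom C i)) (snd (t_src g))
          (torsor_pullback C k (torsor_pullback C i (snd x))) (t_map g)"
        using Tors_torsor_map(1)[OF g] unfolding e Dik torsor_map_pullback_Comp[OF xi(2) k e(2)] .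
      then have h: "h \<in> Arr ?T"
        using g' c' k e(2) D by (simp add: Tors_Arr_iff h_def)
      have ikj: "k \<cdot>\<^bsub>C\<^esub> j \<in> Obj (slice C (Dom C i))" "i \<cdot>\<^bsub>C\<^esub> (k \<cdot>\<^bsub>C\<^esub> j) = i \<cdot>\<^bsub>C\<^esub> k \<cdot>\<^bsub>C\<^esub> j"
        if "j \<in> Arr C" "Cod C j = Dom C k" for j
        using that k e xi CompD[of j k] Comp_assoc[of j k i] by (simp_all add: slice_simps)
      have map: "t_map (Comp ?T (clv ?T i x) u) j s = t_map u j s"
        if "u \<in> Arr ?T" "t_src u = t_src g" "t_tgt u = (Dom C i, torsor_pullback C i (snd x))"
          "t_base u = k" "j \<in> Arr C" "Cod C j = Dom C k" "s \<in> Sec (snd (t_src g)) j" for u j s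
        using that ikj[OF that(5,6)] Tors_map_closed[OF that(1), of j s] D
        by (simp add: Tors_Comp_simps Tors_clv_simps slice_simps torsor_pullback_def)
      have cg: "Comp ?T (clv ?T i x) u = g \<longleftrightarrow> (\<forall>j s. j \<in> Arr C \<longrightarrow> Cod C j = Dom C k \<longrightarrow>
          s \<in> Sec (snd (t_src g)) j \<longrightarrow> t_map u j s = t_map g j s)"
        if u: "u \<in> Arr ?T" "t_src u = t_src g" "t_tgt u = (Dom C i, torsor_pullback C i (snd x))"
          "t_base u = k" for u
      proof
        assume "Comp ?T (clv ?T i x) u = g"
        then show "\<forall>j s. j \<in> Arr C \<longrightarrow> Cod C j = Dom C k \<longrightarrow>
          s \<in> Sec (snd (t_src g)) j \<longrightarrow> t_map u j s = t_map g j s" using map[OF u] by simp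
      next
        assume m: "\<forall>j s. j \<in> Arr C \<longrightarrow> Cod C j = Dom C k \<longrightarrow>
          s \<in> Sec (snd (t_src g)) j \<longrightarrow> t_map u j s = t_map g j s"
        have "Dom C (i \<cdot>\<^bsub>C\<^esub> k) = Dom C k" using CompD[of k i] k xi e by simp
        then show "Comp ?T (clv ?T i x) u = g"
          using u e m map[OF u] g
          by (intro Tors_Arr_eqI[OF Tors_Comp_closed[OF u(1) c] g])
            (simp_all add: Tors_clv_simps Tors_Comp_simps(1-3))
      qed
      show "\<exists>!h. h \<in> arrows ?T (Dom ?T g) (Dom ?T (clv ?T i x)) \<and> pArr ?T h = k \<and>
          Comp ?T (clv ?T i x) h = g"
      proof (rule ex1I[of _ h])
        show "h \<in> arrows ?T (Dom ?T g) (Dom ?T (clv ?T i x)) \<and> pArr ?T h = k \<and>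
            Comp ?T (clv ?T i x) h = g"
          using h cg[OF h] by (simp add: arrows_def Tors_simps Tors_clv_simps h_def)
        fix u assume "u \<in> arrows ?T (Dom ?T g) (Dom ?T (clv ?T i x)) \<and> pArr ?T u = k \<and>
            Comp ?T (clv ?T i x) u = g"
        then have u: "u \<in> Arr ?T" "t_src u = t_src g" "t_base u = k"
            "t_tgt u = (Dom C i, torsor_pullback C i (snd x))" "Comp ?T (clv ?T i x) u = g"
          by (simp_all add: arrows_def Tors_simps Tors_clv_simps)
        show "u = h"
        proof (rule Tors_Arr_eqI[OF u(1) h])
          show "t_src u = t_src h" "t_tgt u = t_tgt h" "t_base u = t_base h"
            using u by (simp_all add: h_def)
          show "t_map u j s = t_map h j s"
            if "j \<in> Arr C" "Cod C j = Dom C (t_base u)" "s \<in> Sec (snd (t_src u)) j" for j s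
            using cg[OF u(1,2,4,3)] u that by (simp add: h_def)
        qed
      qed
    qed
  qed
qed

end

section \<open>Automorphisms of torsors\<close>

text \<open>The uniqueness half of the sheaf condition, for the family of restrictions of a section.\<close>

lemma ab_sheaf_separated:
  assumes "site C" "ab_sheaf C B rB" "U \<in> Obj C" "R \<in> Cov C U"
    and b: "b \<in> carrier (B U)" "b' \<in> carrier (B U)" "\<And>i. i \<in> R \<Longrightarrow> rB i b = rB i b'"
  shows "b = b'"
proof -
  interpret site C by fact
  have sh: "is_sheaf C (\<lambda>U. carrier (B U)) rB" using assms(2) by (simp add: ab_sheaf_def)
  then have pre: "is_presheaf C (\<lambda>U. carrier (B U)) rB" by (simp add: is_sheaf_def)
  have R: "i \<in> Arr C" "Cod C i = U" if "i \<in> R" for i using Cov_arrows[OF assms(3,4) that] by simp_all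
  have "\<exists>!t. t \<in> carrier (B U) \<and> (\<forall>i\<in>R. rB i t = rB i b)"
  proof (rule sh[unfolded is_sheaf_def, THEN conjunct2, THEN bspec, THEN bspec, THEN spec, THEN mp])
    show "U \<in> Obj C" "R \<in> Cov C U" by fact+
    have "rB p (rB i b) = rB (i \<cdot>\<^bsub>C\<^esub> p) b" if "i \<in> R" "p \<in> Arr C" "Cod C p = Dom C i" for i p
      using pre R[OF that(1)] that b(1) unfolding is_presheaf_def by metis
    moreover have "rB i b \<in> carrier (B (Dom C i))" if "i \<in> R" for i
      using pre R[OF that] b(1) unfolding is_presheaf_def by (metis PiE)
    ultimately show "(\<forall>i\<in>R. rB i b \<in> carrier (B (Dom C i))) \<and>
        (\<forall>i\<in>R. \<forall>j\<in>R. \<forall>p\<in>Arr C. \<forall>q\<in>Arr C.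
           Cod C p = Dom C i \<and> Cod C q = Dom C j \<and> i \<cdot>\<^bsub>C\<^esub> p = j \<cdot>\<^bsub>C\<^esub> q \<longrightarrow> rB p (rB i b) = rB q (rB j b))"
      by metis
  qed
  then show ?thesis using b by metis
qed

locale torsor_automorphism = site C
  for C :: "('o, 'a, 'm) site_scheme" +
  fixes B :: "'o \<Rightarrow> ('b, 'z) monoid_scheme" and rB :: "'a \<Rightarrow> 'b \<Rightarrow> 'b"
    and U :: 'o and T :: "('a, 'a \<times> 'a, 'b, 't) torsor" and f :: "('o, 'a, 'b, 't) tors_arr"
  assumes sheaf: "ab_sheaf C B rB"
    and automorphism: "f \<in> vert C (Tors C B rB) (U, T) (U, T)"
begin

lemma arrow: "f \<in> Arr (Tors C B rB)" "t_src f = (U, T)" "t_tgt f = (U, T)" "t_base f = Ident C U"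
  using automorphism by (simp_all add: vert_def arrows_def Tors_simps)

lemma base: "U \<in> Obj C" and torsor: "torsor_over C B rB U T"
  using arrow by (simp_all add: Tors_Arr_iff Tors_Obj_iff)

lemma Ident_left: "j \<in> Arr C \<Longrightarrow> Cod C j = U \<Longrightarrow> Ident C U \<cdot>\<^bsub>C\<^esub> j = j"
  using Comp_Ident_left by blast

lemma map_closed: "\<lbrakk>j \<in> Arr C; Cod C j = U; s \<in> Sec T j\<rbrakk> \<Longrightarrow> t_map f j s \<in> Sec T j"
  using Tors_map_closed[OF arrow(1), of j s] arrow Ident_simps[OF base] Ident_left by simp

lemma map_Res:
  assumes "j \<in> Arr C" "Cod C j = U" "s \<in> Sec T j" "k \<in> Arr C" "Cod C k = Dom C j"
  shows "t_map f (j \<cdot>\<^bsub>C\<^esub> k) (Res T (j, k) s) = Res T (j, k) (t_map f j s)"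
  using torsor_map_slice_Res[OF Tors_torsor_map(1)[OF arrow(1)], of j k s] assms arrow Ident_simps[OF base]
    Ident_left[of j] by (simp add: torsor_pullback_def)

lemma map_Act:
  assumes "j \<in> Arr C" "Cod C j = U" "s \<in> Sec T j" "b \<in> carrier (B (Dom C j))"
  shows "t_map f j (Act T j s b) = Act T j (t_map f j s) b"
  using torsor_map_slice_Act[OF Tors_torsor_map(1)[OF arrow(1)], of j s b] assms arrow Ident_simps[OF base]
    Ident_left[of j] by (simp add: torsor_pullback_def)

lemma torsor_ex1:
  assumes "j \<in> Arr C" "Cod C j = U" "s \<in> Sec T j" "t \<in> Sec T j"
  shows "\<exists>!b. b \<in> carrier (B (Dom C j)) \<and> Act T j s b = t"
proof -
  have "j \<in> Obj (slice C U)" using assms by (simp add: slice_simps)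
  then show ?thesis
    using torsor[unfolded torsor_over_def is_torsor_def, THEN conjunct2, THEN conjunct2, THEN conjunct2,
        THEN conjunct1] assms by blast
qed

lemma torsor_Act_mult:
  assumes "j \<in> Arr C" "Cod C j = U" "s \<in> Sec T j" "b \<in> carrier (B (Dom C j))"
    "c \<in> carrier (B (Dom C j))"
  shows "Act T j s (b \<otimes>\<^bsub>B (Dom C j)\<^esub> c) = Act T j (Act T j s b) c"
proof -
  have "j \<in> Obj (slice C U)" using assms by (simp add: slice_simps)
  then show ?thesis
    using torsor[unfolded torsor_over_def is_torsor_def, THEN conjunct2, THEN conjunct1] assms by blast
qed

lemma torsor_Res_Act:
  assumes "j \<in> Arr C" "Cod C j = U" "s \<in> Sec T j" "b \<in> carrier (B (Dom C j))"
    "k \<in> Arr C" "Cod C k = Dom C j"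
  shows "Res T (j, k) (Act T j s b) = Act T (j \<cdot>\<^bsub>C\<^esub> k) (Res T (j, k) s) (rB k b)"
  using torsor[unfolded torsor_over_def is_torsor_def, THEN conjunct2, THEN conjunct2, THEN conjunct1,
      THEN bspec, of "(j, k)"] assms by (simp add: slice_simps)

lemma rB_closed: "k \<in> Arr C \<Longrightarrow> b \<in> carrier (B (Cod C k)) \<Longrightarrow> rB k b \<in> carrier (B (Dom C k))"
  using sheaf by (auto simp: ab_sheaf_def hom_def)

lemma rB_Comp:
  "\<lbrakk>j \<in> Arr C; k \<in> Arr C; Cod C k = Dom C j; b \<in> carrier (B (Cod C j))\<rbrakk>
   \<Longrightarrow> rB (j \<cdot>\<^bsub>C\<^esub> k) b = rB k (rB j b)"
  using sheaf by (simp add: ab_sheaf_def is_sheaf_def is_presheaf_def)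

definition translates :: "'a \<Rightarrow> 'b \<Rightarrow> bool" where
  "translates j b \<longleftrightarrow> b \<in> carrier (B (Dom C j)) \<and> (\<forall>s\<in>Sec T j. t_map f j s = Act T j s b)"

text \<open>A translation seen on one section \<open>s\<close> is seen on every other section \<open>s \<sqdot> c\<close>:
  \<open>f(s c) = f(s) c = s b c = (s c) b\<close>. Commutativity enters in the last step.\<close>

lemma translates_if_section:
  assumes j: "j \<in> Arr C" "Cod C j = U" and s: "s \<in> Sec T j"
    and b: "b \<in> carrier (B (Dom C j))" "t_map f j s = Act T j s b"
  shows "translates j b"
  unfolding translates_def
proof (intro conjI ballI)
  interpret comm_group "B (Dom C j)" using sheaf Dom_closed[OF j(1)] by (simp add: ab_sheaf_def)
  fix t assume t: "t \<in> Sec T j"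
  obtain c where c: "c \<in> carrier (B (Dom C j))" "Act T j s c = t"
    using torsor_ex1[OF j s t] by blast
  have "t_map f j t = Act T j (Act T j s b) c"
    using map_Act[OF j s c(1)] b c by simp
  also have "\<dots> = Act T j s (c \<otimes>\<^bsub>B (Dom C j)\<^esub> b)"
    using torsor_Act_mult[OF j s b(1) c(1)] m_comm[OF b(1) c(1)] by simp
  also have "\<dots> = Act T j t b"
    using torsor_Act_mult[OF j s c(1) b(1)] c by simp
  finally show "t_map f j t = Act T j t b" .
qed (rule b(1))

lemma ex_translates:
  assumes "j \<in> Arr C" "Cod C j = U" "s \<in> Sec T j"
  obtains b where "translates j b"
  using torsor_ex1[OF assms map_closed[OF assms]] translates_if_section[OF assms] by metis

lemma translates_unique:
  assumes "j \<in> Arr C" "Cod C j = U" "s \<in> Sec T j" "translates j b" "translates j c"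
  shows "b = c"
  using torsor_ex1[OF assms(1-3) map_closed[OF assms(1-3)]] assms(3-5)
  unfolding translates_def by metis

lemma translates_restrict:
  assumes j: "j \<in> Arr C" "Cod C j = U" "s \<in> Sec T j" and k: "k \<in> Arr C" "Cod C k = Dom C j"
    and b: "translates j b"
  shows "translates (j \<cdot>\<^bsub>C\<^esub> k) (rB k b)"
proof -
  have jk: "j \<cdot>\<^bsub>C\<^esub> k \<in> Arr C" "Dom C (j \<cdot>\<^bsub>C\<^esub> k) = Dom C k" "Cod C (j \<cdot>\<^bsub>C\<^esub> k) = U"
    using CompD[of k j] j k by simp_all
  have b': "b \<in> carrier (B (Dom C j))" "t_map f j s = Act T j s b"
    using b j(3) by (simp_all add: translates_def)
  show ?thesis
  proof (rule translates_if_section[OF jk(1,3)])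
    show "Res T (j, k) s \<in> Sec T (j \<cdot>\<^bsub>C\<^esub> k)" by (rule torsor_over_closed(2)[OF torsor j k])
    show "rB k b \<in> carrier (B (Dom C (j \<cdot>\<^bsub>C\<^esub> k)))" using rB_closed b' k jk by simp
    show "t_map f (j \<cdot>\<^bsub>C\<^esub> k) (Res T (j, k) s) = Act T (j \<cdot>\<^bsub>C\<^esub> k) (Res T (j, k) s) (rB k b)"
      using map_Res[OF j k] torsor_Res_Act[OF j b'(1) k] b' by simp
  qed
qed

lemma locally_nonempty:
  obtains R where "R \<in> Cov C U" "\<And>i. i \<in> R \<Longrightarrow> i \<in> Arr C" "\<And>i. i \<in> R \<Longrightarrow> Cod C i = U"
    "\<And>i. i \<in> R \<Longrightarrow> Sec T i \<noteq> {}"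
proof -
  have IdO: "Ident C U \<in> Obj (slice C U)" using Ident_simps[OF base] by (simp add: slice_simps)
  then obtain R where R: "R \<in> Cov C U" "\<forall>i\<in>Pair (Ident C U) ` R. Sec T (Dom (slice C U) i) \<noteq> {}"
    using torsor[unfolded torsor_over_def is_torsor_def, THEN conjunct2, THEN conjunct2, THEN conjunct2,
        THEN conjunct2, THEN bspec, OF IdO] Ident_simps[OF base] by (auto simp: slice_simps)
  have "i \<in> Arr C \<and> Cod C i = U" if "i \<in> R" for i by (rule Cov_arrows[OF base R(1) that])
  moreover from this have "Sec T i \<noteq> {}" if "i \<in> R" for i
    using R(2) that Ident_left[of i] by (auto simp: slice_simps)
  ultimately show thesis using that R(1) by blast
qed

text \<open>On a covering \<open>R\<close> with local sections \<open>f\<close> is translation by unique \<open>c i\<close>. By uniqueness these agree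
  on overlaps and glue to \<open>b\<close>. To see that \<open>f\<close> is translation by \<open>b\<close> over an arbitrary \<open>j\<close> with a section,
  where it is translation by some \<open>e\<close>, one compares \<open>e\<close> with \<open>b\<close> on the pullback of \<open>R\<close> along \<open>j\<close>.\<close>

lemma ex1_translation:
  "\<exists>!b. b \<in> carrier (B U) \<and> (\<forall>j\<in>Obj (slice C U). \<forall>s\<in>Sec T j. t_map f j s = Act T j s (rB j b))"
proof -
  obtain R where R: "R \<in> Cov C U" "\<And>i. i \<in> R \<Longrightarrow> i \<in> Arr C" "\<And>i. i \<in> R \<Longrightarrow> Cod C i = U"
      "\<And>i. i \<in> R \<Longrightarrow> Sec T i \<noteq> {}"
    using locally_nonempty by blast
  have "\<exists>b. translates i b" if "i \<in> R" for i
    using R(4)[OF that] ex_translates[OF R(2,3)[OF that]] by blast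
  then obtain c where c: "translates i (c i)" if "i \<in> R" for i by metis
  then have cB: "c i \<in> carrier (B (Dom C i))" if "i \<in> R" for i using that by (simp add: translates_def)
  have "\<exists>!b. b \<in> carrier (B U) \<and> (\<forall>i\<in>R. rB i b = c i)"
  proof (rule sheaf[unfolded ab_sheaf_def is_sheaf_def, THEN conjunct2, THEN conjunct2, THEN conjunct2,
        THEN bspec, THEN bspec, THEN spec, THEN mp])
    show "U \<in> Obj C" "R \<in> Cov C U" by (rule base R)+
    show "(\<forall>i\<in>R. c i \<in> carrier (B (Dom C i))) \<and>
        (\<forall>i\<in>R. \<forall>j\<in>R. \<forall>p\<in>Arr C. \<forall>q\<in>Arr C.
           Cod C p = Dom C i \<and> Cod C q = Dom C j \<and> i \<cdot>\<^bsub>C\<^esub> p = j \<cdot>\<^bsub>C\<^esub> q \<longrightarrow> rB p (c i) = rB q (c j))"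
    proof (intro conjI ballI impI)
      fix i j p q assume i: "i \<in> R" and j: "j \<in> R" and p: "p \<in> Arr C" and q: "q \<in> Arr C"
        and e: "Cod C p = Dom C i \<and> Cod C q = Dom C j \<and> i \<cdot>\<^bsub>C\<^esub> p = j \<cdot>\<^bsub>C\<^esub> q"
      obtain s t where s: "s \<in> Sec T i" and t: "t \<in> Sec T j" using R(4) i j by blast
      have ip: "i \<cdot>\<^bsub>C\<^esub> p \<in> Arr C" "Cod C (i \<cdot>\<^bsub>C\<^esub> p) = U" using CompD[of p i] R i p e by simp_all
      have "Res T (i, p) s \<in> Sec T (i \<cdot>\<^bsub>C\<^esub> p)"
        using torsor_over_closed(2)[OF torsor R(2,3)[OF i] s p] e by simp
      moreover have "translates (i \<cdot>\<^bsub>C\<^esub> p) (rB p (c i))"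
        using translates_restrict[OF R(2,3)[OF i] s p _ c[OF i]] e by simp
      moreover have "translates (i \<cdot>\<^bsub>C\<^esub> p) (rB q (c j))"
        using translates_restrict[OF R(2,3)[OF j] t q _ c[OF j]] e by simp
      ultimately show "rB p (c i) = rB q (c j)" by (rule translates_unique[OF ip])
    qed (rule cB)
  qed
  then obtain b where b: "b \<in> carrier (B U)" "\<And>i. i \<in> R \<Longrightarrow> rB i b = c i" by blast
  show ?thesis
  proof (rule ex1I[of _ b], intro conjI ballI)
    fix j s assume "j \<in> Obj (slice C U)" and s: "s \<in> Sec T j"
    then have j: "j \<in> Arr C" "Cod C j = U" by (simp_all add: slice_simps)
    obtain e where e: "translates j e" by (rule ex_translates[OF j s])
    have "\<exists>p q. is_pullback C i j p q" if "i \<in> R" for i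
      using fibre_products[OF R(2)[OF that] j(1)] R(3)[OF that] j(2) by simp
    then obtain p q where pq: "is_pullback C i j (p i) (q i)" if "i \<in> R" for i by metis
    have qR: "q ` R \<in> Cov C (Dom C j)"
      using Cov_pullback[OF j(1), of R q] R(1) j(2) pq by blast
    have "e = rB j b"
    proof (rule ab_sheaf_separated[OF site_axioms sheaf Dom_closed[OF j(1)] qR])
      show "e \<in> carrier (B (Dom C j))" using e by (simp add: translates_def)
      show "rB j b \<in> carrier (B (Dom C j))" using rB_closed j b by simp
      fix k assume "k \<in> q ` R"
      then obtain i where i: "i \<in> R" "k = q i" by blast
      have k: "p i \<in> Arr C" "k \<in> Arr C" "Cod C (p i) = Dom C i" "Cod C k = Dom C j"
          "i \<cdot>\<^bsub>C\<^esub> p i = j \<cdot>\<^bsub>C\<^esub> k"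
        using pq[OF i(1)] i(2) by (simp_all add: is_pullback_def)
      obtain t where t: "t \<in> Sec T i" using R(4)[OF i(1)] by blast
      have jk: "j \<cdot>\<^bsub>C\<^esub> k \<in> Arr C" "Cod C (j \<cdot>\<^bsub>C\<^esub> k) = U" using CompD[of k j] j k by simp_all
      have "rB k e = rB (p i) (c i)"
      proof (rule translates_unique[OF jk])
        show "Res T (j, k) s \<in> Sec T (j \<cdot>\<^bsub>C\<^esub> k)" by (rule torsor_over_closed(2)[OF torsor j s k(2,4)])
        show "translates (j \<cdot>\<^bsub>C\<^esub> k) (rB k e)" by (rule translates_restrict[OF j s k(2,4) e])
        show "translates (j \<cdot>\<^bsub>C\<^esub> k) (rB (p i) (c i))"
          using translates_restrict[OF R(2,3)[OF i(1)] t k(1,3) c[OF i(1)]] k(5) by simp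
      qed
      also have "\<dots> = rB (i \<cdot>\<^bsub>C\<^esub> p i) b"
        using rB_Comp[of i "p i" b] R(2,3)[OF i(1)] k b i(1) by simp
      also have "\<dots> = rB k (rB j b)"
        using rB_Comp[of j k b] j k b by simp
      finally show "rB k e = rB k (rB j b)" .
    qed
    then show "t_map f j s = Act T j s (rB j b)" using e s by (simp add: translates_def)
  next
    fix b' assume b': "b' \<in> carrier (B U) \<and>
        (\<forall>j\<in>Obj (slice C U). \<forall>s\<in>Sec T j. t_map f j s = Act T j s (rB j b'))"
    show "b' = b"
    proof (rule ab_sheaf_separated[OF site_axioms sheaf base R(1)])
      fix i assume i: "i \<in> R"
      obtain s where s: "s \<in> Sec T i" using R(4)[OF i] by blast
      have "translates i (rB i b')"
        using b' R(2,3)[OF i] rB_closed[of i b'] by (auto simp: translates_def slice_simps)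
      then have "rB i b' = c i" by (rule translates_unique[OF R(2,3)[OF i] s _ c[OF i]])
      then show "rB i b' = rB i b" using b(2)[OF i] by simp
    qed (use b b' in blast)+
  qed (rule b(1))
qed

lemma Tors_band_eq_iff:
  assumes "c \<in> carrier (B U)"
  shows "Tors_band C B rB (U, T) f = c \<longleftrightarrow>
    (\<forall>j\<in>Obj (slice C U). \<forall>s\<in>Sec T j. t_map f j s = Act T j s (rB j c))"
proof -
  have "Tors_band C B rB (U, T) f = c \<longleftrightarrow> c \<in> carrier (B U) \<and>
      (\<forall>j\<in>Obj (slice C U). \<forall>s\<in>Sec T j. t_map f j s = Act T j s (rB j c))"
    unfolding Tors_band_def fst_conv snd_conv
    using theI'[OF ex1_translation] the1_equality[OF ex1_translation, of c] by auto
  then show ?thesis using assms by simp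
qed

end

section \<open>Structures bound by a complex and connective structures\<close>

lemma is_connective_iff:
  "is_connective C G a B rB \<delta> \<C> \<longleftrightarrow> pseudonatural C G (Tors C B rB) \<C> \<and>
     (\<forall>x\<in>Obj G. \<forall>f\<in>carrier (aut_group C G x).
        \<forall>j\<in>Obj (slice C (pObj G x)). \<forall>s\<in>Sec (snd (Co \<C> x)) j.
          t_map (push \<C> f) j s = Act (snd (Co \<C> x)) j s (rB j (\<delta> (pObj G x) (a x f))))"
  unfolding is_connective_def pseudonatural_def Let_def
  by (rule iffI; elim conjE; intro conjI; assumption)

text \<open>The bijection of cartesian functors with pseudonatural transformations respects the conditions
  on automorphisms, because \<open>push\<close> agrees with the functor on them and \<^const>\<open>Tors_band\<close> detects
  translations.\<close>

theorem bij_betw_bound_structures: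
  fixes B :: "'o \<Rightarrow> ('b, 'z) monoid_scheme" and G :: "('x, 'f, 'o, 'a, 'n) fibcat_scheme"
  assumes "site C" and B: "ab_sheaf C B rB" and \<delta>: "ab_sheaf_hom C A rA B rB \<delta>"
    and "banded_gerbe C A rA G a"
  shows "bij_betw (conn_of C G (Tors C B rB))
    (bound_structures C G a B rB \<delta>
       :: ('x, 'f, 'o \<times> ('a, 'a \<times> 'a, 'b, 't) torsor, ('o, 'a, 'b, 't) tors_arr) fun_data set)
    {\<C>. is_connective C G a B rB \<delta> \<C>}"
proof -
  interpret banded_gerbe C A rA G a by fact
  let ?T = "Tors C B rB :: ('o \<times> ('a, 'a \<times> 'a, 'b, 't) torsor, ('o, 'a, 'b, 't) tors_arr, 'o, 'a) fibcat"
  interpret T: fibration C ?T by (rule Tors_fibration)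
  interpret pair: fibration_pair C G ?T by unfold_locales (rule vert_iso)
  have band: "(\<forall>x\<in>Obj G. \<forall>f\<in>carrier (aut_group C G x).
        Tors_band C B rB (FObj \<mu> x) (FArr \<mu> f) = \<delta> (pObj G x) (a x f)) \<longleftrightarrow>
      (\<forall>x\<in>Obj G. \<forall>f\<in>carrier (aut_group C G x).
        \<forall>j\<in>Obj (slice C (pObj G x)). \<forall>s\<in>Sec (snd (Co (conn_of C G ?T \<mu>) x)) j.
          t_map (push (conn_of C G ?T \<mu>) f) j s =
            Act (snd (Co (conn_of C G ?T \<mu>) x)) j s (rB j (\<delta> (pObj G x) (a x f))))"
    if \<mu>: "cartesian_functor C G ?T \<mu>" for \<mu>
  proof (intro ball_cong refl)
    interpret F: functor_over C G ?T \<mu> by unfold_locales (rule \<mu>)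
    fix x f assume x: "x \<in> Obj G" and "f \<in> carrier (aut_group C G x)"
    then have f: "f \<in> vert C G x x" and af: "a x f \<in> carrier (A (pObj G x))"
      using band_iso[OF x] by (auto simp: aut_group_def iso_def hom_def)
    obtain U S where US: "FObj \<mu> x = (U, S)" by (cases "FObj \<mu> x")
    then have U: "U = pObj G x" using F.FObj_simps[OF x] by (simp add: Tors_simps)
    have closed: "\<delta> (pObj G x) (a x f) \<in> carrier (B U)"
      using \<delta> af pObj_closed[OF x] U by (auto simp: ab_sheaf_hom_def hom_def)
    interpret f: torsor_automorphism C B rB U S "FArr \<mu> f"
      using F.FArr_vert[OF f] B by unfold_locales (simp_all add: US)
    from f.Tors_band_eq_iff[OF closed]
    show "(Tors_band C B rB (FObj \<mu> x) (FArr \<mu> f) = \<delta> (pObj G x) (a x f)) =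
      (\<forall>j\<in>Obj (slice C (pObj G x)). \<forall>s\<in>Sec (snd (Co (conn_of C G ?T \<mu>) x)) j.
          t_map (push (conn_of C G ?T \<mu>) f) j s =
            Act (snd (Co (conn_of C G ?T \<mu>) x)) j s (rB j (\<delta> (pObj G x) (a x f))))"
      using F.push[OF f] US U by (simp add: conn_of_def)
  qed
  note bij = pair.bij_betw_conn_of
  show ?thesis
    unfolding bij_betw_def
  proof
    show "inj_on (conn_of C G ?T) (bound_structures C G a B rB \<delta>)"
      using bij by (auto simp: bij_betw_def bound_structures_def delta_morphism_def inj_on_def)
    show "conn_of C G ?T ` bound_structures C G a B rB \<delta> = {\<C>. is_connective C G a B rB \<delta> \<C>}"
    proof (intro equalityI subsetI)
      fix \<C> :: "('x, 'f, 'a, 'o \<times> ('a, 'a \<times> 'a, 'b, 't) torsor, ('o, 'a, 'b, 't) tors_arr) conn_data"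
      assume "\<C> \<in> conn_of C G ?T ` bound_structures C G a B rB \<delta>"
      then obtain \<mu> where \<mu>: "delta_morphism C G a ?T (Tors_band C B rB) \<delta> \<mu>" "\<C> = conn_of C G ?T \<mu>"
        by (auto simp: bound_structures_def)
      then have "cartesian_functor C G ?T \<mu>" by (simp add: delta_morphism_def)
      then show "\<C> \<in> {\<C>. is_connective C G a B rB \<delta> \<C>}"
        using \<mu> band bij_betwE[OF bij] by (simp add: is_connective_iff delta_morphism_def)
    next
      fix \<C> :: "('x, 'f, 'a, 'o \<times> ('a, 'a \<times> 'a, 'b, 't) torsor, ('o, 'a, 'b, 't) tors_arr) conn_data"
      assume "\<C> \<in> {\<C>. is_connective C G a B rB \<delta> \<C>}"
      then have \<C>: "is_connective C G a B rB \<delta> \<C>" by simp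
      then have "\<C> \<in> conn_of C G ?T ` {\<mu>. cartesian_functor C G ?T \<mu>}"
        using bij by (simp add: bij_betw_def is_connective_iff)
      then obtain \<mu> where \<mu>: "cartesian_functor C G ?T \<mu>" "\<C> = conn_of C G ?T \<mu>" by blast
      then have "delta_morphism C G a ?T (Tors_band C B rB) \<delta> \<mu>"
        using \<C> band[OF \<mu>(1)] by (simp add: is_connective_iff delta_morphism_def)
      then show "\<C> \<in> conn_of C G ?T ` bound_structures C G a B rB \<delta>"
        using \<mu>(2) by (simp add: bound_structures_def)
    qed
  qed
qed

theorem proposition2p2p3:
  fixes C :: "('o, 'a, 'm) site_scheme" and X :: 'o
    and \<O> :: "'o \<Rightarrow> ('r, 'y) ring_scheme" and r\<O> :: "'a \<Rightarrow> 'r \<Rightarrow> 'r"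
    and \<Omega> :: "'o \<Rightarrow> ('r, 'w, 'z) module_scheme" and r\<Omega> :: "'a \<Rightarrow> 'w \<Rightarrow> 'w"
    and d :: "'o \<Rightarrow> 'r \<Rightarrow> 'w"
    and G :: "('x, 'f, 'o, 'a, 'n) fibcat_scheme" and a :: "'x \<Rightarrow> 'f \<Rightarrow> 'r"
  assumes "site_with_forms C X \<O> r\<O> \<Omega> r\<Omega> d"
    and "banded_gerbe C (invertibles \<O>) r\<O> G a"
  shows "bij_betw (conn_of C G (Tors C (forms \<Omega>) r\<Omega>))
    (bound_structures C G a (forms \<Omega>) r\<Omega> (dlog \<O> \<Omega> d)
       :: ('x, 'f, 'o \<times> ('a, 'a \<times> 'a, 'w, 't) torsor, ('o, 'a, 'w, 't) tors_arr) fun_data set)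
    (connective_structures C G a \<O> \<Omega> r\<Omega> d)"
proof -
  interpret site_with_forms C X \<O> r\<O> \<Omega> r\<Omega> d by fact
  show ?thesis
    unfolding connective_structures_def
    by (rule bij_betw_bound_structures[OF site_axioms forms_sheaf dlog_sheaf_hom assms(2)])
qed

end
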